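(* Let $G=SL(n+1,\mathbb{C})$ with $n\ge 1$, let $\omega_1,\dots,\omega_n$ be its fundamental dominant weights, let $1\le i\le n$, and let $\lambda=\omega_i$. Let $d=\dim(G/P_\lambda)$, let $HS_\lambda(x)=\dfrac{g(x)}{(1-x)^{d+1}}$ be the Hilbert series of the equivariantly embedded partial flag variety $X_\lambda\cong G/P_\lambda$, and let $a_1$ be the coefficient of $x$ in the numerator polynomial $g(x)$. Then $$a_1=\binom{n+1}{i}-\bigl(i(n-i+1)+1\bigr).$$
   Context: Fix a Borel subgroup $B\subset G$ and a maximal torus $T\subset B$, with simple roots $\alpha_1,\dots,\alpha_n$ in the standard ordering (the positive roots are the sums of consecutive simple roots $\alpha_k+\alpha_{k+1}+\dots+\alpha_l$, $1\le k\le l\le n$) and $\omega_1,\dots,\omega_n$ the corresponding fundamental dominant weights. For a dominant integral weight $\mu$ of $G$, $L(\mu)$ denotes the irreducible representation of $G$ with highest weight $\mu$. Given a dominant integral weight $\lambda$, let $f\in L^*(\lambda)$ generate the unique $B$-stable line in the dual representation $L^*(\lambda)$. $P_\lambda\subseteq G$ is the parabolic subgroup stabilizing that line; equivalently, $P_\lambda$ is the stabilizer of the hyperplane $H\subset L(\lambda)$ annihilated by $f$. Let $\mathbb{P}^*(L(\lambda))$ be the projective space of hyperplanes in $L(\lambda)$. The map $\pi_\lambda:G/P_\lambda\to\mathbb{P}^*(L(\lambda))$, $gP_\lambda\mapsto g(H)$, is an equivariant embedding, and $X_\lambda$ denotes its image. $HS_\lambda(x)$ is the Hilbert series of $X_\lambda\subseteq\mathbb{P}^*(L(\lambda))$,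 i.e. $\sum_{m\ge 0}h(m)x^m$, where $h(m)$ is the dimension over $\mathbb{C}$ of the degree-$m$ component of the homogeneous coordinate ring of $X_\lambda$. *)

theory Defs
  imports
    "Jordan_Normal_Form.Determinant"
    "HOL-Algebra.Coset"
    "HOL-Analysis.Abstract_Topology"
    "HOL-Library.Poly_Mapping"
    "HOL-Library.Extended_Nat"
    "HOL-Computational_Algebra.Polynomial_FPS"
begin

section \<open>Multivariate polynomials over the complex numbers\<close>

text \<open>A monomial is a finitely supported exponent vector \<open>'v \<Rightarrow>\<^sub>0 nat\<close>, a polynomial a finitely
  supported family of coefficients indexed by monomials.\<close>

type_synonym 'v cpoly = "('v \<Rightarrow>\<^sub>0 nat) \<Rightarrow>\<^sub>0 complex"

definition polys_in :: "'v set \<Rightarrow> 'v cpoly set" where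
  "polys_in V = {p. \<forall>a\<in>Poly_Mapping.keys p. Poly_Mapping.keys a \<subseteq> V}"

definition eval_poly :: "'v cpoly \<Rightarrow> ('v \<Rightarrow> complex) \<Rightarrow> complex" where
  "eval_poly p x = (\<Sum>a\<in>Poly_Mapping.keys p.
     Poly_Mapping.lookup p a * (\<Prod>v\<in>Poly_Mapping.keys a. x v ^ Poly_Mapping.lookup a v))"

definition homogeneous_polys :: "'v set \<Rightarrow> nat \<Rightarrow> 'v cpoly set" where
  "homogeneous_polys V m = {p \<in> polys_in V.
     \<forall>a\<in>Poly_Mapping.keys p. (\<Sum>v\<in>Poly_Mapping.keys a. Poly_Mapping.lookup a v) = m}"

lemma vector_space_cpoly:
  "vector_space (\<lambda>c :: complex. Poly_Mapping.map ((*) c) :: 'v cpoly \<Rightarrow> 'v cpoly)"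
  by unfold_locales
    (auto intro!: poly_mapping_eqI simp: Poly_Mapping.map.rep_eq lookup_add when_def algebra_simps
      simp flip: distrib_left)

definition poly_dim :: "'v cpoly set \<Rightarrow> nat" where
  "poly_dim S = vector_space.dim (\<lambda>c. Poly_Mapping.map ((*) c)) S"


section \<open>Krull dimension and quotient spaces\<close>

definition irreducible_closedin :: "'a topology \<Rightarrow> 'a set \<Rightarrow> bool" where
  "irreducible_closedin X Z \<longleftrightarrow> closedin X Z \<and> Z \<noteq> {} \<and>
     (\<forall>A B. closedin X A \<and> closedin X B \<and> Z \<subseteq> A \<union> B \<longrightarrow> Z \<subseteq> A \<or> Z \<subseteq> B)"

definition krull_dim :: "'a topology \<Rightarrow> enat" where
  "krull_dim X = Sup {enat k | k. \<exists>Z :: nat \<Rightarrow> 'a set.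
     (\<forall>j\<le>k. irreducible_closedin X (Z j)) \<and> (\<forall>j<k. Z j \<subset> Z (Suc j))}"

definition quotient_topology :: "'a topology \<Rightarrow> ('a \<Rightarrow> 'b) \<Rightarrow> 'b topology" where
  "quotient_topology X q =
     topology (\<lambda>U. U \<subseteq> q ` topspace X \<and> openin X {x \<in> topspace X. q x \<in> U})"

lemma openin_quotient_topology:
  "openin (quotient_topology X q) U \<longleftrightarrow>
     U \<subseteq> q ` topspace X \<and> openin X {x \<in> topspace X. q x \<in> U}"
proof -
  have "istopology (\<lambda>U. U \<subseteq> q ` topspace X \<and> openin X {x \<in> topspace X. q x \<in> U})"
    unfolding istopology_def
  proof (intro conjI allI impI)
    fix S T
    assume S: "S \<subseteq> q ` topspace X \<and> openin X {x \<in> topspace X. q x \<in> S}"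
      and T: "T \<subseteq> q ` topspace X \<and> openin X {x \<in> topspace X. q x \<in> T}"
    have "{x \<in> topspace X. q x \<in> S \<inter> T}
        = {x \<in> topspace X. q x \<in> S} \<inter> {x \<in> topspace X. q x \<in> T}" by auto
    then show "openin X {x \<in> topspace X. q x \<in> S \<inter> T}" using S T by auto
    show "S \<inter> T \<subseteq> q ` topspace X" using S by auto
  next
    fix K
    assume K: "\<forall>S\<in>K. S \<subseteq> q ` topspace X \<and> openin X {x \<in> topspace X. q x \<in> S}"
    have "{x \<in> topspace X. q x \<in> \<Union>K} = (\<Union>S\<in>K. {x \<in> topspace X. q x \<in> S})" by auto
    then show "openin X {x \<in> topspace X. q x \<in> \<Union>K}" using K by auto
    show "\<Union>K \<subseteq> q ` topspace X" using K by auto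
  qed
  then show ?thesis by (simp add: quotient_topology_def)
qed


section \<open>The group SL(n+1,C), its standard Borel subgroup and torus\<close>

definition GL :: "nat \<Rightarrow> complex mat monoid" where
  "GL N = \<lparr>carrier = {A \<in> carrier_mat N N. det A \<noteq> 0}, mult = (*), one = 1\<^sub>m N\<rparr>"

definition SL :: "nat \<Rightarrow> complex mat monoid" where
  "SL N = \<lparr>carrier = {A \<in> carrier_mat N N. det A = 1}, mult = (*), one = 1\<^sub>m N\<rparr>"

definition borel :: "nat \<Rightarrow> complex mat set" where
  "borel n = {b \<in> carrier (SL (n+1)). upper_triangular b}"

definition torus :: "nat \<Rightarrow> complex mat set" where
  "torus n = {t \<in> carrier (SL (n+1)). diagonal_mat t}"

text \<open>Weights are written multiplicatively, as characters of the torus. With respect to the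
  upper triangular Borel subgroup and 0-based matrix indices the simple root \<open>\<alpha>\<^sub>j\<close> is
  \<open>t \<mapsto> t\<^bsub>j-1\<^esub> / t\<^bsub>j\<^esub>\<close>, and \<open>\<omega>\<^sub>i\<close> is \<open>t \<mapsto> t\<^bsub>0\<^esub> \<cdots> t\<^bsub>i-1\<^esub>\<close>; the lemma below is the defining
  duality with the simple coroots.\<close>

definition fundamental_weight :: "nat \<Rightarrow> complex mat \<Rightarrow> complex" where
  "fundamental_weight i t = (\<Prod>k<i. t $$ (k, k))"

definition simple_coroot :: "nat \<Rightarrow> nat \<Rightarrow> complex \<Rightarrow> complex mat" where
  "simple_coroot n j s = mat (n+1) (n+1) (\<lambda>(r, c).
     if r \<noteq> c then 0 else if r = j - 1 then s else if r = j then inverse s else 1)"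

lemma fundamental_weight_coroot:
  assumes "1 \<le> i" "i \<le> n" "1 \<le> j" "j \<le> n" "s \<noteq> 0"
  shows "fundamental_weight i (simple_coroot n j s) = (if i = j then s else 1)"
proof -
  have eq: "fundamental_weight i (simple_coroot n j s)
      = (\<Prod>k<i. (if k = j - 1 then s else 1) * (if k = j then inverse s else 1))"
    unfolding fundamental_weight_def
    by (rule prod.cong) (use assms in \<open>auto simp: simple_coroot_def\<close>)
  show ?thesis
    unfolding eq prod.distrib using assms by (auto simp: prod.delta)
qed


section \<open>Rational representations on coordinate spaces\<close>

definition rational_rep :: "nat \<Rightarrow> nat \<Rightarrow> (complex mat \<Rightarrow> complex mat) \<Rightarrow> bool" where
  "rational_rep n N \<rho> \<longleftrightarrow> \<rho> \<in> hom (SL (n+1)) (GL N) \<and>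
     (\<forall>r<N. \<forall>c<N. \<exists>p\<in>polys_in ({..<n+1} \<times> {..<n+1}).
        \<forall>g\<in>carrier (SL (n+1)). \<rho> g $$ (r, c) = eval_poly p (($$) g))"

definition linear_subspace :: "nat \<Rightarrow> complex vec set \<Rightarrow> bool" where
  "linear_subspace N W \<longleftrightarrow> W \<subseteq> carrier_vec N \<and> 0\<^sub>v N \<in> W \<and>
     (\<forall>v\<in>W. \<forall>w\<in>W. v + w \<in> W) \<and> (\<forall>c. \<forall>v\<in>W. c \<cdot>\<^sub>v v \<in> W)"

definition irreducible_rep :: "nat \<Rightarrow> nat \<Rightarrow> (complex mat \<Rightarrow> complex mat) \<Rightarrow> bool" where
  "irreducible_rep n N \<rho> \<longleftrightarrow> N > 0 \<and>
     (\<forall>W. linear_subspace N W \<and> (\<forall>g\<in>carrier (SL (n+1)). \<forall>w\<in>W. \<rho> g *\<^sub>v w \<in> W)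
        \<longrightarrow> W = {0\<^sub>v N} \<or> W = carrier_vec N)"

definition line :: "complex vec \<Rightarrow> complex vec set" where
  "line v = {c \<cdot>\<^sub>v v | c. True}"

definition line_stabilizer :: "nat \<Rightarrow> (complex mat \<Rightarrow> complex mat) \<Rightarrow> complex vec \<Rightarrow> complex mat set" where
  "line_stabilizer n \<rho> v = {g \<in> carrier (SL (n+1)). (\<lambda>w. \<rho> g *\<^sub>v w) ` line v = line v}"

definition has_highest_weight ::
    "nat \<Rightarrow> nat \<Rightarrow> (complex mat \<Rightarrow> complex mat) \<Rightarrow> (complex mat \<Rightarrow> complex) \<Rightarrow> bool" where
  "has_highest_weight n N \<rho> \<mu> \<longleftrightarrow>
     (\<exists>v\<in>carrier_vec N. v \<noteq> 0\<^sub>v N \<and> borel n \<subseteq> line_stabilizer n \<rho> v \<and>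
        (\<forall>t\<in>torus n. \<rho> t *\<^sub>v v = \<mu> t \<cdot>\<^sub>v v))"

text \<open>\<open>(N, \<rho>)\<close> is a model of \<open>L(\<mu>)\<close>, which is determined up to isomorphism.\<close>

definition is_L :: "nat \<Rightarrow> (complex mat \<Rightarrow> complex) \<Rightarrow> nat \<Rightarrow> (complex mat \<Rightarrow> complex mat) \<Rightarrow> bool" where
  "is_L n \<mu> N \<rho> \<longleftrightarrow>
     rational_rep n N \<rho> \<and> irreducible_rep n N \<rho> \<and> has_highest_weight n N \<rho> \<mu>"

text \<open>A functional on \<open>C\<^sup>N\<close> is represented by the vector \<open>f\<close> with value \<open>f \<bullet> v\<close> at \<open>v\<close>, so the
  contragredient action is by inverse transposes.\<close>

definition dual_rep :: "nat \<Rightarrow> (complex mat \<Rightarrow> complex mat) \<Rightarrow> complex mat \<Rightarrow> complex mat" where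
  "dual_rep n \<rho> g = transpose_mat (\<rho> (inv\<^bsub>SL (n+1)\<^esub> g))"

definition hyperplane :: "nat \<Rightarrow> complex vec \<Rightarrow> complex vec set" where
  "hyperplane N f = {v \<in> carrier_vec N. f \<bullet> v = 0}"


section \<open>The flag variety and its projective embedding\<close>

definition generates_B_stable_dual_line ::
    "nat \<Rightarrow> nat \<Rightarrow> (complex mat \<Rightarrow> complex mat) \<Rightarrow> complex vec \<Rightarrow> bool" where
  "generates_B_stable_dual_line n N \<rho> f \<longleftrightarrow>
     f \<in> carrier_vec N \<and> f \<noteq> 0\<^sub>v N \<and> borel n \<subseteq> line_stabilizer n (dual_rep n \<rho>) f"

definition parabolic :: "nat \<Rightarrow> (complex mat \<Rightarrow> complex mat) \<Rightarrow> complex vec \<Rightarrow> complex mat set" where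
  "parabolic n \<rho> f = line_stabilizer n (dual_rep n \<rho>) f"

definition zariski_SL :: "nat \<Rightarrow> complex mat topology" where
  "zariski_SL n = topology_generated_by
     {{g \<in> carrier (SL (n+1)). eval_poly p (($$) g) \<noteq> 0} | p. p \<in> polys_in ({..<n+1} \<times> {..<n+1})}"

text \<open>The space of left cosets \<open>gP\<close> with the quotient of the Zariski topology, which is the
  Zariski topology of the variety \<open>G/P\<close>.\<close>

definition flag_space :: "nat \<Rightarrow> complex mat set \<Rightarrow> complex mat set topology" where
  "flag_space n P = quotient_topology (zariski_SL n) (\<lambda>g. g <#\<^bsub>SL (n+1)\<^esub> P)"

definition flag_image :: "nat \<Rightarrow> nat \<Rightarrow> (complex mat \<Rightarrow> complex mat) \<Rightarrow> complex vec \<Rightarrow> complex vec set set" where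
  "flag_image n N \<rho> f = (\<lambda>g. (\<lambda>v. \<rho> g *\<^sub>v v) ` hyperplane N f) ` carrier (SL (n+1))"


section \<open>Hilbert series of a set of hyperplanes\<close>

text \<open>A point of the projective space of hyperplanes in \<open>C\<^sup>N\<close> has as homogeneous coordinates
  the coordinates of any functional defining it, which is unique up to a nonzero scalar.\<close>

definition vanishing_polys :: "nat \<Rightarrow> complex vec set set \<Rightarrow> nat \<Rightarrow> nat cpoly set" where
  "vanishing_polys N X m = {p \<in> homogeneous_polys {..<N} m.
     \<forall>f\<in>carrier_vec N. f \<noteq> 0\<^sub>v N \<and> hyperplane N f \<in> X \<longrightarrow> eval_poly p (($) f) = 0}"

text \<open>The dimension of the degree-\<open>m\<close> component \<open>S\<^sub>m / I(X)\<^sub>m\<close> of the homogeneous coordinate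
  ring; the subtraction does not truncate, as \<open>I(X)\<^sub>m\<close> is a subspace of the finite-dimensional
  space \<open>S\<^sub>m\<close>.\<close>

definition hilbert_function :: "nat \<Rightarrow> complex vec set set \<Rightarrow> nat \<Rightarrow> nat" where
  "hilbert_function N X m =
     poly_dim (homogeneous_polys {..<N} m) - poly_dim (vanishing_polys N X m)"

definition hilbert_series :: "nat \<Rightarrow> complex vec set set \<Rightarrow> rat fps" where
  "hilbert_series N X = Abs_fps (\<lambda>m. of_nat (hilbert_function N X m))"

end

theory Submission
  imports Defs "HOL-Computational_Algebra.Fundamental_Theorem_Algebra"
begin

text \<open>Put \<open>m = n + 1\<close> and \<open>k = m - i\<close>. Comparing coefficients in \<open>g = HS (1 - x)\<^sup>d\<^sup>+\<^sup>1\<close> gives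
  \<open>a\<^sub>1 = h(1) - (d + 1) h(0)\<close>. Here \<open>h(0) = 1\<close> because the variety has a point, and \<open>h(1) = N\<close>: a linear
  form that vanishes on the variety is a vector of the representation that is annihilated by all translates of
  the functional \<open>f\<close>, hence zero by irreducibility. It remains to show that \<open>N\<close> is the binomial
  coefficient \<open>m\<close> choose \<open>i\<close> and that \<open>d = i k\<close>.

  Everything about the representation follows from one formula (\<open>coefficient_is_minor\<close>). Let \<open>v\<close> be the
  highest weight vector. The matrix coefficient \<open>g \<mapsto> f(\<rho>(g) v)\<close> is invariant under left translation by
  upper unitriangular matrices, and right translation by \<open>b\<close> in the Borel subgroup multiplies it by the
  weight \<open>\<omega>\<^sub>i(b)\<close>. The minor of \<open>g\<close> in the last \<open>i\<close> rows and first \<open>i\<close> columns has the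
  same two properties. If \<open>w\<close> is the long element of the Weyl group, the products \<open>u w b\<close> are dense in
  the group, so a polynomial function with these properties is determined by its value at \<open>w\<close>
  (\<open>big_cell_dense\<close>), and the coefficient is a nonzero multiple of the minor.
  By irreducibility a vector \<open>u\<close> is determined by the function \<open>g \<mapsto> f(\<rho>(g) u)\<close>
  (\<open>separation\<close>), so identities between minors become identities between vectors. Left translations that rescale the minor are the block upper triangular
  matrices, so these form the stabilizer \<open>P\<close> of the line of \<open>f\<close> (\<open>parabolic_block\<close>). Right
  translates of the minor are spanned by the minors in the last \<open>i\<close> rows and arbitrary columns, which are
  linearly independent, so the representation has the dimension claimed (\<open>dimension\<close>).

  The quotient by \<open>P\<close> is covered by translates of the big cell of block unipotent matrices, which is an
  affine space with \<open>i k\<close> coordinates. A chain of irreducible closed sets restricts to a chain in the cell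
  around a point of its smallest member. Functions \<open>f\<^sub>l\<close> that vanish on the \<open>l\<close>-th member but not on
  the next one are algebraically independent (\<open>chain_independence\<close>), while counting monomials shows that
  more than \<open>i k\<close> polynomials in \<open>i k\<close> variables are dependent (\<open>algebraic_dependence\<close>); so the
  chain has length at most \<open>i k\<close>. The closures of the coordinate subspaces of the cell attain this bound.\<close>

section \<open>Polynomial functions\<close>

text \<open>Polynomial functions generated by rules rather than through coefficients: all closure properties
  below become inductions, and coefficients are needed only in the counting argument for algebraic dependence.\<close>

inductive polyfun :: "'v set \<Rightarrow> (('v \<Rightarrow> complex) \<Rightarrow> complex) \<Rightarrow> bool" for V where
  const: "polyfun V (\<lambda>_. c)"
| var: "v \<in> V \<Longrightarrow> polyfun V (\<lambda>x. x v)"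
| add: "polyfun V F \<Longrightarrow> polyfun V G \<Longrightarrow> polyfun V (\<lambda>x. F x + G x)"
| mult: "polyfun V F \<Longrightarrow> polyfun V G \<Longrightarrow> polyfun V (\<lambda>x. F x * G x)"

lemma polyfun_diff:
  assumes "polyfun V F" "polyfun V G" shows "polyfun V (\<lambda>x. F x - G x)"
  using polyfun.add[OF assms(1) polyfun.mult[OF polyfun.const[of V "-1"] assms(2)]] by simp

lemma polyfun_sum: "(\<And>i. i \<in> I \<Longrightarrow> polyfun V (F i)) \<Longrightarrow> polyfun V (\<lambda>x. \<Sum>i\<in>I. F i x)"
  by (induction I rule: infinite_finite_induct) (auto intro: polyfun.intros)

lemma polyfun_prod: "(\<And>i. i \<in> I \<Longrightarrow> polyfun V (F i)) \<Longrightarrow> polyfun V (\<lambda>x. \<Prod>i\<in>I. F i x)"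
  by (induction I rule: infinite_finite_induct) (auto intro: polyfun.intros)

lemma polyfun_power: "polyfun V F \<Longrightarrow> polyfun V (\<lambda>x. F x ^ k)"
  by (induction k) (auto intro: polyfun.intros)

lemmas polyfun_intros = polyfun.intros polyfun_diff polyfun_sum polyfun_prod polyfun_power

lemma polyfun_cong: "polyfun V F \<Longrightarrow> (\<And>v. v \<in> V \<Longrightarrow> x v = y v) \<Longrightarrow> F x = F y"
  by (induction rule: polyfun.induct) auto

lemma polyfun_compose:
  "polyfun V F \<Longrightarrow> (\<And>v. v \<in> V \<Longrightarrow> polyfun W (\<lambda>x. Y x v)) \<Longrightarrow> polyfun W (\<lambda>x. F (Y x))"
  by (induction rule: polyfun.induct) (auto intro: polyfun.intros)

lemma polyfun_curve:
  assumes "polyfun V F" "\<And>v. v \<in> V \<Longrightarrow> \<exists>p. \<forall>s. c s v = poly p s"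
  shows "\<exists>p. \<forall>s. F (c s) = poly p s"
  using assms
proof (induction rule: polyfun.induct)
  case (const c)
  show ?case by (rule exI[of _ "[:c:]"]) simp
next
  case (add F G)
  then obtain p q where "\<forall>s. F (c s) = poly p s" "\<forall>s. G (c s) = poly q s" by blast
  then show ?case by (intro exI[of _ "p + q"]) simp
next
  case (mult F G)
  then obtain p q where "\<forall>s. F (c s) = poly p s" "\<forall>s. G (c s) = poly q s" by blast
  then show ?case by (intro exI[of _ "p * q"]) simp
qed auto

text \<open>Irreducibility of affine space is always used in this form: two polynomial functions that are
  nonzero somewhere are restricted to the line through two such points, where both have finitely many zeros.\<close>

lemma polyfun_line:
  assumes "polyfun V F"
  shows "\<exists>p. \<forall>s. F (\<lambda>v. x v + s * (y v - x v)) = poly p s"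
proof (rule polyfun_curve[OF assms])
  fix v
  show "\<exists>p. \<forall>s. x v + s * (y v - x v) = poly p s"
    by (rule exI[of _ "[:x v, y v - x v:]"]) simp
qed

lemma poly_common_nonroot:
  fixes p q :: "complex poly"
  assumes "poly p a \<noteq> 0" "poly q b \<noteq> 0"
  obtains s where "poly p s \<noteq> 0" "poly q s \<noteq> 0"
proof -
  have "p * q \<noteq> 0" using assms by auto
  then have "finite {s. poly (p * q) s = 0}" by (rule poly_roots_finite)
  then obtain s where "s \<notin> {s. poly (p * q) s = 0}" using ex_new_if_finite infinite_UNIV_char_0 by metis
  then show ?thesis using that by auto
qed

text \<open>Clearing denominators. The substitutions of rational functions that occur, namely rescaling a
  matrix to determinant one and reading off the coordinates of a coset, have a single common denominator.\<close>

lemma polyfun_quotient: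
  assumes "polyfun V F" "\<And>v. v \<in> V \<Longrightarrow> polyfun W (\<lambda>x. Y x v)" "polyfun W D"
  shows "\<exists>e H. polyfun W H \<and> (\<forall>x. D x \<noteq> 0 \<longrightarrow> F (\<lambda>v. Y x v / D x) * D x ^ e = H x)"
  using assms
proof (induction rule: polyfun.induct)
  case (const c)
  show ?case by (rule exI[of _ 0]) (auto intro!: exI[of _ "\<lambda>_. c"] polyfun.const)
next
  case (var v)
  show ?case by (rule exI[of _ 1], rule exI[of _ "\<lambda>x. Y x v"]) (use var in auto)
next
  case (add F G)
  then obtain e1 H1 e2 H2 where h: "polyfun W H1" "polyfun W H2"
    and 1: "\<And>x. D x \<noteq> 0 \<Longrightarrow> F (\<lambda>v. Y x v / D x) * D x ^ e1 = H1 x"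
    and 2: "\<And>x. D x \<noteq> 0 \<Longrightarrow> G (\<lambda>v. Y x v / D x) * D x ^ e2 = H2 x" by metis
  show ?case
    by (rule exI[of _ "e1 + e2"], rule exI[of _ "\<lambda>x. H1 x * D x ^ e2 + H2 x * D x ^ e1"])
      (use h add.prems in \<open>auto intro!: polyfun_intros simp: 1[symmetric] 2[symmetric] algebra_simps power_add\<close>)
next
  case (mult F G)
  then obtain e1 H1 e2 H2 where h: "polyfun W H1" "polyfun W H2"
    and 1: "\<And>x. D x \<noteq> 0 \<Longrightarrow> F (\<lambda>v. Y x v / D x) * D x ^ e1 = H1 x"
    and 2: "\<And>x. D x \<noteq> 0 \<Longrightarrow> G (\<lambda>v. Y x v / D x) * D x ^ e2 = H2 x" by metis
  show ?case
    by (rule exI[of _ "e1 + e2"], rule exI[of _ "\<lambda>x. H1 x * H2 x"])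
      (use h in \<open>auto intro!: polyfun_intros simp: 1[symmetric] 2[symmetric] algebra_simps power_add\<close>)
qed

text \<open>Enlarging the index set beyond the support lets sums over the supports of different polynomials
  be compared.\<close>

lemma eval_poly_eq:
  assumes "finite A" "Poly_Mapping.keys p \<subseteq> A"
  shows "eval_poly p x = (\<Sum>a\<in>A. Poly_Mapping.lookup p a * (\<Prod>v\<in>Poly_Mapping.keys a. x v ^ Poly_Mapping.lookup a v))"
  unfolding eval_poly_def by (rule sum.mono_neutral_left) (use assms in \<open>auto simp: in_keys_iff\<close>)

lemma eval_poly_add: "eval_poly (p + q) x = eval_poly p x + eval_poly q x"
proof -
  let ?A = "Poly_Mapping.keys p \<union> Poly_Mapping.keys q"
  have "Poly_Mapping.keys (p + q) \<subseteq> ?A" by (rule keys_add)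
  then show ?thesis
    by (subst (1 2 3) eval_poly_eq[of ?A]) (auto simp: lookup_add algebra_simps sum.distrib)
qed

lemma eval_poly_sum: "eval_poly (\<Sum>i\<in>I. p i) x = (\<Sum>i\<in>I. eval_poly (p i) x)"
  by (induction I rule: infinite_finite_induct) (auto simp: eval_poly_add, auto simp: eval_poly_def)

lemma eval_poly_single:
  "eval_poly (Poly_Mapping.single a c) x = c * (\<Prod>v\<in>Poly_Mapping.keys a. x v ^ Poly_Mapping.lookup a v)"
  by (subst eval_poly_eq[of "{a}"]) auto

lemma monomial_eval_eq:
  assumes "finite A" "Poly_Mapping.keys a \<subseteq> A"
  shows "(\<Prod>v\<in>Poly_Mapping.keys a. (x v :: complex) ^ Poly_Mapping.lookup a v) = (\<Prod>v\<in>A. x v ^ Poly_Mapping.lookup a v)"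
  by (rule prod.mono_neutral_left) (use assms in \<open>auto simp: in_keys_iff\<close>)

lemma monomial_eval_add:
  "(\<Prod>v\<in>Poly_Mapping.keys (a + b). (x v :: complex) ^ Poly_Mapping.lookup (a + b) v) =
   (\<Prod>v\<in>Poly_Mapping.keys a. x v ^ Poly_Mapping.lookup a v) *
   (\<Prod>v\<in>Poly_Mapping.keys b. x v ^ Poly_Mapping.lookup b v)"
proof -
  let ?A = "Poly_Mapping.keys a \<union> Poly_Mapping.keys b"
  have "Poly_Mapping.keys (a + b) \<subseteq> ?A" by (rule keys_add)
  then show ?thesis
    by (subst (1 2 3) monomial_eval_eq[of ?A]) (auto simp: lookup_add power_add prod.distrib)
qed

lemma poly_mapping_eq_sum_single:
  "p = (\<Sum>a\<in>Poly_Mapping.keys p. Poly_Mapping.single a (Poly_Mapping.lookup p a))"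
  by (rule poly_mapping_eqI) (simp add: lookup_sum lookup_single when_def in_keys_iff)

lemma eval_poly_mult: "eval_poly (p * q) x = eval_poly p x * eval_poly q x"
proof -
  have "p * q = (\<Sum>a\<in>Poly_Mapping.keys p. Poly_Mapping.single a (Poly_Mapping.lookup p a)) *
                (\<Sum>b\<in>Poly_Mapping.keys q. Poly_Mapping.single b (Poly_Mapping.lookup q b))"
    by (simp only: poly_mapping_eq_sum_single[symmetric])
  also have "\<dots> = (\<Sum>a\<in>Poly_Mapping.keys p. \<Sum>b\<in>Poly_Mapping.keys q.
      Poly_Mapping.single (a + b) (Poly_Mapping.lookup p a * Poly_Mapping.lookup q b))"
    by (simp add: sum_product mult_single)
  finally show ?thesis
    by (simp only: eval_poly_sum eval_poly_single monomial_eval_add eval_poly_def[of p] eval_poly_def[of q] sum_product ac_simps)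
qed

lemma polyfun_imp_eval_poly:
  "polyfun V F \<Longrightarrow> \<exists>p\<in>polys_in V. \<forall>x. eval_poly p x = F x"
proof (induction rule: polyfun.induct)
  case (const c)
  show ?case
    by (rule bexI[of _ "Poly_Mapping.single 0 c"]) (auto simp: eval_poly_single polys_in_def)
next
  case (var v)
  show ?case
    by (rule bexI[of _ "Poly_Mapping.single (Poly_Mapping.single v 1) 1"])
       (use var in \<open>auto simp: eval_poly_single polys_in_def\<close>)
next
  case (add F G)
  then obtain p q where *: "p \<in> polys_in V" "q \<in> polys_in V" "\<forall>x. eval_poly p x = F x" "\<forall>x. eval_poly q x = G x"
    by blast
  have "p + q \<in> polys_in V" using *(1,2) keys_add[of p q] by (fastforce simp: polys_in_def)
  then show ?case using * by (intro bexI[of _ "p + q"]) (auto simp: eval_poly_add)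
next
  case (mult F G)
  then obtain p q where *: "p \<in> polys_in V" "q \<in> polys_in V" "\<forall>x. eval_poly p x = F x" "\<forall>x. eval_poly q x = G x"
    by blast
  have "p * q \<in> polys_in V"
  proof -
    have "Poly_Mapping.keys c \<subseteq> V" if "c \<in> Poly_Mapping.keys (p * q)" for c
    proof -
      obtain a b where "c = a + b" "a \<in> Poly_Mapping.keys p" "b \<in> Poly_Mapping.keys q"
        using keys_mult[of p q] \<open>c \<in> _\<close> by blast
      then show ?thesis using *(1,2) keys_add[of a b] by (fastforce simp: polys_in_def)
    qed
    then show ?thesis by (auto simp: polys_in_def)
  qed
  then show ?case using * by (intro bexI[of _ "p * q"]) (auto simp: eval_poly_mult)
qed

lemma polyfun_eval_poly: "p \<in> polys_in V \<Longrightarrow> polyfun V (eval_poly p)"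
  unfolding eval_poly_def by (auto intro!: polyfun_intros simp: polys_in_def)


section \<open>Algebraic dependence\<close>

lemma linear_dependence:
  fixes M :: "'i \<Rightarrow> 'j \<Rightarrow> 'a :: field"
  assumes "finite J" "finite I" "card J < card I"
  shows "\<exists>a. (\<exists>i\<in>I. a i \<noteq> 0) \<and> (\<forall>j\<in>J. (\<Sum>i\<in>I. a i * M i j) = 0)"
  using assms
proof (induction J arbitrary: I M rule: finite_induct)
  case empty
  then have "I \<noteq> {}" by auto
  then show ?case by (intro exI[of _ "\<lambda>_. 1"]) auto
next
  case (insert j J)
  show ?case
  proof (cases "\<forall>i\<in>I. M i j = 0")
    case True
    have "card J < card I" using insert by auto
    from insert.IH[OF insert.prems(1) this, of M] obtain a where
      "\<exists>i\<in>I. a i \<noteq> 0" "\<forall>j\<in>J. (\<Sum>i\<in>I. a i * M i j) = 0" by blast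
    then show ?thesis using True by (intro exI[of _ a]) auto
  next
    case False
    then obtain i0 where i0: "i0 \<in> I" "M i0 j \<noteq> 0" by auto
    let ?I = "I - {i0}"
    define M' where "M' i l = M i l - M i j / M i0 j * M i0 l" for i l
    have "card J < card ?I" using insert i0 by (simp add: card_Diff_singleton)
    from insert.IH[OF _ this, of M'] insert.prems(1) obtain a where
      a: "\<exists>i\<in>?I. a i \<noteq> 0" "\<forall>l\<in>J. (\<Sum>i\<in>?I. a i * M' i l) = 0" by blast
    define c where "c = - (\<Sum>i\<in>?I. a i * M i j) / M i0 j"
    define b where "b = a(i0 := c)"
    have eq: "(\<Sum>i\<in>I. b i * M i l) = c * M i0 l + (\<Sum>i\<in>?I. a i * M i l)" for l
      using insert.prems(1) i0 by (subst sum.remove[of I i0]) (auto simp: b_def)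
    have "(\<Sum>i\<in>I. b i * M i l) = (\<Sum>i\<in>?I. a i * M' i l)" for l
      unfolding eq c_def M'_def using i0
      by (simp add: right_diff_distrib sum_subtractf sum_distrib_right sum_divide_distrib mult.assoc)
    moreover have "(\<Sum>i\<in>?I. a i * M' i j) = 0"
      using i0 by (simp add: M'_def)
    moreover have "\<exists>i\<in>I. b i \<noteq> 0" using a(1) by (auto simp: b_def)
    ultimately show ?thesis using a(2) by (intro exI[of _ b]) auto
  qed
qed

text \<open>Polynomials whose degree in each single variable is at most \<open>D\<close>. The exponent vectors form a
  box, which makes their number a power.\<close>

definition box_poly :: "'v set \<Rightarrow> nat \<Rightarrow> (('v \<Rightarrow> complex) \<Rightarrow> complex) \<Rightarrow> bool" where
  "box_poly V D F \<longleftrightarrow> (\<exists>c. \<forall>x. F x = (\<Sum>a\<in>V \<rightarrow>\<^sub>E {..D}. c a * (\<Prod>v\<in>V. x v ^ a v)))"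

lemma box_poly_monomial:
  assumes "finite V" "\<And>v. v \<in> V \<Longrightarrow> a v \<le> D"
  shows "box_poly V D (\<lambda>x. c * (\<Prod>v\<in>V. x v ^ a v))"
  unfolding box_poly_def
proof (rule exI[of _ "\<lambda>b. if b = restrict a V then c else 0"], rule allI)
  fix x :: "'a \<Rightarrow> complex"
  have "finite (V \<rightarrow>\<^sub>E {..D})" using assms by (simp add: finite_PiE)
  moreover have "restrict a V \<in> V \<rightarrow>\<^sub>E {..D}" using assms by auto
  ultimately show "c * (\<Prod>v\<in>V. x v ^ a v) = (\<Sum>b\<in>V \<rightarrow>\<^sub>E {..D}.
     (if b = restrict a V then c else 0) * (\<Prod>v\<in>V. x v ^ b v))"
    by (simp add: if_distrib[of "\<lambda>y. y * _"] sum.delta cong: if_cong)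
qed

lemma box_poly_zero: "box_poly V D (\<lambda>x. 0)"
  unfolding box_poly_def by (rule exI[of _ "\<lambda>_. 0"]) simp

lemma box_poly_add: "box_poly V D F \<Longrightarrow> box_poly V D G \<Longrightarrow> box_poly V D (\<lambda>x. F x + G x)"
  unfolding box_poly_def
proof (elim exE)
  fix c d assume "\<forall>x. F x = (\<Sum>a\<in>V \<rightarrow>\<^sub>E {..D}. c a * (\<Prod>v\<in>V. x v ^ a v))"
    "\<forall>x. G x = (\<Sum>a\<in>V \<rightarrow>\<^sub>E {..D}. d a * (\<Prod>v\<in>V. x v ^ a v))"
  then show "\<exists>c. \<forall>x. F x + G x = (\<Sum>a\<in>V \<rightarrow>\<^sub>E {..D}. c a * (\<Prod>v\<in>V. x v ^ a v))"
    by (intro exI[of _ "\<lambda>a. c a + d a"]) (simp add: algebra_simps sum.distrib)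
qed

lemma box_poly_sum: "(\<And>i. i \<in> I \<Longrightarrow> box_poly V D (F i)) \<Longrightarrow> box_poly V D (\<lambda>x. \<Sum>i\<in>I. F i x)"
  by (induction I rule: infinite_finite_induct) (auto intro: box_poly_zero box_poly_add)

lemma box_poly_mono:
  assumes "finite V" "D \<le> D'" "box_poly V D F" shows "box_poly V D' F"
proof -
  obtain c where "F = (\<lambda>x. \<Sum>a\<in>V \<rightarrow>\<^sub>E {..D}. c a * (\<Prod>v\<in>V. x v ^ a v))"
    using assms(3) by (auto simp: box_poly_def)
  then show ?thesis
    using assms(1,2) by (auto intro!: box_poly_sum box_poly_monomial simp: PiE_iff intro: order_trans)
qed

lemma box_poly_mult:
  assumes "finite V" "box_poly V D F" "box_poly V D' G"
  shows "box_poly V (D + D') (\<lambda>x. F x * G x)"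
proof -
  obtain c where c: "F = (\<lambda>x. \<Sum>a\<in>V \<rightarrow>\<^sub>E {..D}. c a * (\<Prod>v\<in>V. x v ^ a v))"
    using assms(2) by (auto simp: box_poly_def)
  obtain d where d: "G = (\<lambda>x. \<Sum>a\<in>V \<rightarrow>\<^sub>E {..D'}. d a * (\<Prod>v\<in>V. x v ^ a v))"
    using assms(3) by (auto simp: box_poly_def)
  have "(\<lambda>x. F x * G x) = (\<lambda>x. \<Sum>a\<in>V \<rightarrow>\<^sub>E {..D}. \<Sum>b\<in>V \<rightarrow>\<^sub>E {..D'}. (c a * d b) * (\<Prod>v\<in>V. x v ^ (a v + b v)))"
    by (simp add: c d sum_product power_add prod.distrib algebra_simps)
  moreover have "box_poly V (D + D') \<dots>"
    using assms(1) by (intro box_poly_sum box_poly_monomial) (auto simp: PiE_iff intro!: add_mono)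
  ultimately show ?thesis by simp
qed

lemma box_poly_const: "finite V \<Longrightarrow> box_poly V D (\<lambda>x. c)"
  using box_poly_monomial[of V "\<lambda>_. 0" D c] by simp

lemma box_poly_power:
  "finite V \<Longrightarrow> box_poly V D F \<Longrightarrow> box_poly V (e * D) (\<lambda>x. F x ^ e)"
proof (induction e)
  case 0
  then show ?case using box_poly_const[of V 0 1] by simp
next
  case (Suc e)
  then show ?case using box_poly_mult[of V D F "e * D" "\<lambda>x. F x ^ e"] by simp
qed

lemma box_poly_prod:
  assumes "finite V" "\<And>i. i < (k :: nat) \<Longrightarrow> box_poly V D (F i)"
  shows "box_poly V (k * D) (\<lambda>x. \<Prod>i<k. F i x)"
  using assms(2)
proof (induction k)
  case (Suc k)
  then have "box_poly V (k * D + D) (\<lambda>x. (\<Prod>i<k. F i x) * F k x)"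
    by (intro box_poly_mult[OF assms(1)]) auto
  then show ?case by (simp add: add.commute)
qed (simp add: box_poly_const[OF assms(1)])

lemma polyfun_box_poly:
  assumes "finite V" "polyfun V F" shows "\<exists>D. box_poly V D F"
  using assms(2)
proof (induction rule: polyfun.induct)
  case (const c)
  then show ?case using box_poly_const[OF assms(1)] by blast
next
  case (var v)
  have "(\<lambda>x :: _ \<Rightarrow> complex. \<Prod>u\<in>V. x u ^ (if u = v then 1 else 0)) = (\<lambda>x. x v)"
  proof
    fix x :: "'a \<Rightarrow> complex"
    have "(\<Prod>u\<in>V. x u ^ (if u = v then 1 else 0)) = (\<Prod>u\<in>V. if u = v then x u else 1)"
      by (rule prod.cong) auto
    then show "(\<Prod>u\<in>V. x u ^ (if u = v then 1 else 0)) = x v"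
      using assms(1) var by simp
  qed
  then have "box_poly V 1 (\<lambda>x. x v)"
    using box_poly_monomial[OF assms(1), of "\<lambda>u. if u = v then 1 else 0" 1 1] by simp
  then show ?case by blast
next
  case (add F G)
  then obtain D D' where "box_poly V D F" "box_poly V D' G" by blast
  then have "box_poly V (max D D') F" "box_poly V (max D D') G"
    using box_poly_mono[OF assms(1)] by (meson max.cobounded1 max.cobounded2)+
  from box_poly_add[OF this] show ?case by blast
next
  case (mult F G)
  then obtain D D' where "box_poly V D F" "box_poly V D' G" by blast
  from box_poly_mult[OF assms(1) this] show ?case by blast
qed

text \<open>The products of powers of the \<open>f l\<close> with exponents at most \<open>M\<close> number
  \<open>(M + 1) ^ k\<close>, but lie in a space whose dimension grows only like \<open>M ^ card V\<close>.\<close>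

lemma algebraic_dependence:
  assumes V: "finite V" and k: "card V < k" and f: "\<And>l. l < k \<Longrightarrow> polyfun V (f l)"
  obtains E Q where "finite E" "E \<noteq> {}" "E \<subseteq> extensional {..<k}" "\<And>e. e \<in> E \<Longrightarrow> Q e \<noteq> 0"
    "\<And>x. (\<Sum>e\<in>E. Q e * (\<Prod>l<k. f l x ^ e l)) = 0"
proof -
  have "\<exists>D. \<forall>l<k. box_poly V (D l) (f l)" using polyfun_box_poly[OF V f] by metis
  then obtain D0 where D0: "\<And>l. l < k \<Longrightarrow> box_poly V (D0 l) (f l)" by blast
  define D where "D = (\<Sum>l<k. D0 l)"
  have D: "box_poly V D (f l)" if "l < k" for l
    unfolding D_def using that by (intro box_poly_mono[OF V _ D0[OF that]] member_le_sum) auto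
  define C where "C = k * D + 1"
  \<comment> \<open>with this \<open>M\<close> the count of monomials is at most \<open>M * (M + 1) ^ card V\<close>\<close>
  define M where "M = C ^ card V"
  let ?E = "{..<k} \<rightarrow>\<^sub>E {..M}" and ?J = "V \<rightarrow>\<^sub>E {..k * (M * D)}"
  have bp: "box_poly V (k * (M * D)) (\<lambda>x. \<Prod>l<k. f l x ^ e l)" if "e \<in> ?E" for e
  proof (rule box_poly_prod[OF V])
    fix l assume l: "l < k"
    have "e l * D \<le> M * D" using that l by (intro mult_right_mono) (auto simp: PiE_iff)
    then show "box_poly V (M * D) (\<lambda>x. f l x ^ e l)"
      using box_poly_mono[OF V _ box_poly_power[OF V D[OF l], of "e l"]] by simp
  qed
  then have "\<forall>e\<in>?E. \<exists>c. \<forall>x. (\<Prod>l<k. f l x ^ e l) = (\<Sum>a\<in>?J. c a * (\<Prod>v\<in>V. x v ^ a v))"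
    unfolding box_poly_def by blast
  from bchoice[OF this] obtain c where
    c: "\<And>e x. e \<in> ?E \<Longrightarrow> (\<Prod>l<k. f l x ^ e l) = (\<Sum>a\<in>?J. c e a * (\<Prod>v\<in>V. x v ^ a v))"
    by blast
  have "card ?J = (k * (M * D) + 1) ^ card V" using V by (simp add: card_PiE)
  also have "\<dots> \<le> (C * (M + 1)) ^ card V"
    by (rule power_mono) (auto simp: C_def algebra_simps)
  also have "\<dots> = M * (M + 1) ^ card V" by (subst power_mult_distrib) (simp add: M_def)
  also have "\<dots> < (M + 1) ^ Suc (card V)" by simp
  also have "\<dots> \<le> (M + 1) ^ k" using k by (intro power_increasing) auto
  also have "\<dots> = card ?E" by (simp add: card_PiE)
  finally have "card ?J < card ?E" .
  moreover have "finite ?J" "finite ?E" using V by (simp_all add: finite_PiE)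
  ultimately obtain q where q: "\<exists>e\<in>?E. q e \<noteq> 0" "\<forall>a\<in>?J. (\<Sum>e\<in>?E. q e * c e a) = 0"
    using linear_dependence[of ?J ?E c] by blast
  have "(\<Sum>e\<in>{e\<in>?E. q e \<noteq> 0}. q e * (\<Prod>l<k. f l x ^ e l)) = 0" for x
  proof -
    have "(\<Sum>e\<in>{e\<in>?E. q e \<noteq> 0}. q e * (\<Prod>l<k. f l x ^ e l)) = (\<Sum>e\<in>?E. q e * (\<Prod>l<k. f l x ^ e l))"
      by (rule sum.mono_neutral_left) (auto simp: finite_PiE)
    also have "\<dots> = (\<Sum>e\<in>?E. \<Sum>a\<in>?J. (q e * c e a) * (\<Prod>v\<in>V. x v ^ a v))"
      by (rule sum.cong[OF refl], subst c, assumption) (simp add: sum_distrib_left mult.assoc)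
    also have "\<dots> = (\<Sum>a\<in>?J. (\<Sum>e\<in>?E. q e * c e a) * (\<Prod>v\<in>V. x v ^ a v))"
      by (subst sum.swap) (simp add: sum_distrib_right)
    also have "\<dots> = 0" using q(2) by simp
    finally show ?thesis .
  qed
  moreover have "finite {e\<in>?E. q e \<noteq> 0}" by (simp add: finite_PiE)
  ultimately show ?thesis
    using q(1) by (intro that[of "{e\<in>?E. q e \<noteq> 0}" q]) (auto simp: PiE_iff)
qed

text \<open>Induction along the chain. Factor the lowest power of the last function \<open>f k\<close> out of a
  relation on \<open>Z (k + 1)\<close>; by irreducibility the cofactor vanishes there too, and on the smaller set
  \<open>Z k\<close>, where \<open>f k\<close> is zero, it reduces to a nontrivial relation among the earlier functions.\<close>

lemma chain_independence:
  fixes Z :: "nat \<Rightarrow> ('v \<Rightarrow> complex) set"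
  assumes poly: "\<And>l. l < k \<Longrightarrow> polyfun V (f l)"
    and irr: "\<And>l F G. l \<le> k \<Longrightarrow> polyfun V F \<Longrightarrow> polyfun V G \<Longrightarrow> (\<forall>x\<in>Z l. F x * G x = 0) \<Longrightarrow>
                (\<forall>x\<in>Z l. F x = 0) \<or> (\<forall>x\<in>Z l. G x = 0)"
    and Z0: "Z 0 \<noteq> {}" and mono: "\<And>l. l < k \<Longrightarrow> Z l \<subseteq> Z (Suc l)"
    and van: "\<And>l x. l < k \<Longrightarrow> x \<in> Z l \<Longrightarrow> f l x = 0"
    and nonvan: "\<And>l. l < k \<Longrightarrow> \<exists>x\<in>Z (Suc l). f l x \<noteq> 0"
    and E: "finite E" "E \<noteq> {}" "E \<subseteq> extensional {..<k}" "\<And>e. e \<in> E \<Longrightarrow> Q e \<noteq> 0"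
  shows "\<exists>x\<in>Z k. (\<Sum>e\<in>E. Q e * (\<Prod>l<k. f l x ^ e l)) \<noteq> 0"
  using assms
proof (induction k arbitrary: E Q)
  case 0
  then have "E \<subseteq> {\<lambda>_. undefined}" by simp
  then have "E = {\<lambda>_. undefined}" using 0 by (simp add: subset_singleton_iff)
  then show ?case using 0 by auto
next
  case (Suc k)
  define m where "m = Min ((\<lambda>e. e k) ` E)"
  have m: "m \<le> e k" if "e \<in> E" for e using that Suc.prems by (simp add: m_def)
  have "m \<in> (\<lambda>e. e k) ` E" unfolding m_def using Suc.prems by (intro Min_in) auto
  then obtain e0 where e0: "e0 \<in> E" "e0 k = m" by auto
  define E0 where "E0 = {e\<in>E. e k = m}"
  \<comment> \<open>on \<open>Z k\<close> only the exponents in \<open>E0\<close> survive; \<open>r\<close> forgets their constant last entry\<close>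
  define r where "r e = restrict e {..<k}" for e :: "nat \<Rightarrow> nat"
  have inj: "inj_on r E0"
  proof (rule inj_onI)
    fix a b assume ab: "a \<in> E0" "b \<in> E0" "r a = r b"
    show "a = b"
    proof (rule extensionalityI[of _ "{..<Suc k}"])
      fix l assume "l \<in> {..<Suc k}"
      then show "a l = b l"
        using ab(1,2) fun_cong[OF ab(3), of l] by (cases "l = k") (auto simp: E0_def r_def less_Suc_eq)
    qed (use ab Suc.prems in \<open>auto simp: E0_def\<close>)
  qed
  let ?G = "\<lambda>x. \<Sum>e\<in>E. Q e * (\<Prod>l<k. f l x ^ e l) * f k x ^ (e k - m)"
  have fact: "(\<Sum>e\<in>E. Q e * (\<Prod>l<Suc k. f l x ^ e l)) = f k x ^ m * ?G x" for x
    unfolding sum_distrib_left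
    by (rule sum.cong[OF refl]) (use m in \<open>simp add: algebra_simps flip: power_add\<close>)
  have G: "?G x = (\<Sum>e\<in>r ` E0. Q (the_inv_into E0 r e) * (\<Prod>l<k. f l x ^ e l))" if "f k x = 0" for x
  proof -
    have "?G x = (\<Sum>e\<in>E0. Q e * (\<Prod>l<k. f l x ^ e l) * f k x ^ (e k - m))"
      by (rule sum.mono_neutral_right) (use m that Suc.prems in \<open>fastforce simp: E0_def\<close>)+
    also have "\<dots> = (\<Sum>e\<in>E0. Q (the_inv_into E0 r (r e)) * (\<Prod>l<k. f l x ^ (r e) l))"
    proof (rule sum.cong[OF refl])
      fix e assume e: "e \<in> E0"
      then show "Q e * (\<Prod>l<k. f l x ^ e l) * f k x ^ (e k - m) =
          Q (the_inv_into E0 r (r e)) * (\<Prod>l<k. f l x ^ (r e) l)"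
        using the_inv_into_f_f[OF inj e] by (simp add: E0_def) (simp add: r_def)
    qed
    finally show ?thesis by (simp add: sum.reindex[OF inj])
  qed
  have ext: "r ` E0 \<subseteq> extensional {..<k}"
    unfolding r_def by (intro image_subsetI restrict_extensional)
  have "\<exists>x\<in>Z k. (\<Sum>e\<in>r ` E0. Q (the_inv_into E0 r e) * (\<Prod>l<k. f l x ^ e l)) \<noteq> 0"
  proof (rule Suc.IH)
    fix e assume "e \<in> r ` E0"
    then show "Q (the_inv_into E0 r e) \<noteq> 0"
      using Suc.prems inj by (auto simp: the_inv_into_f_f E0_def)
  qed (use Suc.prems e0 ext in \<open>auto simp: E0_def\<close>)
  then obtain x where x: "x \<in> Z k" "?G x \<noteq> 0" using G Suc.prems(5)[of k] by auto
  show ?case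
  proof (rule ccontr)
    assume "\<not> ?thesis"
    then have 0: "\<forall>x\<in>Z (Suc k). f k x ^ m * ?G x = 0" unfolding fact by blast
    have "polyfun V (\<lambda>x. f k x ^ m)" "polyfun V ?G"
      using Suc.prems(1) by (auto intro!: polyfun_intros)
    from Suc.prems(2)[OF le_refl this 0] show False
      using x Suc.prems(4)[of k] Suc.prems(6)[of k] by auto
  qed
qed

text \<open>This is the bound of the Krull dimension of an affine space by its number of coordinates, stated
  for sets that need not be closed.\<close>

lemma no_long_chain:
  fixes Z :: "nat \<Rightarrow> ('v \<Rightarrow> complex) set"
  assumes "finite V"
    and "\<And>l. l < k \<Longrightarrow> polyfun V (f l)"
    and "\<And>l F G. l \<le> k \<Longrightarrow> polyfun V F \<Longrightarrow> polyfun V G \<Longrightarrow> (\<forall>x\<in>Z l. F x * G x = 0) \<Longrightarrow>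
                (\<forall>x\<in>Z l. F x = 0) \<or> (\<forall>x\<in>Z l. G x = 0)"
    and "Z 0 \<noteq> {}" and "\<And>l. l < k \<Longrightarrow> Z l \<subseteq> Z (Suc l)"
    and "\<And>l x. l < k \<Longrightarrow> x \<in> Z l \<Longrightarrow> f l x = 0"
    and "\<And>l. l < k \<Longrightarrow> \<exists>x\<in>Z (Suc l). f l x \<noteq> 0"
  shows "k \<le> card V"
proof (rule ccontr)
  assume "\<not> k \<le> card V"
  then have "card V < k" by simp
  show False
  proof (rule algebraic_dependence[OF assms(1) \<open>card V < k\<close> assms(2)])
    fix E Q
    assume E: "finite E" "E \<noteq> {}" "E \<subseteq> extensional {..<k}" "\<And>e. e \<in> E \<Longrightarrow> Q e \<noteq> 0"
      and 0: "\<And>x. (\<Sum>e\<in>E. Q e * (\<Prod>l<k. f l x ^ e l)) = 0"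
    have "\<exists>x\<in>Z k. (\<Sum>e\<in>E. Q e * (\<Prod>l<k. f l x ^ e l)) \<noteq> 0"
      by (rule chain_independence[where V = V]) (fact assms E)+
    then show False by (simp add: 0)
  qed
qed

section \<open>The matrix group SL\<close>

lemma mult_entry:
  assumes "A \<in> carrier_mat a b" "B \<in> carrier_mat b c" "r < a" "s < c"
  shows "(A * B) $$ (r, s) = (\<Sum>j<b. A $$ (r, j) * B $$ (j, s))"
  using assms by (simp add: scalar_prod_def atLeast0LessThan)

lemma carrier_SL: "g \<in> carrier (SL m) \<longleftrightarrow> g \<in> carrier_mat m m \<and> det g = 1"
  by (simp add: SL_def)

lemma SL_mat: "g \<in> carrier (SL m) \<Longrightarrow> g \<in> carrier_mat m m"
  by (simp add: carrier_SL)

lemma mult_SL: "g \<otimes>\<^bsub>SL m\<^esub> h = g * h"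
  by (simp add: SL_def)

lemma one_SL: "\<one>\<^bsub>SL m\<^esub> = 1\<^sub>m m"
  by (simp add: SL_def)

lemma adj_mat_SL:
  assumes "g \<in> carrier (SL m)"
  shows "adj_mat g \<in> carrier (SL m)" "adj_mat g * g = 1\<^sub>m m"
proof -
  have g: "g \<in> carrier_mat m m" "det g = 1" using assms by (auto simp: carrier_SL)
  have e: "adj_mat g * g = 1\<^sub>m m" unfolding adj_mat(3)[OF g(1)] g(2) by (rule eq_matI) auto
  then have "det (adj_mat g) * det g = 1"
    using det_mult[OF adj_mat(1)[OF g(1)] g(1)] by simp
  then show "adj_mat g \<in> carrier (SL m)" "adj_mat g * g = 1\<^sub>m m"
    using e g adj_mat(1)[OF g(1)] by (auto simp: carrier_SL)
qed

lemma group_SL: "Group.group (SL m)"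
proof (rule groupI)
  fix x y assume "x \<in> carrier (SL m)" "y \<in> carrier (SL m)"
  then show "x \<otimes>\<^bsub>SL m\<^esub> y \<in> carrier (SL m)"
    by (auto simp: carrier_SL mult_SL det_mult)
next
  fix x y z assume "x \<in> carrier (SL m)" "y \<in> carrier (SL m)" "z \<in> carrier (SL m)"
  then show "x \<otimes>\<^bsub>SL m\<^esub> y \<otimes>\<^bsub>SL m\<^esub> z = x \<otimes>\<^bsub>SL m\<^esub> (y \<otimes>\<^bsub>SL m\<^esub> z)"
    by (auto simp: carrier_SL mult_SL)
next
  fix x assume x: "x \<in> carrier (SL m)"
  then show "\<exists>y\<in>carrier (SL m). y \<otimes>\<^bsub>SL m\<^esub> x = \<one>\<^bsub>SL m\<^esub>"
    using adj_mat_SL[OF x] by (auto simp: mult_SL one_SL)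
qed (auto simp: carrier_SL mult_SL one_SL)

lemma SL_mult_closed: "g \<in> carrier (SL m) \<Longrightarrow> h \<in> carrier (SL m) \<Longrightarrow> g * h \<in> carrier (SL m)"
  using monoid.m_closed[OF group.is_monoid[OF group_SL], of g m h] by (simp add: mult_SL)

lemma SL_one_closed: "1\<^sub>m m \<in> carrier (SL m)"
  by (simp add: carrier_SL)

text \<open>The adjugate exhibits inversion on SL as a polynomial map.\<close>

lemma inv_SL: "g \<in> carrier (SL m) \<Longrightarrow> inv\<^bsub>SL m\<^esub> g = adj_mat g"
  using adj_mat_SL[of g m] by (intro group.inv_equality[OF group_SL]) (auto simp: mult_SL one_SL)

lemma SL_inv_closed: "g \<in> carrier (SL m) \<Longrightarrow> inv\<^bsub>SL m\<^esub> g \<in> carrier (SL m)"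
  by (rule group.inv_closed[OF group_SL])

lemma SL_l_inv: "g \<in> carrier (SL m) \<Longrightarrow> inv\<^bsub>SL m\<^esub> g * g = 1\<^sub>m m"
  using group.l_inv[OF group_SL, of g m] by (simp add: mult_SL one_SL)

lemma SL_r_inv: "g \<in> carrier (SL m) \<Longrightarrow> g * inv\<^bsub>SL m\<^esub> g = 1\<^sub>m m"
  using group.r_inv[OF group_SL, of g m] by (simp add: mult_SL one_SL)

lemma SL_assoc:
  "g \<in> carrier (SL m) \<Longrightarrow> h \<in> carrier (SL m) \<Longrightarrow> l \<in> carrier (SL m) \<Longrightarrow> g * h * l = g * (h * l)"
  by (auto simp: carrier_SL)

lemma SL_inv_cancel:
  assumes "g \<in> carrier (SL m)" "h \<in> carrier (SL m)"
  shows "inv\<^bsub>SL m\<^esub> g * (g * h) = h" "g * (inv\<^bsub>SL m\<^esub> g * h) = h"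
  using assms SL_mat[OF assms(2)] SL_inv_closed[OF assms(1)]
    SL_assoc[of "inv\<^bsub>SL m\<^esub> g" m g h] SL_assoc[of g m "inv\<^bsub>SL m\<^esub> g" h]
    SL_l_inv[OF assms(1)] SL_r_inv[OF assms(1)]
  by simp_all

abbreviation entries :: "nat \<Rightarrow> (nat \<times> nat) set" where
  "entries m \<equiv> {..<m} \<times> {..<m}"

lemma polyfun_det:
  assumes "\<And>r c. r < k \<Longrightarrow> c < k \<Longrightarrow> polyfun V (\<lambda>x. Y x (r, c))"
  shows "polyfun V (\<lambda>x. det (mat k k (Y x)))"
proof -
  have "(\<lambda>x. det (mat k k (Y x))) =
      (\<lambda>x. \<Sum>p\<in>{p. p permutes {0..<k}}. signof p * (\<Prod>i = 0..<k. Y x (i, p i)))"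
    by (rule ext, subst det_def'[of _ k]) (auto intro!: sum.cong prod.cong simp: permutes_in_image)
  moreover have "polyfun V \<dots>"
  proof (intro polyfun_sum polyfun.mult polyfun.const polyfun_prod assms)
    fix p i assume "p \<in> {p. p permutes {0..<k}}" "i \<in> {0..<k}"
    then show "i < k" "p i < k" using permutes_in_image[of p "{0..<k}" i] by auto
  qed
  ultimately show ?thesis by simp
qed

lemma mat_eta: "A \<in> carrier_mat m k \<Longrightarrow> mat m k (($$) A) = A"
  by auto

lemma polyfun_adj_mat_entry:
  assumes "r < m" "c < m"
  shows "\<exists>F. polyfun (entries m) F \<and> (\<forall>g\<in>carrier_mat m m. adj_mat g $$ (r, c) = F (($$) g))"
proof -
  let ?Y = "\<lambda>x (a, b). x (if a < c then a else Suc a, if b < r then b else Suc b)"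
  let ?F = "\<lambda>x :: nat \<times> nat \<Rightarrow> complex. (-1) ^ (c + r) * det (mat (m - 1) (m - 1) (?Y x))"
  have "polyfun (entries m) ?F"
    using assms by (intro polyfun.mult polyfun.const polyfun_det) (auto intro!: polyfun.var)
  moreover have "adj_mat g $$ (r, c) = ?F (($$) g)" if "g \<in> carrier_mat m m" for g
    using that assms by (auto simp: adj_mat_def cofactor_def mat_delete_def)
  ultimately show ?thesis by blast
qed

lemma det_triangular:
  assumes "A \<in> carrier_mat k k" "upper_triangular A"
  shows "det A = (\<Prod>r<k. A $$ (r, r))"
  using assms by (simp add: det_upper_triangular prod_list_diag_prod atLeast0LessThan)


section \<open>Density of the big cell\<close>

text \<open>The lower factor is unitriangular.\<close>

definition has_LU :: "nat \<Rightarrow> complex mat \<Rightarrow> bool" where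
  "has_LU m A \<longleftrightarrow> (\<exists>L U. L \<in> carrier_mat m m \<and> U \<in> carrier_mat m m \<and>
        A = L * U \<and> (\<forall>r<m. L $$ (r, r) = 1) \<and> (\<forall>c<m. \<forall>r<c. L $$ (r, c) = 0) \<and> upper_triangular U)"

text \<open>Gaussian elimination without pivoting. The polynomial \<open>M\<close> is built along the recursion on the
  Schur complement, scaled by the pivot so that it stays polynomial; its value at scalar matrices shows
  that it is not identically zero.\<close>

lemma generic_LU:
  "\<exists>M. polyfun (entries m) M \<and> (\<forall>a. a \<noteq> 0 \<longrightarrow> M (\<lambda>(r, c). if r = c then a else 0) \<noteq> 0) \<and>
     (\<forall>A\<in>carrier_mat m m. M (($$) A) \<noteq> 0 \<longrightarrow> has_LU m A)"
proof (induction m)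
  case 0
  show ?case
  proof (intro exI[of _ "\<lambda>_. 1"] conjI ballI impI allI)
    fix A :: "complex mat" assume "A \<in> carrier_mat 0 0"
    then show "has_LU 0 A"
      unfolding has_LU_def by (intro exI[of _ "1\<^sub>m 0"]) auto
  qed (auto intro: polyfun.const)
next
  case (Suc m)
  then obtain M where M: "polyfun (entries m) M"
    "\<And>a. a \<noteq> 0 \<Longrightarrow> M (\<lambda>(r, c). if r = c then a else 0) \<noteq> 0"
    "\<And>A. A \<in> carrier_mat m m \<Longrightarrow> M (($$) A) \<noteq> 0 \<Longrightarrow> has_LU m A"
    by blast
  define S where "S x = (\<lambda>(r, c). x (0, 0) * x (Suc r, Suc c) - x (Suc r, 0) * x (0, Suc c))"
    for x :: "nat \<times> nat \<Rightarrow> complex"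
  let ?M = "\<lambda>x. x (0, 0) * M (S x)"
  show ?case
  proof (intro exI[of _ ?M] conjI ballI impI allI)
    show "polyfun (entries (Suc m)) ?M"
      by (intro polyfun.mult polyfun_compose[OF M(1)]) (auto simp: S_def intro!: polyfun_intros)
  next
    fix a :: complex assume "a \<noteq> 0"
    moreover have "S (\<lambda>(r, c). if r = c then a else 0) = (\<lambda>(r, c). if r = c then a * a else 0)"
      by (auto simp: S_def)
    ultimately show "(case (0, 0) of (r, c) \<Rightarrow> if r = c then a else 0) * M (S (\<lambda>(r, c). if r = c then a else 0)) \<noteq> 0"
      using M(2)[of "a * a"] by simp
  next
    fix A :: "complex mat"
    assume A: "A \<in> carrier_mat (Suc m) (Suc m)" and nz: "A $$ (0, 0) * M (S (($$) A)) \<noteq> 0"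
    define a where "a = A $$ (0, 0)"
    have a: "a \<noteq> 0" using nz by (simp add: a_def)
    have "M (($$) (mat m m (S (($$) A)))) = M (S (($$) A))"
      by (rule polyfun_cong[OF M(1)]) auto
    with nz M(3)[of "mat m m (S (($$) A))"] obtain L U where
      LU: "L \<in> carrier_mat m m" "U \<in> carrier_mat m m" "mat m m (S (($$) A)) = L * U"
      "\<forall>r<m. L $$ (r, r) = 1" "\<forall>c<m. \<forall>r<c. L $$ (r, c) = 0" "upper_triangular U" by (auto simp: has_LU_def)
    define L' where "L' = mat (Suc m) (Suc m) (\<lambda>(r, c).
      if r = 0 then (if c = 0 then 1 else 0) else if c = 0 then A $$ (r, 0) / a else L $$ (r - 1, c - 1))"
    define U' where "U' = mat (Suc m) (Suc m) (\<lambda>(r, c).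
      if r = 0 then A $$ (0, c) else if c = 0 then 0 else U $$ (r - 1, c - 1) / a)"
    have LU_entry: "(\<Sum>j<m. L $$ (r, j) * U $$ (j, c)) = a * A $$ (Suc r, Suc c) - A $$ (Suc r, 0) * A $$ (0, Suc c)"
      if "r < m" "c < m" for r c
      using arg_cong[OF LU(3), of "\<lambda>X. X $$ (r, c)"] that mult_entry[OF LU(1,2) that]
      by (simp add: S_def a_def)
    have "A = L' * U'"
    proof (rule eq_matI)
      fix r c assume "r < dim_row (L' * U')" "c < dim_col (L' * U')"
      then have rc: "r < Suc m" "c < Suc m" by (auto simp: L'_def U'_def)
      have "(L' * U') $$ (r, c) = (\<Sum>j<Suc m. L' $$ (r, j) * U' $$ (j, c))"
        by (rule mult_entry) (use rc in \<open>auto simp: L'_def U'_def\<close>)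
      also have "\<dots> = L' $$ (r, 0) * U' $$ (0, c) + (\<Sum>j<m. L' $$ (r, Suc j) * U' $$ (Suc j, c))"
        by (rule sum.lessThan_Suc_shift)
      also have "\<dots> = A $$ (r, c)"
      proof (cases r)
        case 0
        then show ?thesis using rc by (simp add: L'_def U'_def)
      next
        case r: (Suc r')
        show ?thesis
        proof (cases c)
          case 0
          then show ?thesis using rc r a by (simp add: L'_def U'_def a_def)
        next
          case c: (Suc c')
          have "(\<Sum>j<m. L' $$ (r, Suc j) * U' $$ (Suc j, c)) = (\<Sum>j<m. L $$ (r', j) * U $$ (j, c')) / a"
            using rc r c by (simp add: L'_def U'_def sum_divide_distrib)
          also have "\<dots> = A $$ (r, c) - A $$ (r, 0) / a * A $$ (0, c)"
            using LU_entry[of r' c'] rc r c a by (simp add: field_simps)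
          finally show ?thesis using rc r c by (simp add: L'_def U'_def)
        qed
      qed
      finally show "A $$ (r, c) = (L' * U') $$ (r, c)" by simp
    qed (use A in \<open>auto simp: L'_def U'_def\<close>)
    moreover have "\<forall>c<Suc m. \<forall>r<c. L' $$ (r, c) = 0"
    proof (intro allI impI)
      fix c r assume "c < Suc m" "r < c"
      then show "L' $$ (r, c) = 0" using LU(5) by (cases r; cases c) (auto simp: L'_def)
    qed
    moreover have "upper_triangular U'"
    proof (rule upper_triangularI)
      fix c r assume "c < r" "r < dim_row U'"
      then show "U' $$ (r, c) = 0"
        using LU(2) upper_triangularD[OF LU(6), of "c - 1" "r - 1"] by (cases r; cases c) (auto simp: U'_def)
    qed
    ultimately show "has_LU (Suc m) A"
      unfolding has_LU_def using LU(4) by (intro exI[of _ L'] exI[of _ U']) (auto simp: L'_def U'_def)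
  qed
qed

definition unipotents :: "nat \<Rightarrow> complex mat set" where
  "unipotents m = {u \<in> carrier_mat m m. upper_triangular u \<and> (\<forall>r<m. u $$ (r, r) = 1)}"

lemma unipotents_SL: "u \<in> unipotents m \<Longrightarrow> u \<in> carrier (SL m)"
  by (auto simp: unipotents_def carrier_SL det_triangular)

definition antidiag :: "nat \<Rightarrow> complex mat" where
  "antidiag m = mat m m (\<lambda>(r, c). if r + c + 1 = m then 1 else 0)"

lemma antidiag_mat[simp]: "antidiag m \<in> carrier_mat m m"
  by (simp add: antidiag_def)

lemma antidiag_mult_left:
  assumes "A \<in> carrier_mat m k" "r < m" "c < k"
  shows "(antidiag m * A) $$ (r, c) = A $$ (m - 1 - r, c)"
proof -
  have "(antidiag m * A) $$ (r, c) = (\<Sum>j<m. if j = m - 1 - r then A $$ (j, c) else 0)"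
    by (subst mult_entry[OF antidiag_mat assms], rule sum.cong) (use assms in \<open>auto simp: antidiag_def\<close>)
  then show ?thesis using assms by simp
qed

lemma antidiag_mult_right:
  assumes "A \<in> carrier_mat k m" "r < k" "c < m"
  shows "(A * antidiag m) $$ (r, c) = A $$ (r, m - 1 - c)"
proof -
  have "(A * antidiag m) $$ (r, c) = (\<Sum>j<m. if j = m - 1 - c then A $$ (r, j) else 0)"
    by (subst mult_entry[OF assms(1) antidiag_mat assms(2,3)], rule sum.cong) (use assms in \<open>auto simp: antidiag_def\<close>)
  then show ?thesis using assms by simp
qed

lemma antidiag_square: "antidiag m * antidiag m = 1\<^sub>m m"
  by (rule eq_matI) (auto simp: antidiag_mult_left[OF antidiag_mat] simp del: index_mult_mat(1), auto simp: antidiag_def)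

lemma det_antidiag: "det (antidiag m) \<noteq> 0"
proof -
  have "det (antidiag m) * det (antidiag m) = 1"
    using det_mult[OF antidiag_mat antidiag_mat, of m] by (simp add: antidiag_square)
  then show ?thesis by auto
qed

text \<open>Permutation matrices may have determinant \<open>-1\<close>; a scalar multiple replaces them in SL.\<close>

lemma scale_to_SL:
  assumes "A \<in> carrier_mat m m" "det A \<noteq> 0" "0 < m"
  obtains a where "a \<noteq> 0" "a \<cdot>\<^sub>m A \<in> carrier (SL m)"
proof -
  obtain a where a: "a ^ m = inverse (det A)"
  proof -
    have "card {z. z ^ m = inverse (det A)} = m"
      using card_nth_roots[of "inverse (det A)" m] assms(2,3) by simp
    then have "{z. z ^ m = inverse (det A)} \<noteq> {}" using assms(3) by (metis card.empty less_irrefl)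
    then show ?thesis using that by blast
  qed
  have "a \<noteq> 0"
  proof
    assume "a = 0"
    then show False using a assms(2,3) by (simp add: power_0_left)
  qed
  then show ?thesis using assms a by (intro that[of a]) (auto simp: carrier_SL)
qed

text \<open>The product of upper unitriangular matrices, \<open>w\<close>, and upper triangular matrices contains the
  generic element, since \<open>w\<close> exchanges upper and lower triangular matrices. So the
  vanishing of \<open>E\<close> at \<open>w\<close> spreads to a dense subset. To stay inside SL while moving along a line of
  matrices from \<open>g\<close> to \<open>w\<close>, the first column is divided by the determinant.\<close>

lemma big_cell_dense:
  assumes E: "polyfun (entries m) E" and w: "w = a \<cdot>\<^sub>m antidiag m" "w \<in> carrier (SL m)" "a \<noteq> 0" and m: "0 < m"
    and u: "\<And>u g. u \<in> unipotents m \<Longrightarrow> g \<in> carrier (SL m) \<Longrightarrow> E (($$) g) = 0 \<Longrightarrow> E (($$) (u * g)) = 0"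
    and b: "\<And>b g. b \<in> carrier (SL m) \<Longrightarrow> upper_triangular b \<Longrightarrow> g \<in> carrier (SL m) \<Longrightarrow>
               E (($$) g) = 0 \<Longrightarrow> E (($$) (g * b)) = 0"
    and Ew: "E (($$) w) = 0" and g: "g \<in> carrier (SL m)"
  shows "E (($$) g) = 0"
proof (rule ccontr)
  assume Eg: "E (($$) g) \<noteq> 0"
  obtain M where M: "polyfun (entries m) M"
    "\<And>a. a \<noteq> 0 \<Longrightarrow> M (\<lambda>(r, c). if r = c then a else 0) \<noteq> 0"
    "\<And>A. A \<in> carrier_mat m m \<Longrightarrow> M (($$) A) \<noteq> 0 \<Longrightarrow> has_LU m A"
    using generic_LU[of m] by blast
  define D where "D x = det (mat m m x)" for x :: "nat \<times> nat \<Rightarrow> complex"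
  define Y where "Y x = (\<lambda>(r, c). if c = 0 then x (r, c) else x (r, c) * D x)" for x :: "nat \<times> nat \<Rightarrow> complex"
  have D: "polyfun (entries m) D"
    unfolding D_def by (rule polyfun_det[where Y = "\<lambda>x. x"]) (auto intro: polyfun.var)
  have PY: "polyfun (entries m) (\<lambda>x. Y x v)" if "v \<in> entries m" for v
    using that D by (cases v; cases "snd v = 0") (auto simp: Y_def intro!: polyfun_intros)
  have "\<exists>e H. polyfun (entries m) H \<and> (\<forall>x. D x \<noteq> 0 \<longrightarrow> E (\<lambda>v. Y x v / D x) * D x ^ e = H x)"
    by (rule polyfun_quotient[where Y = Y, OF E _ D]) (rule PY)
  then obtain e H where
    H0: "polyfun (entries m) H \<and> (\<forall>x. D x \<noteq> 0 \<longrightarrow> E (\<lambda>v. Y x v / D x) * D x ^ e = H x)"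
    by (elim exE)
  note H = conjunct1[OF H0] conjunct2[OF H0, rule_format]
  \<comment> \<open>reversing the rows is multiplication by \<open>antidiag m\<close> from the left\<close>
  define M' where "M' x = M (\<lambda>(r, c). x (m - 1 - r, c))" for x :: "nat \<times> nat \<Rightarrow> complex"
  have M': "polyfun (entries m) M'"
    unfolding M'_def by (rule polyfun_compose[OF M(1)]) (auto intro!: polyfun.var)
  define z where "z s = (\<lambda>v. g $$ v + s * (w $$ v - g $$ v))" for s
  obtain p where p: "\<forall>s. M' (z s) = poly p s"
    using polyfun_line[OF M', of "($$) g" "($$) w"] unfolding z_def by (elim exE)
  have HD: "polyfun (entries m) (\<lambda>x. H x * D x)" by (intro polyfun.mult H D)
  obtain q where q: "\<forall>s. H (z s) * D (z s) = poly q s"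
    using polyfun_line[OF HD, of "($$) g" "($$) w"] unfolding z_def by (elim exE)
  have z0: "z 0 = ($$) g" and z1: "z 1 = ($$) w" by (auto simp: z_def)
  have g': "g \<in> carrier_mat m m" "det g = 1" using g by (auto simp: carrier_SL)
  have Dg: "D (($$) g) = 1" using g' by (simp add: D_def mat_eta)
  have "Y (($$) g) = ($$) g" by (auto simp: Y_def Dg)
  then have "H (z 0) * D (z 0) \<noteq> 0" using H(2)[of "($$) g"] Eg by (simp add: z0 Dg)
  moreover have "M' (z 1) = M (\<lambda>(r, c). if r = c then a else 0)"
    unfolding M'_def z1 by (rule polyfun_cong[OF M(1)]) (auto simp: w antidiag_def)
  then have "M' (z 1) \<noteq> 0" using M(2)[OF w(3)] by simp
  ultimately have "poly p 1 \<noteq> 0" "poly q 0 \<noteq> 0" using p q by simp_all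
  then obtain s where "poly p s \<noteq> 0" "poly q s \<noteq> 0" by (rule poly_common_nonroot)
  then have "M' (z s) \<noteq> 0" "H (z s) * D (z s) \<noteq> 0" using p q by simp_all
  then have s: "M' (z s) \<noteq> 0" "H (z s) \<noteq> 0" "D (z s) \<noteq> 0" by auto
  define d where "d = D (z s)"
  define A where "A = mat m m (z s)"
  define t where "t c = (if c = 0 then 1 / d else 1)" for c :: nat
  define T where "T = mat_diag m t"
  have T: "T \<in> carrier_mat m m" and A: "A \<in> carrier_mat m m" by (auto simp: T_def A_def)
  have JA: "antidiag m * A \<in> carrier_mat m m" by (rule mult_carrier_mat[OF antidiag_mat A])
  have AT: "A * T = mat m m (\<lambda>(r, c). A $$ (r, c) * t c)"
    unfolding T_def by (rule mat_diag_mult_right[OF A])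
  have dT: "det T = 1 / d"
  proof -
    have "upper_triangular T" by (rule upper_triangularI) (auto simp: T_def mat_diag_def)
    then have "det T = (\<Prod>r<m. t r)" using det_triangular[OF T] by (simp add: T_def mat_diag_def)
    also have "\<dots> = (\<Prod>r<m. if r = 0 then 1 / d else 1)" by (simp add: t_def)
    finally show ?thesis using m by (simp add: prod.delta)
  qed
  have "det A = d" by (simp add: A_def d_def D_def)
  then have "det (A * T) = 1" using s(3) dT by (simp add: det_mult[OF A T] d_def)
  then have AT_SL: "A * T \<in> carrier (SL m)" using A T by (auto simp: carrier_SL)
  have "M (($$) (antidiag m * A)) = M' (z s)"
    unfolding M'_def by (rule polyfun_cong[OF M(1)])
      (auto simp: antidiag_mult_left[OF A] simp del: index_mult_mat(1), auto simp: A_def)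
  with s(1) M(3)[OF JA] obtain L U where
    LU: "L \<in> carrier_mat m m" "U \<in> carrier_mat m m" "antidiag m * A = L * U"
    "\<forall>r<m. L $$ (r, r) = 1" "\<forall>c<m. \<forall>r<c. L $$ (r, c) = 0" "upper_triangular U" by (auto simp: has_LU_def)
  define J where "J = antidiag m"
  have J: "J \<in> carrier_mat m m" "J * J = 1\<^sub>m m" by (auto simp: J_def antidiag_square)
  \<comment> \<open>\<open>J L J\<close> is upper unitriangular, and \<open>J\<close> is a multiple of \<open>w\<close>\<close>
  define u0 where "u0 = J * L * J"
  define b0 where "b0 = inverse a \<cdot>\<^sub>m (U * T)"
  have u0: "u0 \<in> unipotents m"
  proof -
    have ent: "u0 $$ (r, c) = L $$ (m - 1 - r, m - 1 - c)" if "r < m" "c < m" for r c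
    proof -
      have JL: "J * L \<in> carrier_mat m m" using J LU by auto
      show ?thesis
        using antidiag_mult_right[OF JL that] antidiag_mult_left[OF LU(1) that(1), of "m - 1 - c"] that
        by (simp add: u0_def J_def del: index_mult_mat(1))
    qed
    have "u0 \<in> carrier_mat m m" using J LU by (auto simp: u0_def)
    then show ?thesis
      using LU(4,5) by (auto simp: unipotents_def ent intro!: upper_triangularI)
  qed
  have b0: "b0 \<in> carrier_mat m m" "upper_triangular b0"
  proof -
    show "b0 \<in> carrier_mat m m" using LU T by (auto simp: b0_def)
    have "U * T = mat m m (\<lambda>(r, c). U $$ (r, c) * t c)"
      unfolding T_def by (rule mat_diag_mult_right[OF LU(2)])
    then show "upper_triangular b0"
      using LU(2) upper_triangularD[OF LU(6)] by (auto simp: b0_def intro!: upper_triangularI)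
  qed
  have wJ: "w = a \<cdot>\<^sub>m J" by (simp add: w J_def)
  have eq: "A * T = u0 * w * b0"
  proof -
    have Z: "J * L \<in> carrier_mat m m" and Y: "U * T \<in> carrier_mat m m" using J LU T by auto
    have "u0 * w = a \<cdot>\<^sub>m (J * L * J * J)"
      unfolding u0_def wJ using J Z by (intro mult_smult_distrib[of _ m m _ m]) auto
    also have "J * L * J * J = J * L * (J * J)"
      using Z J by (intro assoc_mult_mat[of _ m m _ m _ m]) auto
    also have "\<dots> = J * L" unfolding J(2) by (rule right_mult_one_mat[OF Z])
    finally have "u0 * w * b0 = a \<cdot>\<^sub>m (J * L) * (inverse a \<cdot>\<^sub>m (U * T))" by (simp add: b0_def)
    also have "\<dots> = a \<cdot>\<^sub>m (J * L * (inverse a \<cdot>\<^sub>m (U * T)))"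
      using Z Y by (intro mult_smult_assoc_mat[of _ m m _ m]) auto
    also have "J * L * (inverse a \<cdot>\<^sub>m (U * T)) = inverse a \<cdot>\<^sub>m (J * L * (U * T))"
      using Z Y by (intro mult_smult_distrib[of _ m m _ m]) auto
    also have "a \<cdot>\<^sub>m (inverse a \<cdot>\<^sub>m (J * L * (U * T))) = J * L * (U * T)"
      using w(3) by (intro eq_matI) auto
    also have "\<dots> = J * (L * (U * T))" using J LU Y by (intro assoc_mult_mat[of _ m m _ m _ m]) auto
    also have "L * (U * T) = L * U * T" using LU T by (intro assoc_mult_mat[of _ m m _ m _ m, symmetric]) auto
    also have "\<dots> = J * A * T" by (simp only: LU(3) J_def)
    also have "\<dots> = J * (A * T)" using J A T by (intro assoc_mult_mat[of _ m m _ m _ m]) auto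
    also have "J * (J * (A * T)) = J * J * (A * T)"
      using J A T by (intro assoc_mult_mat[of _ m m _ m _ m, symmetric]) auto
    also have "\<dots> = A * T" unfolding J(2) by (rule left_mult_one_mat[OF mult_carrier_mat[OF A T]])
    finally show ?thesis by simp
  qed
  have "det (u0 * w * b0) = det b0"
    using SL_mult_closed[OF unipotents_SL[OF u0] w(2)] b0(1) det_mult[of "u0 * w" m b0]
    by (simp add: carrier_SL)
  then have "b0 \<in> carrier (SL m)" using AT_SL b0(1) by (simp add: carrier_SL eq)
  then have "E (($$) (u0 * w * b0)) = 0"
    using b0(2) u[OF u0 w(2) Ew] SL_mult_closed[OF unipotents_SL[OF u0] w(2)]
    by (intro b[of b0 "u0 * w"]) auto
  moreover have "(A * T) $$ (r, c) = z s (r, c) * t c" if "r < m" "c < m" for r c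
    unfolding AT using that by (simp add: A_def)
  then have "E (($$) (A * T)) = E (\<lambda>v. Y (z s) v / D (z s))"
    using s(3) by (intro polyfun_cong[OF E]) (auto simp: t_def Y_def d_def simp del: index_mult_mat(1))
  ultimately show False using H(2)[OF s(3)] s eq by auto
qed

text \<open>With \<open>i + k = m\<close> this is the lower left minor of an \<open>m\<close> by \<open>m\<close> matrix.\<close>

definition corner :: "nat \<Rightarrow> nat \<Rightarrow> (nat \<times> nat \<Rightarrow> complex) \<Rightarrow> complex" where
  "corner i k x = det (mat i i (\<lambda>(r, c). x (k + r, c)))"

lemma polyfun_corner: "i + k = m \<Longrightarrow> polyfun (entries m) (corner i k)"
  unfolding corner_def by (rule polyfun_det) (auto intro!: polyfun.var)

lemma corner_antidiag: "i + k = m \<Longrightarrow> a \<noteq> 0 \<Longrightarrow> corner i k (($$) (a \<cdot>\<^sub>m antidiag m)) \<noteq> 0"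
proof -
  assume "i + k = m" "a \<noteq> 0"
  then have "mat i i (\<lambda>(r, c). (a \<cdot>\<^sub>m antidiag m) $$ (k + r, c)) = a \<cdot>\<^sub>m antidiag i"
    by (intro eq_matI) (auto simp: antidiag_def)
  then show ?thesis using \<open>a \<noteq> 0\<close> det_antidiag[of i] by (simp add: corner_def)
qed

lemma sum_split_block: "i + k = m \<Longrightarrow> (\<Sum>j<m. f j) = (\<Sum>j<k. f j) + (\<Sum>j<i. f (k + j :: nat) :: complex)"
proof (induction i arbitrary: m)
  case (Suc i)
  then show ?case using Suc.IH[of "i + k"] by (auto simp: add.commute add.assoc)
qed simp

lemma corner_left_mult:
  assumes ik: "i + k = m" and y: "y \<in> carrier_mat m m" and g: "g \<in> carrier_mat m m"
    and z: "\<And>r c. k \<le> r \<Longrightarrow> r < m \<Longrightarrow> c < k \<Longrightarrow> y $$ (r, c) = 0"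
  shows "corner i k (($$) (y * g)) = det (mat i i (\<lambda>(r, c). y $$ (k + r, k + c))) * corner i k (($$) g)"
proof -
  have "mat i i (\<lambda>(r, c). (y * g) $$ (k + r, c)) =
    mat i i (\<lambda>(r, c). y $$ (k + r, k + c)) * mat i i (\<lambda>(r, c). g $$ (k + r, c))"
  proof (rule eq_matI)
    fix r c assume "r < dim_row (mat i i (\<lambda>(r, c). y $$ (k + r, k + c)) * mat i i (\<lambda>(r, c). g $$ (k + r, c)))"
      "c < dim_col (mat i i (\<lambda>(r, c). y $$ (k + r, k + c)) * mat i i (\<lambda>(r, c). g $$ (k + r, c)))"
    then have rc: "r < i" "c < i" by auto
    have "(y * g) $$ (k + r, c) = (\<Sum>j<m. y $$ (k + r, j) * g $$ (j, c))"
      by (rule mult_entry[OF y g]) (use rc ik in auto)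
    also have "\<dots> = (\<Sum>j<i. y $$ (k + r, k + j) * g $$ (k + j, c))"
      unfolding sum_split_block[OF ik] using rc ik z by simp
    finally show "mat i i (\<lambda>(r, c). (y * g) $$ (k + r, c)) $$ (r, c) =
      (mat i i (\<lambda>(r, c). y $$ (k + r, k + c)) * mat i i (\<lambda>(r, c). g $$ (k + r, c))) $$ (r, c)"
      using rc by (subst mult_entry[of _ i i]) auto
  qed auto
  then show ?thesis unfolding corner_def by (simp add: det_mult[of _ i])
qed

lemma corner_right_mult:
  assumes ik: "i + k = m" and y: "y \<in> carrier_mat m m" "upper_triangular y" and g: "g \<in> carrier_mat m m"
  shows "corner i k (($$) (g * y)) = corner i k (($$) g) * (\<Prod>r<i. y $$ (r, r))"
proof -
  let ?Y = "mat i i (\<lambda>(r, c). y $$ (r, c))"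
  have "mat i i (\<lambda>(r, c). (g * y) $$ (k + r, c)) = mat i i (\<lambda>(r, c). g $$ (k + r, c)) * ?Y"
  proof (rule eq_matI)
    fix r c assume "r < dim_row (mat i i (\<lambda>(r, c). g $$ (k + r, c)) * ?Y)"
      "c < dim_col (mat i i (\<lambda>(r, c). g $$ (k + r, c)) * ?Y)"
    then have rc: "r < i" "c < i" by auto
    have "(g * y) $$ (k + r, c) = (\<Sum>j<m. g $$ (k + r, j) * y $$ (j, c))"
      by (rule mult_entry[OF g y(1)]) (use rc ik in auto)
    also have "\<dots> = (\<Sum>j<i. g $$ (k + r, j) * y $$ (j, c))"
      using rc ik y by (intro sum.mono_neutral_right) (auto intro!: upper_triangularD[OF y(2)])
    finally show "mat i i (\<lambda>(r, c). (g * y) $$ (k + r, c)) $$ (r, c) =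
      (mat i i (\<lambda>(r, c). g $$ (k + r, c)) * ?Y) $$ (r, c)"
      using rc by (subst mult_entry[of _ i i]) auto
  qed auto
  moreover have "det ?Y = (\<Prod>r<i. y $$ (r, r))"
    by (subst det_triangular[of _ i]) (use ik y in \<open>auto intro!: upper_triangularI upper_triangularD[OF y(2)]\<close>)
  ultimately show ?thesis unfolding corner_def by (simp add: det_mult[of _ i])
qed

lemma corner_unipotent:
  assumes ik: "i + k = m" and u: "u \<in> unipotents m" and g: "g \<in> carrier_mat m m"
  shows "corner i k (($$) (u * g)) = corner i k (($$) g)"
proof -
  have u': "u \<in> carrier_mat m m" "upper_triangular u" "\<forall>r<m. u $$ (r, r) = 1"
    using u by (auto simp: unipotents_def)
  have "det (mat i i (\<lambda>(r, c). u $$ (k + r, k + c))) = 1"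
    by (subst det_triangular[of _ i]) (use ik u' in \<open>auto intro!: upper_triangularI upper_triangularD[OF u'(2)]\<close>)
  moreover have "u $$ (r, c) = 0" if "k \<le> r" "r < m" "c < k" for r c
    using that u' by (intro upper_triangularD[OF u'(2)]) auto
  ultimately show ?thesis by (simp add: corner_left_mult[OF ik u'(1) g])
qed

section \<open>Minors of the bottom rows\<close>

definition minor_cols :: "nat \<Rightarrow> nat \<Rightarrow> (nat \<Rightarrow> nat) \<Rightarrow> complex mat \<Rightarrow> complex" where
  "minor_cols i k \<tau> g = det (mat i i (\<lambda>(r, c). g $$ (k + r, \<tau> c)))"

lemma det_permute_cols:
  assumes "B \<in> carrier_mat i i" "p permutes {0..<i}"
  shows "det (mat i i (\<lambda>(r, c). B $$ (r, p c))) = signof p * det B"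
proof -
  have p: "p c < i" if "c < i" for c using permutes_in_image[OF assms(2), of c] that by auto
  have "det (mat i i (\<lambda>(r, c). B $$ (r, p c))) = det (transpose_mat (mat i i (\<lambda>(r, c). B $$ (r, p c))))"
    by (rule det_transpose[symmetric, of _ i]) simp
  also have "transpose_mat (mat i i (\<lambda>(r, c). B $$ (r, p c))) = mat i i (\<lambda>(r, c). transpose_mat B $$ (p r, c))"
    by (rule eq_matI) (use assms p in auto)
  also have "det \<dots> = signof p * det (transpose_mat B)"
    by (rule det_permute_rows) (use assms in auto)
  finally show ?thesis by (simp add: det_transpose[OF assms(1)])
qed

text \<open>The half of the Cauchy-Binet formula that comes from multilinearity, over all maps \<open>\<tau>\<close> from
  columns to columns.\<close>

lemma corner_expand:
  assumes g: "g \<in> carrier_mat m m" and h: "h \<in> carrier_mat m m" and ik: "i + k = m"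
  shows "corner i k (($$) (g * h)) =
    (\<Sum>\<tau>\<in>{..<i} \<rightarrow>\<^sub>E {..<m}. (\<Prod>c<i. h $$ (\<tau> c, c)) * minor_cols i k \<tau> g)"
proof -
  have "corner i k (($$) (g * h)) = (\<Sum>p | p permutes {0..<i}. signof p * (\<Prod>c<i. (g * h) $$ (k + p c, c)))"
    unfolding corner_def
    by (subst det_col[of _ i]) (auto intro!: sum.cong prod.cong dest: permutes_in_image[THEN iffD2])
  also have "\<dots> = (\<Sum>p | p permutes {0..<i}. signof p *
      (\<Sum>\<tau>\<in>{..<i} \<rightarrow>\<^sub>E {..<m}. \<Prod>c<i. g $$ (k + p c, \<tau> c) * h $$ (\<tau> c, c)))"
  proof (rule sum.cong[OF refl])
    fix p assume "p \<in> {p. p permutes {0..<i}}"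
    then have p: "p c < i" if "c < i" for c using permutes_in_image[of p "{0..<i}" c] that by auto
    have "(\<Prod>c<i. (g * h) $$ (k + p c, c)) = (\<Prod>c<i. \<Sum>j<m. g $$ (k + p c, j) * h $$ (j, c))"
      by (rule prod.cong[OF refl], rule mult_entry[OF g h]) (use p ik in fastforce)+
    then show "signof p * (\<Prod>c<i. (g * h) $$ (k + p c, c)) =
      signof p * (\<Sum>\<tau>\<in>{..<i} \<rightarrow>\<^sub>E {..<m}. \<Prod>c<i. g $$ (k + p c, \<tau> c) * h $$ (\<tau> c, c))"
      by (simp add: prod_sum_PiE)
  qed
  also have "\<dots> = (\<Sum>\<tau>\<in>{..<i} \<rightarrow>\<^sub>E {..<m}. (\<Prod>c<i. h $$ (\<tau> c, c)) *
      (\<Sum>p | p permutes {0..<i}. signof p * (\<Prod>c<i. g $$ (k + p c, \<tau> c))))"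
    unfolding sum_distrib_left by (subst sum.swap) (simp add: prod.distrib mult_ac)
  also have "\<dots> = (\<Sum>\<tau>\<in>{..<i} \<rightarrow>\<^sub>E {..<m}. (\<Prod>c<i. h $$ (\<tau> c, c)) * minor_cols i k \<tau> g)"
  proof (rule sum.cong[OF refl])
    fix \<tau>
    have "minor_cols i k \<tau> g = (\<Sum>p | p permutes {0..<i}. signof p * (\<Prod>c<i. g $$ (k + p c, \<tau> c)))"
      unfolding minor_cols_def
      by (subst det_col[of _ i]) (auto intro!: sum.cong prod.cong dest: permutes_in_image[THEN iffD2])
    then show "(\<Prod>c<i. h $$ (\<tau> c, c)) * (\<Sum>p | p permutes {0..<i}. signof p * (\<Prod>c<i. g $$ (k + p c, \<tau> c))) =
      (\<Prod>c<i. h $$ (\<tau> c, c)) * minor_cols i k \<tau> g" by simp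
  qed
  finally show ?thesis .
qed

lemma minor_cols_not_inj:
  assumes "\<not> inj_on \<tau> {..<i}" shows "minor_cols i k \<tau> g = 0"
proof -
  obtain a b where "a < i" "b < i" "a \<noteq> b" "\<tau> a = \<tau> b" using assms by (auto simp: inj_on_def)
  then show ?thesis
    unfolding minor_cols_def by (intro det_identical_columns[of _ i a b]) (auto intro!: eq_vecI)
qed

lemma minor_cols_same_image:
  assumes "inj_on \<tau> {..<i}" "inj_on e {..<i}" "\<tau> ` {..<i} = e ` {..<i}"
  shows "\<exists>s. \<forall>g. minor_cols i k \<tau> g = s * minor_cols i k e g"
proof -
  define p where "p c = (if c < i then the_inv_into {..<i} e (\<tau> c) else c)" for c
  have bij: "bij_betw (the_inv_into {..<i} e \<circ> \<tau>) {..<i} {..<i}"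
    using assms by (intro bij_betw_trans[of _ _ "e ` {..<i}"] bij_betw_the_inv_into) (auto simp: bij_betw_def)
  have "p permutes {0..<i}"
  proof (rule bij_imp_permutes)
    show "bij_betw p {0..<i} {0..<i}"
      using bij by (subst bij_betw_cong[of _ _ "the_inv_into {..<i} e \<circ> \<tau>"]) (auto simp: p_def atLeast0LessThan)
  qed (auto simp: p_def)
  moreover have ep: "e (p c) = \<tau> c" if "c < i" for c
  proof -
    have "\<tau> c \<in> e ` {..<i}" using that assms(3) by auto
    then show ?thesis using that by (simp add: p_def f_the_inv_into_f[OF assms(2)])
  qed
  moreover have "p c < i" if "c < i" for c
    using permutes_in_image[OF \<open>p permutes _\<close>, of c] that by auto
  ultimately have "minor_cols i k \<tau> g = signof p * minor_cols i k e g" for g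
  proof -
    have "mat i i (\<lambda>(r, c). g $$ (k + r, \<tau> c)) = mat i i (\<lambda>(r, c). mat i i (\<lambda>(r, c). g $$ (k + r, e c)) $$ (r, p c))"
      by (rule eq_matI) (use \<open>\<And>c. c < i \<Longrightarrow> p c < i\<close> ep in auto)
    then show ?thesis
      unfolding minor_cols_def by (simp only:) (rule det_permute_cols[OF _ \<open>p permutes _\<close>], simp)
  qed
  then show ?thesis by blast
qed

lemma adapted_enumeration:
  assumes "J \<subseteq> {..<m}" "card J = i"
  obtains e where "bij_betw e {..<m} {..<m}" "e ` {..<i} = J"
proof -
  have fin: "finite J" using assms(1) finite_subset by blast
  have im: "i \<le> m" using card_mono[OF _ assms(1)] assms(2) by simp
  obtain a where a: "bij_betw a {..<i} J"
    using finite_same_card_bij[of "{..<i}" J] fin assms(2) by auto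
  obtain b where b: "bij_betw b {i..<m} ({..<m} - J)"
    using finite_same_card_bij[of "{i..<m}" "{..<m} - J"] fin assms by (auto simp: card_Diff_subset)
  define e where "e c = (if c < i then a c else b c)" for c
  have 1: "bij_betw e {..<i} J"
    using a by (subst bij_betw_cong[of _ _ a]) (auto simp: e_def)
  have 2: "bij_betw e {i..<m} ({..<m} - J)"
    using b by (subst bij_betw_cong[of _ _ b]) (auto simp: e_def)
  have "{..<i} \<union> {i..<m} = {..<m}" "J \<union> ({..<m} - J) = {..<m}" using im assms(1) by auto
  then have "bij_betw e {..<m} {..<m}" using bij_betw_combine[OF 1 2] by auto
  moreover have "e ` {..<i} = J" using 1 by (simp add: bij_betw_def)
  ultimately show ?thesis using that by blast
qed

definition perm_mat :: "nat \<Rightarrow> (nat \<Rightarrow> nat) \<Rightarrow> complex mat" where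
  "perm_mat m e = mat m m (\<lambda>(r, c). if r = e c then 1 else 0)"

lemma perm_mat_carrier[simp]: "perm_mat m e \<in> carrier_mat m m"
  by (simp add: perm_mat_def)

lemma perm_mat_mult:
  assumes "g \<in> carrier_mat m m" "r < m" "c < m" "e c < m"
  shows "(g * perm_mat m e) $$ (r, c) = g $$ (r, e c)"
proof -
  have "(g * perm_mat m e) $$ (r, c) = (\<Sum>j<m. if j = e c then g $$ (r, j) else 0)"
    by (subst mult_entry[OF assms(1) perm_mat_carrier assms(2,3)], rule sum.cong)
      (use assms in \<open>auto simp: perm_mat_def\<close>)
  then show ?thesis using assms by simp
qed

lemma perm_mat_transpose:
  assumes "bij_betw e {..<m} {..<m}"
  shows "transpose_mat (perm_mat m e) * perm_mat m e = 1\<^sub>m m"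
proof (rule eq_matI)
  fix r c assume "r < dim_row (1\<^sub>m m :: complex mat)" "c < dim_col (1\<^sub>m m :: complex mat)"
  then have rc: "r < m" "c < m" by auto
  then have e: "e r < m" "e c < m" "e r = e c \<longleftrightarrow> r = c"
    using assms by (auto simp: bij_betw_def inj_on_def)
  then show "(transpose_mat (perm_mat m e) * perm_mat m e) $$ (r, c) = 1\<^sub>m m $$ (r, c)"
    using rc by (subst perm_mat_mult) (auto simp: perm_mat_def)
qed (auto simp: perm_mat_def)

lemma det_perm_mat: "bij_betw e {..<m} {..<m} \<Longrightarrow> det (perm_mat m e) \<noteq> 0"
proof
  assume "bij_betw e {..<m} {..<m}" "det (perm_mat m e) = 0"
  then show False
    using det_mult[of "transpose_mat (perm_mat m e)" m "perm_mat m e"] perm_mat_transpose[of e m] by simp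
qed

lemma corner_perm_mat:
  assumes ik: "i + k = m" and g: "g \<in> carrier_mat m m" and e: "bij_betw e {..<m} {..<m}"
  shows "corner i k (($$) (g * (a \<cdot>\<^sub>m perm_mat m e))) = a ^ i * minor_cols i k e g"
proof -
  have "g * (a \<cdot>\<^sub>m perm_mat m e) = a \<cdot>\<^sub>m (g * perm_mat m e)"
    by (rule mult_smult_distrib[OF g perm_mat_carrier])
  moreover have em: "e c < m" if "c < m" for c using e that by (auto simp: bij_betw_def)
  have "mat i i (\<lambda>(r, c). (a \<cdot>\<^sub>m (g * perm_mat m e)) $$ (k + r, c)) =
    a \<cdot>\<^sub>m mat i i (\<lambda>(r, c). g $$ (k + r, e c))"
  proof (rule eq_matI)
    fix r c assume "r < dim_row (a \<cdot>\<^sub>m mat i i (\<lambda>(r, c). g $$ (k + r, e c)))"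
      "c < dim_col (a \<cdot>\<^sub>m mat i i (\<lambda>(r, c). g $$ (k + r, e c)))"
    then have rc: "r < i" "c < i" by auto
    have "(g * perm_mat m e) $$ (k + r, c) = g $$ (k + r, e c)"
      by (rule perm_mat_mult[OF g]) (use rc ik em in auto)
    moreover have "dim_row (g * perm_mat m e) = m" "dim_col (g * perm_mat m e) = m"
      using g by (auto simp: perm_mat_def)
    ultimately show "mat i i (\<lambda>(r, c). (a \<cdot>\<^sub>m (g * perm_mat m e)) $$ (k + r, c)) $$ (r, c) =
        (a \<cdot>\<^sub>m mat i i (\<lambda>(r, c). g $$ (k + r, e c))) $$ (r, c)"
      using rc ik by (simp del: index_mult_mat(1))
  qed auto
  ultimately show ?thesis by (simp add: corner_def minor_cols_def)
qed

text \<open>In the expansion over maps \<open>\<tau>\<close>, a map that is not injective contributes zero, and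
  an injective one contributes a multiple of the minor in the columns \<open>K \<tau>\<close>, its image. That minor is a
  multiple of the corner of \<open>g\<close> translated by a permutation matrix.\<close>

lemma corner_mult_combination:
  assumes ik: "i + k = m" and h: "h \<in> carrier_mat m m"
    and w: "\<And>J. J \<subseteq> {..<m} \<Longrightarrow> card J = i \<Longrightarrow> bij_betw (e J) {..<m} {..<m} \<and> e J ` {..<i} = J \<and> a J \<noteq> (0 :: complex)"
  shows "\<exists>(T :: (nat \<Rightarrow> nat) set) \<beta> K. (\<forall>\<tau>\<in>T. K \<tau> \<subseteq> {..<m} \<and> card (K \<tau>) = i) \<and>
     (\<forall>g\<in>carrier_mat m m. corner i k (($$) (g * h)) =
        (\<Sum>\<tau>\<in>T. \<beta> \<tau> * corner i k (($$) (g * (a (K \<tau>) \<cdot>\<^sub>m perm_mat m (e (K \<tau>)))))))"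
proof -
  define T where "T = {\<tau> \<in> {..<i} \<rightarrow>\<^sub>E {..<m}. inj_on \<tau> {..<i}}"
  define K where "K \<tau> = \<tau> ` {..<i}" for \<tau> :: "nat \<Rightarrow> nat"
  have K: "K \<tau> \<subseteq> {..<m}" "card (K \<tau>) = i" if "\<tau> \<in> T" for \<tau>
    using that by (auto simp: T_def K_def card_image)
  have "\<exists>s. \<forall>g. minor_cols i k \<tau> g = s * minor_cols i k (e (K \<tau>)) g" if "\<tau> \<in> T" for \<tau>
  proof (rule minor_cols_same_image)
    show "inj_on \<tau> {..<i}" using that by (simp add: T_def)
    have "inj_on (e (K \<tau>)) {..<m}" using w[OF K[OF that]] by (simp add: bij_betw_def)
    then show "inj_on (e (K \<tau>)) {..<i}" by (rule inj_on_subset) (use ik in auto)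
    show "\<tau> ` {..<i} = e (K \<tau>) ` {..<i}" using w[OF K[OF that]] by (simp add: K_def)
  qed
  then have "\<forall>\<tau>\<in>T. \<exists>s. \<forall>g. minor_cols i k \<tau> g = s * minor_cols i k (e (K \<tau>)) g" by simp
  from bchoice[OF this] obtain s where
    s: "\<forall>\<tau>\<in>T. \<forall>g. minor_cols i k \<tau> g = s \<tau> * minor_cols i k (e (K \<tau>)) g" by (elim exE)
  define \<beta> where "\<beta> \<tau> = (\<Prod>c<i. h $$ (\<tau> c, c)) * s \<tau> / a (K \<tau>) ^ i" for \<tau>
  have "corner i k (($$) (g * h)) =
      (\<Sum>\<tau>\<in>T. \<beta> \<tau> * corner i k (($$) (g * (a (K \<tau>) \<cdot>\<^sub>m perm_mat m (e (K \<tau>))))))"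
    if g: "g \<in> carrier_mat m m" for g
  proof -
    have "corner i k (($$) (g * h)) = (\<Sum>\<tau>\<in>{..<i} \<rightarrow>\<^sub>E {..<m}. (\<Prod>c<i. h $$ (\<tau> c, c)) * minor_cols i k \<tau> g)"
      by (rule corner_expand[OF g h ik])
    also have "\<dots> = (\<Sum>\<tau>\<in>T. (\<Prod>c<i. h $$ (\<tau> c, c)) * minor_cols i k \<tau> g)"
      by (rule sum.mono_neutral_right) (auto simp: T_def finite_PiE minor_cols_not_inj)
    also have "\<dots> = (\<Sum>\<tau>\<in>T. \<beta> \<tau> * corner i k (($$) (g * (a (K \<tau>) \<cdot>\<^sub>m perm_mat m (e (K \<tau>))))))"
    proof (rule sum.cong[OF refl])
      fix \<tau> assume t: "\<tau> \<in> T"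
      have "minor_cols i k \<tau> g = s \<tau> * minor_cols i k (e (K \<tau>)) g" using s t by blast
      then show "(\<Prod>c<i. h $$ (\<tau> c, c)) * minor_cols i k \<tau> g =
          \<beta> \<tau> * corner i k (($$) (g * (a (K \<tau>) \<cdot>\<^sub>m perm_mat m (e (K \<tau>)))))"
        using w[OF K[OF t]] by (simp add: \<beta>_def corner_perm_mat[OF ik g])
    qed
    finally show ?thesis .
  qed
  then show ?thesis using K by (intro exI[of _ T] exI[of _ \<beta>] exI[of _ K]) auto
qed

lemma det_zero_col:
  assumes "B \<in> carrier_mat i i" "c < i" "\<And>r. r < i \<Longrightarrow> B $$ (r, c) = 0"
  shows "det B = (0 :: complex)"
  using laplace_expansion_column[OF assms(1,2)] assms(3) by simp

text \<open>Minors in different column sets are separated by the matrices \<open>y\<close> that carry one of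
  the permutation matrices to \<open>w\<close>: the other translate then has a zero column in its corner.\<close>

lemma corner_perm_mat_other:
  assumes ik: "i + k = m" and w: "w \<in> carrier_mat m m" "w = b \<cdot>\<^sub>m antidiag m"
    and eJ: "bij_betw e {..<m} {..<m}" and e': "bij_betw e' {..<m} {..<m}"
    and ne: "e ` {..<i} \<noteq> e' ` {..<i}" and y: "y \<in> carrier_mat m m" "y * (a \<cdot>\<^sub>m perm_mat m e) = w" "a \<noteq> 0"
  shows "corner i k (($$) (y * (a' \<cdot>\<^sub>m perm_mat m e'))) = 0"
proof -
  have inj: "inj_on e {..<i}" "inj_on e' {..<i}"
    using eJ e' ik by (auto simp: bij_betw_def intro: inj_on_subset)
  have "\<not> e' ` {..<i} \<subseteq> e ` {..<i}"
    using ne card_subset_eq[of "e ` {..<i}" "e' ` {..<i}"] inj by (auto simp: card_image)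
  then obtain c where c: "c < i" "e' c \<notin> e ` {..<i}" by auto
  have cm: "e' c < m" using e' c ik by (auto simp: bij_betw_def)
  \<comment> \<open>column \<open>d\<close> lies outside the first \<open>i\<close>, so \<open>w\<close> is zero there in the last \<open>i\<close> rows\<close>
  then obtain d where d: "d < m" "e d = e' c" using eJ by (metis bij_betw_iff_bijections lessThan_iff)
  have "i \<le> d" using d c by (metis image_eqI lessThan_iff not_le)
  have "y $$ (k + r, e' c) = 0" if r: "r < i" for r
  proof -
    have "a * (y * perm_mat m e) $$ (k + r, d) = (y * (a \<cdot>\<^sub>m perm_mat m e)) $$ (k + r, d)"
      using y(1) r d ik by (subst mult_smult_distrib[OF y(1) perm_mat_carrier]) (simp add: perm_mat_def)
    also have "\<dots> = 0" unfolding y(2) w(2) using r d ik \<open>i \<le> d\<close> by (simp add: antidiag_def)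
    finally show ?thesis
      using y(3) perm_mat_mult[OF y(1), of "k + r" d e] r d ik cm by simp
  qed
  then have "minor_cols i k e' y = 0"
    unfolding minor_cols_def using c(1) by (intro det_zero_col[of _ i c]) auto
  then show ?thesis by (simp add: corner_perm_mat[OF ik y(1) e'])
qed

text \<open>Test the hypothesis on \<open>h = u w\<close> for elementary \<open>u\<close> that add column \<open>q\<close> of \<open>g\<close> to one of its
  last \<open>i\<close> columns. The corner of \<open>u w\<close> does not depend on \<open>u\<close>, so the invertible matrix \<open>B\<close> formed from the
  bottom right block of \<open>g\<close> keeps its determinant when the bottom part of column \<open>q\<close> is added to any of its
  columns. By Cramer's rule all coordinates of that part with respect to the columns of \<open>B\<close> vanish.\<close>

lemma corner_semi_invariant:
  assumes ik: "i + k = m" and g: "g \<in> carrier (SL m)" and w: "w \<in> carrier (SL m)" "w = b \<cdot>\<^sub>m antidiag m" "b \<noteq> 0"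
    and a: "a \<noteq> 0" "\<And>h. h \<in> carrier (SL m) \<Longrightarrow> corner i k (($$) (g * h)) = a * corner i k (($$) h)"
    and rq: "k \<le> r" "r < m" "q < k"
  shows "g $$ (r, q) = 0"
proof -
  have gm: "g \<in> carrier_mat m m" and wm: "w \<in> carrier_mat m m" using g w by (auto simp: SL_mat)
  define B where "B = mat i i (\<lambda>(r, c). b * g $$ (k + r, m - 1 - c))"
  have Bm: "B \<in> carrier_mat i i" by (simp add: B_def)
  have yw: "corner i k (($$) (y * w)) = det (mat i i (\<lambda>(r, c). b * y $$ (k + r, m - 1 - c)))"
    if y: "y \<in> carrier_mat m m" for y
  proof -
    have "mat i i (\<lambda>(r, c). (y * w) $$ (k + r, c)) = mat i i (\<lambda>(r, c). b * y $$ (k + r, m - 1 - c))"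
    proof (rule eq_matI)
      fix r c assume "r < dim_row (mat i i (\<lambda>(r, c). b * y $$ (k + r, m - 1 - c)))"
        "c < dim_col (mat i i (\<lambda>(r, c). b * y $$ (k + r, m - 1 - c)))"
      then have rc: "r < i" "c < i" by auto
      have "(y * w) $$ (k + r, c) = b * (y * antidiag m) $$ (k + r, c)"
        using y rc ik unfolding w(2) by (subst mult_smult_distrib[OF y antidiag_mat]) (simp add: antidiag_def)
      also have "\<dots> = b * y $$ (k + r, m - 1 - c)"
        using antidiag_mult_right[OF y, of "k + r" c] rc ik by simp
      finally show "mat i i (\<lambda>(r, c). (y * w) $$ (k + r, c)) $$ (r, c) =
          mat i i (\<lambda>(r, c). b * y $$ (k + r, m - 1 - c)) $$ (r, c)" using rc by simp
    qed auto
    then show ?thesis by (simp add: corner_def)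
  qed
  have detB: "det B = a * corner i k (($$) w)"
    using a(2)[OF w(1)] yw[OF gm] by (simp add: B_def)
  have nz: "det B \<noteq> 0" using detB a(1) corner_antidiag[OF ik w(3)] w(2) by simp
  define v where "v = vec i (\<lambda>r. b * g $$ (k + r, q))"
  define x where "x = (1 / det B) \<cdot>\<^sub>v (adj_mat B *\<^sub>v v)"
  have vm: "v \<in> carrier_vec i" by (simp add: v_def)
  have xm: "x \<in> carrier_vec i" using adj_mat(1)[OF Bm] vm by (simp add: x_def)
  have Bx: "B *\<^sub>v x = v"
  proof -
    have "B *\<^sub>v x = (1 / det B) \<cdot>\<^sub>v (B *\<^sub>v (adj_mat B *\<^sub>v v))"
      unfolding x_def using Bm adj_mat(1)[OF Bm] vm by (intro mult_mat_vec[of _ i i]) auto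
    also have "B *\<^sub>v (adj_mat B *\<^sub>v v) = (B * adj_mat B) *\<^sub>v v"
      using Bm adj_mat(1)[OF Bm] vm by (intro assoc_mult_mat_vec[symmetric]) auto
    also have "\<dots> = det B \<cdot>\<^sub>v v"
      unfolding adj_mat(2)[OF Bm] using vm by (intro eq_vecI) auto
    finally show ?thesis using nz vm by (auto intro!: eq_vecI)
  qed
  have "x $ p = 0" if p: "p < i" for p
  proof -
    define u where "u = mat m m (\<lambda>(r, c). if r = c then 1 else if r = q \<and> c = m - 1 - p then 1 else (0 :: complex))"
    have um: "u \<in> carrier_mat m m" by (simp add: u_def)
    have qp: "q < m - 1 - p" using rq p ik by auto
    have u: "u \<in> unipotents m"
      using qp by (auto simp: unipotents_def u_def intro!: upper_triangularI)
    have gu: "(g * u) $$ (r, c) = g $$ (r, c) + (if c = m - 1 - p then g $$ (r, q) else 0)" if "r < m" "c < m" for r c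
    proof -
      have "(g * u) $$ (r, c) = (\<Sum>j<m. g $$ (r, j) * u $$ (j, c))" by (rule mult_entry[OF gm um that])
      also have "\<dots> = (\<Sum>j<m. (if j = c then g $$ (r, j) else 0) + (if j = q then (if c = m - 1 - p then g $$ (r, j) else 0) else 0))"
        by (rule sum.cong[OF refl]) (use that qp in \<open>auto simp: u_def\<close>)
      also have "\<dots> = g $$ (r, c) + (if c = m - 1 - p then g $$ (r, q) else 0)"
        using that rq ik by (simp add: sum.distrib)
      finally show ?thesis .
    qed
    have "corner i k (($$) (g * (u * w))) = a * corner i k (($$) w)"
      using a(2)[OF SL_mult_closed[OF unipotents_SL[OF u] w(1)]] corner_unipotent[OF ik u wm] by simp
    then have "corner i k (($$) ((g * u) * w)) = det B"
      using assoc_mult_mat[OF gm um wm] detB by simp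
    then have 1: "det (mat i i (\<lambda>(r, c). b * (g * u) $$ (k + r, m - 1 - c))) = det B"
      using yw[of "g * u"] gm um by simp
    have "mat i i (\<lambda>(r, c). b * (g * u) $$ (k + r, m - 1 - c)) = replace_col B (B *\<^sub>v (unit_vec i p + x)) p"
    proof -
      have "B *\<^sub>v (unit_vec i p + x) = B *\<^sub>v unit_vec i p + v"
        using Bm xm Bx by (simp add: mult_add_distrib_mat_vec[of _ i i])
      also have "B *\<^sub>v unit_vec i p = col B p" using Bm p by (auto intro!: eq_vecI)
      finally show ?thesis
        unfolding replace_col_def
        by (intro eq_matI) (use Bm p ik in \<open>auto simp: gu B_def v_def algebra_simps simp del: index_mult_mat(1)\<close>)
    qed
    then have "(1 + x $ p) * det B = det B"
      using 1 cramer_lemma_mat[OF Bm _ p, of "unit_vec i p + x"] xm p by simp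
    then show ?thesis using nz by (simp add: algebra_simps)
  qed
  then have "x = 0\<^sub>v i" using xm by (intro eq_vecI) auto
  then have "v = 0\<^sub>v i" using Bx Bm by (auto intro!: eq_vecI)
  then have "v $ (r - k) = 0" using rq ik by simp
  moreover have "k + (r - k) = r" "r - k < i" using rq ik by auto
  then have "v $ (r - k) = b * g $$ (r, q)" by (simp add: v_def)
  ultimately show ?thesis using w(3) by simp
qed

section \<open>The fundamental representation\<close>

lemma line_stable_iff:
  fixes X :: "complex mat"
  assumes X: "X \<in> carrier_mat N N" and v: "v \<in> carrier_vec N" "v \<noteq> 0\<^sub>v N"
  shows "(\<lambda>w. X *\<^sub>v w) ` line v = line v \<longleftrightarrow> (\<exists>c. c \<noteq> 0 \<and> X *\<^sub>v v = c \<cdot>\<^sub>v v)"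
proof
  assume eq: "(\<lambda>w. X *\<^sub>v w) ` line v = line v"
  have "v \<in> line v" unfolding line_def by (auto intro!: exI[of _ 1])
  then have "X *\<^sub>v v \<in> line v" and "v \<in> (\<lambda>w. X *\<^sub>v w) ` line v" using eq by auto
  then obtain c w where c: "X *\<^sub>v v = c \<cdot>\<^sub>v v" and "w \<in> line v" "v = X *\<^sub>v w"
    unfolding line_def by blast
  then obtain a where a: "v = X *\<^sub>v (a \<cdot>\<^sub>v v)" unfolding line_def by blast
  have "v = a \<cdot>\<^sub>v (c \<cdot>\<^sub>v v)" using a mult_mat_vec[OF X v(1), of a] c by simp
  then have vv: "v = (a * c) \<cdot>\<^sub>v v" by (simp add: smult_smult_assoc)
  have "c \<noteq> 0"
  proof
    assume "c = 0"
    then have "v $ r = 0" if "r < N" for r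
      using arg_cong[OF vv, of "\<lambda>z. z $ r"] that v(1) by simp
    then have "v = 0\<^sub>v N" using v(1) by (intro eq_vecI) auto
    then show False using v(2) by simp
  qed
  then show "\<exists>c. c \<noteq> 0 \<and> X *\<^sub>v v = c \<cdot>\<^sub>v v" using c by blast
next
  assume "\<exists>c. c \<noteq> 0 \<and> X *\<^sub>v v = c \<cdot>\<^sub>v v"
  then obtain c where c: "c \<noteq> 0" "X *\<^sub>v v = c \<cdot>\<^sub>v v" by blast
  have *: "X *\<^sub>v (a \<cdot>\<^sub>v v) = (a * c) \<cdot>\<^sub>v v" for a
    using mult_mat_vec[OF X v(1), of a] c by (simp add: smult_smult_assoc)
  show "(\<lambda>w. X *\<^sub>v w) ` line v = line v"
  proof (intro equalityI subsetI)
    fix y assume "y \<in> line v"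
    then obtain a where "y = a \<cdot>\<^sub>v v" by (auto simp: line_def)
    then have "y = X *\<^sub>v ((a / c) \<cdot>\<^sub>v v)" using c(1) by (simp add: *)
    then show "y \<in> (\<lambda>w. X *\<^sub>v w) ` line v" by (auto simp: line_def)
  qed (auto simp: line_def *)
qed

text \<open>A polynomial without zeros on the affine space of unitriangular matrices is constant on
  each complex line, by the fundamental theorem of algebra.\<close>

lemma unipotent_character_trivial:
  assumes F: "polyfun (entries m) F" and nz: "\<And>u. u \<in> unipotents m \<Longrightarrow> F (($$) u) \<noteq> 0"
    and u: "u \<in> unipotents m"
  shows "F (($$) u) = F (($$) (1\<^sub>m m))"
proof -
  have u': "u \<in> carrier_mat m m" "upper_triangular u" "\<forall>r<m. u $$ (r, r) = 1"
    using u by (auto simp: unipotents_def)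
  define x where "x s = (\<lambda>v. 1\<^sub>m m $$ v + s * (u $$ v - 1\<^sub>m m $$ v))" for s :: complex
  obtain p where p: "\<forall>s. F (x s) = poly p s"
    using polyfun_line[OF F, of "($$) (1\<^sub>m m)" "($$) u"] unfolding x_def by (elim exE)
  have "poly p s \<noteq> 0" for s
  proof -
    have "mat m m (x s) \<in> unipotents m"
      using u' upper_triangularD[OF u'(2)] by (auto simp: unipotents_def x_def intro!: upper_triangularI)
    from nz[OF this] have "F (($$) (mat m m (x s))) \<noteq> 0" .
    moreover have "F (($$) (mat m m (x s))) = F (x s)" by (rule polyfun_cong[OF F]) auto
    ultimately show ?thesis using p by simp
  qed
  then have "constant (poly p)" using fundamental_theorem_of_algebra by blast
  then have "poly p 1 = poly p 0" unfolding constant_def by blast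
  moreover have "F (x 1) = F (($$) u)" "F (x 0) = F (($$) (1\<^sub>m m))"
    by (rule polyfun_cong[OF F], simp add: x_def)+
  ultimately show ?thesis using p by simp
qed

definition block_parabolic :: "nat \<Rightarrow> nat \<Rightarrow> complex mat set" where
  "block_parabolic m k = {g \<in> carrier (SL m). \<forall>r q. k \<le> r \<longrightarrow> r < m \<longrightarrow> q < k \<longrightarrow> g $$ (r, q) = 0}"

text \<open>This description by semi-invariance matches the stabilizer of a functional, and it
  makes closure under products and inverses evident.\<close>

lemma block_parabolic_iff:
  assumes ik: "i + k = m" and m: "0 < m"
  shows "g \<in> block_parabolic m k \<longleftrightarrow> g \<in> carrier (SL m) \<and>
    (\<exists>a. a \<noteq> 0 \<and> (\<forall>h\<in>carrier (SL m). corner i k (($$) (g * h)) = a * corner i k (($$) h)))"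
proof -
  obtain b where b: "b \<noteq> 0" "b \<cdot>\<^sub>m antidiag m \<in> carrier (SL m)"
    by (rule scale_to_SL[OF antidiag_mat det_antidiag m])
  define w where "w = b \<cdot>\<^sub>m antidiag m"
  have w: "w \<in> carrier (SL m)" and cw: "corner i k (($$) w) \<noteq> 0"
    using b corner_antidiag[OF ik b(1)] by (auto simp: w_def)
  show ?thesis
  proof (intro iffI conjI)
    assume "g \<in> block_parabolic m k"
    then have g: "g \<in> carrier (SL m)" "\<And>r q. k \<le> r \<Longrightarrow> r < m \<Longrightarrow> q < k \<Longrightarrow> g $$ (r, q) = 0"
      by (auto simp: block_parabolic_def)
    then show "g \<in> carrier (SL m)" by blast
    define D where "D = det (mat i i (\<lambda>(r, c). g $$ (k + r, k + c)))"
    have D: "corner i k (($$) (g * h)) = D * corner i k (($$) h)" if "h \<in> carrier (SL m)" for h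
      unfolding D_def by (rule corner_left_mult[OF ik SL_mat[OF g(1)] SL_mat[OF that] g(2)])
    moreover have "D \<noteq> 0"
      using D[OF SL_mult_closed[OF SL_inv_closed[OF g(1)] w]] SL_inv_cancel(2)[OF g(1) w] cw by auto
    ultimately show "\<exists>a. a \<noteq> 0 \<and> (\<forall>h\<in>carrier (SL m). corner i k (($$) (g * h)) = a * corner i k (($$) h))"
      by blast
  next
    assume "g \<in> carrier (SL m) \<and>
      (\<exists>a. a \<noteq> 0 \<and> (\<forall>h\<in>carrier (SL m). corner i k (($$) (g * h)) = a * corner i k (($$) h)))"
    then obtain a where g: "g \<in> carrier (SL m)" and a: "a \<noteq> 0"
      "\<And>h. h \<in> carrier (SL m) \<Longrightarrow> corner i k (($$) (g * h)) = a * corner i k (($$) h)" by blast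
    then show "g \<in> block_parabolic m k"
      using corner_semi_invariant[OF ik g w w_def b(1) a] by (auto simp: block_parabolic_def)
  qed
qed

lemma block_parabolic_subgroup:
  assumes ik: "i + k = m" and m: "0 < m"
  shows "subgroup (block_parabolic m k) (SL m)"
proof (rule group.subgroupI[OF group_SL])
  show "block_parabolic m k \<subseteq> carrier (SL m)" by (auto simp: block_parabolic_def)
  have "1\<^sub>m m \<in> block_parabolic m k" by (auto simp: block_parabolic_def SL_one_closed)
  then show "block_parabolic m k \<noteq> {}" by blast
next
  fix g assume "g \<in> block_parabolic m k"
  then obtain a where g: "g \<in> carrier (SL m)" and a: "a \<noteq> 0"
    "\<And>h. h \<in> carrier (SL m) \<Longrightarrow> corner i k (($$) (g * h)) = a * corner i k (($$) h)"
    unfolding block_parabolic_iff[OF ik m] by blast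
  have "corner i k (($$) (inv\<^bsub>SL m\<^esub> g * h)) = (1 / a) * corner i k (($$) h)" if h: "h \<in> carrier (SL m)" for h
    using a(2)[OF SL_mult_closed[OF SL_inv_closed[OF g] h]] a(1) SL_inv_cancel(2)[OF g h] by simp
  then show "inv\<^bsub>SL m\<^esub> g \<in> block_parabolic m k"
    unfolding block_parabolic_iff[OF ik m] using SL_inv_closed[OF g] a(1) by (intro conjI exI[of _ "1 / a"]) auto
next
  fix g g' assume "g \<in> block_parabolic m k" "g' \<in> block_parabolic m k"
  then obtain a a' where g: "g \<in> carrier (SL m)" "g' \<in> carrier (SL m)" and a: "a \<noteq> 0" "a' \<noteq> 0"
    "\<And>h. h \<in> carrier (SL m) \<Longrightarrow> corner i k (($$) (g * h)) = a * corner i k (($$) h)"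
    "\<And>h. h \<in> carrier (SL m) \<Longrightarrow> corner i k (($$) (g' * h)) = a' * corner i k (($$) h)"
    unfolding block_parabolic_iff[OF ik m] by blast
  have "corner i k (($$) (g * g' * h)) = (a * a') * corner i k (($$) h)" if h: "h \<in> carrier (SL m)" for h
    using a(3)[OF SL_mult_closed[OF g(2) h]] a(4)[OF h] by (simp add: SL_assoc[OF g h])
  then show "g \<otimes>\<^bsub>SL m\<^esub> g' \<in> block_parabolic m k"
    unfolding block_parabolic_iff[OF ik m] mult_SL using SL_mult_closed[OF g] a(1,2)
    by (intro conjI exI[of _ "a * a'"]) auto
qed

locale fundamental_rep =
  fixes n m i k N :: nat and \<rho> :: "complex mat \<Rightarrow> complex mat" and v f :: "complex vec"
  assumes m_eq: "n + 1 = m" and ik: "i + k = m"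
    and rational: "rational_rep n N \<rho>"
    and irreducible: "irreducible_rep n N \<rho>"
    and v: "v \<in> carrier_vec N" "v \<noteq> 0\<^sub>v N" "borel n \<subseteq> line_stabilizer n \<rho> v"
    and v_weight: "\<And>t. t \<in> torus n \<Longrightarrow> \<rho> t *\<^sub>v v = fundamental_weight i t \<cdot>\<^sub>v v"
    and f: "generates_B_stable_dual_line n N \<rho> f"
begin

abbreviation "G \<equiv> carrier (SL m)"
abbreviation "Inv \<equiv> m_inv (SL m)"

lemma m_pos: "0 < m"
  using m_eq by simp

lemma f_vec: "f \<in> carrier_vec N" "f \<noteq> 0\<^sub>v N"
  using f by (auto simp: generates_B_stable_dual_line_def)

lemma rho_hom: "\<rho> \<in> hom (SL m) (GL N)"
  using rational unfolding rational_rep_def m_eq by blast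

lemma rho_mat: "g \<in> G \<Longrightarrow> \<rho> g \<in> carrier_mat N N"
  using rho_hom by (auto simp: hom_def GL_def)

lemma rho_mult: "g \<in> G \<Longrightarrow> h \<in> G \<Longrightarrow> \<rho> (g * h) = \<rho> g * \<rho> h"
  using rho_hom by (auto simp: hom_def GL_def mult_SL)

lemma rho_one: "\<rho> (1\<^sub>m m) = 1\<^sub>m N"
proof -
  let ?X = "\<rho> (1\<^sub>m m)"
  have X: "?X \<in> carrier_mat N N" "det ?X \<noteq> 0"
    using rho_hom SL_one_closed[of m] by (auto simp: hom_def GL_def)
  have XX: "?X * ?X = ?X" using rho_mult[OF SL_one_closed SL_one_closed] by simp
  \<comment> \<open>an idempotent invertible matrix is the identity\<close>
  have "det ?X \<cdot>\<^sub>m ?X = (det ?X \<cdot>\<^sub>m 1\<^sub>m N) * ?X"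
    using X(1) by (simp add: mult_smult_assoc_mat[OF one_carrier_mat X(1)])
  also have "\<dots> = adj_mat ?X * (?X * ?X)"
    unfolding adj_mat(3)[OF X(1), symmetric] by (rule assoc_mult_mat[OF adj_mat(1)[OF X(1)] X(1) X(1)])
  also have "\<dots> = det ?X \<cdot>\<^sub>m 1\<^sub>m N" unfolding XX by (rule adj_mat(3)[OF X(1)])
  finally have eq: "det ?X \<cdot>\<^sub>m ?X = det ?X \<cdot>\<^sub>m 1\<^sub>m N" .
  show ?thesis
  proof (rule eq_matI)
    fix r c assume "r < dim_row (1\<^sub>m N :: complex mat)" "c < dim_col (1\<^sub>m N :: complex mat)"
    then show "?X $$ (r, c) = 1\<^sub>m N $$ (r, c)"
      using arg_cong[OF eq, of "\<lambda>A. A $$ (r, c)"] X by simp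
  qed (use X in auto)
qed

lemma rho_vec: "g \<in> G \<Longrightarrow> u \<in> carrier_vec N \<Longrightarrow> \<rho> g *\<^sub>v u \<in> carrier_vec N"
  by (rule mult_mat_vec_carrier[OF rho_mat])

lemma rho_act: "g \<in> G \<Longrightarrow> h \<in> G \<Longrightarrow> u \<in> carrier_vec N \<Longrightarrow> \<rho> (g * h) *\<^sub>v u = \<rho> g *\<^sub>v (\<rho> h *\<^sub>v u)"
  by (simp add: rho_mult assoc_mult_mat_vec[OF rho_mat rho_mat])

lemma rho_inv_act:
  assumes "g \<in> G" "u \<in> carrier_vec N"
  shows "\<rho> (Inv g) *\<^sub>v (\<rho> g *\<^sub>v u) = u" "\<rho> g *\<^sub>v (\<rho> (Inv g) *\<^sub>v u) = u"
  using assms SL_inv_closed[OF assms(1)]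
  by (simp_all add: rho_act[symmetric] SL_l_inv SL_r_inv rho_one)

text \<open>The vectors \<open>u\<close> for which all these values vanish form an invariant subspace. The lemma serves in
  both directions: for fixed \<open>y\<close> it shows that vectors are equal, for fixed \<open>u\<close> that functionals are.\<close>

lemma separation:
  assumes y: "y \<in> carrier_vec N" "y \<noteq> 0\<^sub>v N" and u: "u \<in> carrier_vec N" "u \<noteq> 0\<^sub>v N"
  shows "\<exists>h\<in>G. y \<bullet> (\<rho> h *\<^sub>v u) \<noteq> 0"
proof (rule ccontr)
  assume neg: "\<not> ?thesis"
  define W where "W = {u \<in> carrier_vec N. \<forall>h\<in>G. y \<bullet> (\<rho> h *\<^sub>v u) = 0}"
  have "linear_subspace N W"
    unfolding linear_subspace_def
  proof (intro conjI ballI allI)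
    have "\<rho> h *\<^sub>v 0\<^sub>v N = 0\<^sub>v N" if "h \<in> G" for h
      by (rule eq_vecI) (use rho_mat[OF that] in auto)
    then show "0\<^sub>v N \<in> W" using y by (auto simp: W_def)
    show "a + b \<in> W" if "a \<in> W" "b \<in> W" for a b
      using that y rho_mat rho_vec
      by (auto simp: W_def mult_add_distrib_mat_vec[of _ N N] scalar_prod_add_distrib[of _ N])
    show "c \<cdot>\<^sub>v a \<in> W" if "a \<in> W" for c a
      using that y rho_mat rho_vec by (auto simp: W_def mult_mat_vec[of _ N N] scalar_prod_smult_distrib[of _ N])
  qed (auto simp: W_def)
  moreover have "\<rho> g *\<^sub>v w \<in> W" if "g \<in> G" "w \<in> W" for g w
    using that by (auto simp: W_def rho_vec rho_act[symmetric] SL_mult_closed)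
  ultimately have "W = {0\<^sub>v N} \<or> W = carrier_vec N"
    using irreducible unfolding irreducible_rep_def m_eq by blast
  moreover have "u \<in> W" using neg u by (auto simp: W_def)
  ultimately have W: "W = carrier_vec N" using u by auto
  have "y $ r = 0" if "r < N" for r
  proof -
    have "unit_vec N r \<in> W" using W by simp
    then have "y \<bullet> (\<rho> (1\<^sub>m m) *\<^sub>v unit_vec N r) = 0" unfolding W_def using SL_one_closed by blast
    then show ?thesis using that by (simp add: rho_one)
  qed
  then have "y = 0\<^sub>v N" using y by (intro eq_vecI) auto
  then show False using y by simp
qed

lemma transpose_rho: "g \<in> G \<Longrightarrow> y \<in> carrier_vec N \<Longrightarrow> u \<in> carrier_vec N \<Longrightarrow>
    (transpose_mat (\<rho> g) *\<^sub>v y) \<bullet> u = y \<bullet> (\<rho> g *\<^sub>v u)"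
  by (rule transpose_vec_mult_scalar[OF rho_mat])

lemma coefficient_polyfun:
  assumes "y \<in> carrier_vec N" "u \<in> carrier_vec N"
  shows "\<exists>F. polyfun (entries m) F \<and> (\<forall>g\<in>G. y \<bullet> (\<rho> g *\<^sub>v u) = F (($$) g))"
proof -
  have "\<forall>rc\<in>entries N. \<exists>F. polyfun (entries m) F \<and> (\<forall>g\<in>G. \<rho> g $$ rc = F (($$) g))"
  proof
    fix rc assume "rc \<in> entries N"
    then obtain r c where rc: "rc = (r, c)" "r < N" "c < N" by auto
    then obtain p where "p \<in> polys_in (entries m)" "\<forall>g\<in>G. \<rho> g $$ rc = eval_poly p (($$) g)"
      using rational unfolding rational_rep_def m_eq by blast
    then show "\<exists>F. polyfun (entries m) F \<and> (\<forall>g\<in>G. \<rho> g $$ rc = F (($$) g))"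
      using polyfun_eval_poly by blast
  qed
  from bchoice[OF this] obtain R where
    R: "\<forall>rc\<in>entries N. polyfun (entries m) (R rc) \<and> (\<forall>g\<in>G. \<rho> g $$ rc = R rc (($$) g))" by (elim exE)
  have "y \<bullet> (\<rho> g *\<^sub>v u) = (\<Sum>r<N. y $ r * (\<Sum>c<N. R (r, c) (($$) g) * u $ c))" if g: "g \<in> G" for g
  proof -
    have "y \<bullet> (\<rho> g *\<^sub>v u) = (\<Sum>r<N. y $ r * (\<Sum>c<N. \<rho> g $$ (r, c) * u $ c))"
      using rho_mat[OF g] assms by (simp add: scalar_prod_def mult_mat_vec_def atLeast0LessThan)
    then show ?thesis using R g by simp
  qed
  moreover have "polyfun (entries m) (\<lambda>x. \<Sum>r<N. y $ r * (\<Sum>c<N. R (r, c) x * u $ c))"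
    using R by (auto intro!: polyfun_intros)
  ultimately show ?thesis by (intro exI[of _ "\<lambda>x. \<Sum>r<N. y $ r * (\<Sum>c<N. R (r, c) x * u $ c)"]) simp
qed

lemma inverse_polyfun:
  assumes F: "polyfun (entries m) F"
  shows "\<exists>F'. polyfun (entries m) F' \<and> (\<forall>g\<in>G. F (($$) (Inv g)) = F' (($$) g))"
proof -
  have "\<forall>rc\<in>entries m. \<exists>A. polyfun (entries m) A \<and> (\<forall>g\<in>carrier_mat m m. adj_mat g $$ rc = A (($$) g))"
    using polyfun_adj_mat_entry[of _ m] by fastforce
  from bchoice[OF this] obtain A where
    A: "\<forall>rc\<in>entries m. polyfun (entries m) (A rc) \<and> (\<forall>g\<in>carrier_mat m m. adj_mat g $$ rc = A rc (($$) g))"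
    by (elim exE)
  have "polyfun (entries m) (\<lambda>x. F (\<lambda>rc. A rc x))"
    by (rule polyfun_compose[OF F]) (use A in blast)
  moreover have "F (($$) (Inv g)) = F (\<lambda>rc. A rc (($$) g))" if "g \<in> G" for g
    unfolding inv_SL[OF that] by (rule polyfun_cong[OF F]) (use A SL_mat[OF that] in blast)
  ultimately show ?thesis by (intro exI[of _ "\<lambda>x. F (\<lambda>rc. A rc x)"]) simp
qed

lemma unipotents_borel: "u \<in> unipotents m \<Longrightarrow> u \<in> borel n"
  unfolding borel_def m_eq by (auto simp: unipotents_SL) (simp add: unipotents_def)

text \<open>The eigenvalue on the stable line is a coordinate of \<open>\<rho>(u) v\<close>, thus polynomial in \<open>u\<close>.\<close>

lemma unipotent_fixes_v:
  assumes u: "u \<in> unipotents m" shows "\<rho> u *\<^sub>v v = v"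
proof -
  have ex: "\<exists>c. c \<noteq> 0 \<and> \<rho> u *\<^sub>v v = c \<cdot>\<^sub>v v" if u: "u \<in> unipotents m" for u
  proof -
    have "(\<lambda>w. \<rho> u *\<^sub>v w) ` line v = line v"
      using v(3) unipotents_borel[OF u] unfolding line_stabilizer_def by blast
    then show ?thesis using line_stable_iff[OF rho_mat v(1,2)] unipotents_SL[OF u] by blast
  qed
  obtain r where r: "r < N" "v $ r \<noteq> 0" using v(1,2) by (metis eq_vecI carrier_vecD index_zero_vec)
  obtain F where F: "polyfun (entries m) F \<and> (\<forall>g\<in>G. unit_vec N r \<bullet> (\<rho> g *\<^sub>v v) = F (($$) g))"
    using coefficient_polyfun[OF unit_vec_carrier[of N r] v(1)] by (elim exE)
  have Fu: "F (($$) u) = (\<rho> u *\<^sub>v v) $ r" if "u \<in> unipotents m" for u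
    using bspec[OF conjunct2[OF F] unipotents_SL[OF that]]
      scalar_prod_left_unit[OF rho_vec[OF unipotents_SL[OF that] v(1)] r(1)] by simp
  have one: "1\<^sub>m m \<in> unipotents m" by (auto simp: unipotents_def)
  have "F (($$) u) = F (($$) (1\<^sub>m m))"
  proof (rule unipotent_character_trivial[OF conjunct1[OF F] _ u])
    fix u assume u: "u \<in> unipotents m"
    then show "F (($$) u) \<noteq> 0" using ex[OF u] r v(1) by (auto simp: Fu)
  qed
  then have "(\<rho> u *\<^sub>v v) $ r = v $ r" using Fu[OF u] Fu[OF one] v(1) by (simp add: rho_one)
  moreover obtain c where "\<rho> u *\<^sub>v v = c \<cdot>\<^sub>v v" using ex[OF u] by blast
  ultimately show ?thesis using r v(1) by auto
qed

lemma unipotent_fixes_f: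
  assumes u: "u \<in> unipotents m" and x: "x \<in> carrier_vec N" shows "f \<bullet> (\<rho> (Inv u) *\<^sub>v x) = f \<bullet> x"
proof -
  have ex: "\<exists>c. c \<noteq> 0 \<and> transpose_mat (\<rho> (Inv u)) *\<^sub>v f = c \<cdot>\<^sub>v f" if u: "u \<in> unipotents m" for u
  proof -
    have "(\<lambda>w. transpose_mat (\<rho> (Inv u)) *\<^sub>v w) ` line f = line f"
      using f unipotents_borel[OF u]
      unfolding generates_B_stable_dual_line_def line_stabilizer_def dual_rep_def m_eq by blast
    then show ?thesis
      using line_stable_iff[OF _ f_vec] rho_mat[OF SL_inv_closed[OF unipotents_SL[OF u]]] by simp
  qed
  obtain r where r: "r < N" "f $ r \<noteq> 0" using f_vec by (metis eq_vecI carrier_vecD index_zero_vec)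
  obtain F0 where F0: "polyfun (entries m) F0 \<and> (\<forall>g\<in>G. f \<bullet> (\<rho> g *\<^sub>v unit_vec N r) = F0 (($$) g))"
    using coefficient_polyfun[OF f_vec(1) unit_vec_carrier[of N r]] by (elim exE)
  obtain F where F: "polyfun (entries m) F \<and> (\<forall>g\<in>G. F0 (($$) (Inv g)) = F (($$) g))"
    using inverse_polyfun[OF conjunct1[OF F0]] by (elim exE)
  have Fu: "F (($$) u) = f \<bullet> (\<rho> (Inv u) *\<^sub>v unit_vec N r)" if "u \<in> unipotents m" for u
    using F F0 unipotents_SL[OF that] SL_inv_closed[OF unipotents_SL[OF that]] by auto
  have coeff: "f \<bullet> (\<rho> (Inv u) *\<^sub>v x) = c * (f \<bullet> x)"
    if "u \<in> unipotents m" "x \<in> carrier_vec N" "transpose_mat (\<rho> (Inv u)) *\<^sub>v f = c \<cdot>\<^sub>v f" for u x c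
    using transpose_rho[OF SL_inv_closed[OF unipotents_SL[OF that(1)]] f_vec(1) that(2)] that(2,3) f_vec by simp
  have one: "1\<^sub>m m \<in> unipotents m" by (auto simp: unipotents_def)
  have inv1: "Inv (1\<^sub>m m) = 1\<^sub>m m"
    using monoid.inv_one[OF group.is_monoid[OF group_SL], of m] by (simp add: one_SL)
  have "F (($$) u) = F (($$) (1\<^sub>m m))"
  proof (rule unipotent_character_trivial[OF conjunct1[OF F] _ u])
    fix u assume u: "u \<in> unipotents m"
    then obtain c where c: "c \<noteq> 0" "transpose_mat (\<rho> (Inv u)) *\<^sub>v f = c \<cdot>\<^sub>v f" using ex by blast
    then show "F (($$) u) \<noteq> 0"
      using r coeff[OF u unit_vec_carrier c(2), of r] by (simp add: Fu[OF u])
  qed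
  then have 1: "f \<bullet> (\<rho> (Inv u) *\<^sub>v unit_vec N r) = f $ r"
    using Fu[OF u] Fu[OF one] r by (simp add: inv1 rho_one)
  obtain c where c: "transpose_mat (\<rho> (Inv u)) *\<^sub>v f = c \<cdot>\<^sub>v f" using ex[OF u] by blast
  have "c = 1" using 1 coeff[OF u unit_vec_carrier c, of r] r by simp
  then show ?thesis using coeff[OF u x c] by simp
qed

text \<open>An upper triangular matrix is its diagonal part, which acts through the weight, times a
  unitriangular one.\<close>

lemma borel_acts_on_v:
  assumes b: "b \<in> G" "upper_triangular b"
  shows "\<rho> b *\<^sub>v v = (\<Prod>r<i. b $$ (r, r)) \<cdot>\<^sub>v v"
proof -
  have bm: "b \<in> carrier_mat m m" "(\<Prod>r<m. b $$ (r, r)) = 1"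
    using b det_triangular[of b m] by (auto simp: carrier_SL)
  have nz: "b $$ (r, r) \<noteq> 0" if "r < m" for r
  proof
    assume "b $$ (r, r) = 0"
    then have "(\<Prod>r<m. b $$ (r, r)) = 0" using that by (intro prod_zero) auto
    then show False using bm(2) by simp
  qed
  define t where "t = mat_diag m (\<lambda>r. b $$ (r, r))"
  define s where "s = mat_diag m (\<lambda>r. inverse (b $$ (r, r)))"
  have tm: "t \<in> carrier_mat m m" "s \<in> carrier_mat m m" by (auto simp: t_def s_def)
  have "upper_triangular t" by (rule upper_triangularI) (auto simp: t_def mat_diag_def)
  then have "det t = 1" using det_triangular[OF tm(1)] bm(2) by (simp add: t_def mat_diag_def)
  then have tG: "t \<in> G" using tm by (auto simp: carrier_SL)
  have tT: "t \<in> torus n" using tG unfolding torus_def m_eq by (auto simp: diagonal_mat_def) (auto simp: t_def mat_diag_def)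
  have sb: "s * b = mat m m (\<lambda>(r, c). inverse (b $$ (r, r)) * b $$ (r, c))"
    unfolding s_def by (rule mat_diag_mult_left[OF bm(1)])
  have u: "s * b \<in> unipotents m"
    using nz bm(1) upper_triangularD[OF b(2)] unfolding sb by (auto simp: unipotents_def intro!: upper_triangularI)
  have "t * s = 1\<^sub>m m" unfolding t_def s_def mat_diag_diag by (rule eq_matI) (use nz in \<open>auto simp: mat_diag_def\<close>)
  then have "t * (s * b) = b" using assoc_mult_mat[OF tm bm(1)] bm(1) by simp
  then have "\<rho> b *\<^sub>v v = \<rho> t *\<^sub>v v"
    using rho_act[OF tG unipotents_SL[OF u] v(1)] unipotent_fixes_v[OF u] by simp
  also have "\<dots> = (\<Prod>r<i. b $$ (r, r)) \<cdot>\<^sub>v v"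
    unfolding v_weight[OF tT] fundamental_weight_def using ik
    by (intro arg_cong2[where f = "(\<cdot>\<^sub>v)"] prod.cong) (auto simp: t_def mat_diag_def)
  finally show ?thesis .
qed

lemma coefficient_is_minor:
  "\<exists>c. c \<noteq> 0 \<and> (\<forall>g\<in>G. f \<bullet> (\<rho> g *\<^sub>v v) = c * corner i k (($$) g))"
proof -
  obtain a where a: "a \<noteq> 0" "a \<cdot>\<^sub>m antidiag m \<in> G"
    by (rule scale_to_SL[OF antidiag_mat det_antidiag m_pos])
  define w where "w = a \<cdot>\<^sub>m antidiag m"
  have w: "w \<in> G" and cw: "corner i k (($$) w) \<noteq> 0"
    using a corner_antidiag[OF ik a(1)] by (auto simp: w_def)
  obtain F where F: "polyfun (entries m) F \<and> (\<forall>g\<in>G. f \<bullet> (\<rho> g *\<^sub>v v) = F (($$) g))"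
    using coefficient_polyfun[OF f_vec(1) v(1)] by (elim exE)
  have Fg: "F (($$) g) = f \<bullet> (\<rho> g *\<^sub>v v)" if "g \<in> G" for g using F that by simp
  define c where "c = F (($$) w) / corner i k (($$) w)"
  define E where "E x = F x - c * corner i k x" for x
  have E: "polyfun (entries m) E"
    unfolding E_def using F polyfun_corner[OF ik] by (auto intro!: polyfun_intros)
  have Ez: "E (($$) g) = 0" if g: "g \<in> G" for g
  proof (rule big_cell_dense[OF E w_def w a(1) m_pos _ _ _ g])
    fix u g assume ug: "u \<in> unipotents m" "g \<in> G" "E (($$) g) = 0"
    have uG: "u \<in> G" by (rule unipotents_SL[OF ug(1)])
    have "f \<bullet> (\<rho> (u * g) *\<^sub>v v) = f \<bullet> (\<rho> (Inv u) *\<^sub>v (\<rho> (u * g) *\<^sub>v v))"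
      using unipotent_fixes_f[OF ug(1) rho_vec[OF SL_mult_closed[OF uG ug(2)] v(1)]] by simp
    also have "\<dots> = f \<bullet> (\<rho> g *\<^sub>v v)"
      using rho_act[OF uG ug(2) v(1)] rho_inv_act(1)[OF uG rho_vec[OF ug(2) v(1)]] by simp
    finally have "F (($$) (u * g)) = F (($$) g)" using uG ug(2) by (simp add: Fg SL_mult_closed)
    then show "E (($$) (u * g)) = 0"
      using ug(3) corner_unipotent[OF ik ug(1) SL_mat[OF ug(2)]] by (simp add: E_def)
  next
    fix b g assume bg: "b \<in> G" "upper_triangular b" "g \<in> G" "E (($$) g) = 0"
    have "F (($$) (g * b)) = F (($$) g) * (\<Prod>r<i. b $$ (r, r))"
      using bg rho_vec[OF bg(3) v(1)] rho_mat[OF bg(3)] f_vec(1) v(1)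
      by (simp add: Fg SL_mult_closed rho_act borel_acts_on_v mult_mat_vec[of _ N N])
    then show "E (($$) (g * b)) = 0"
      using bg(4) corner_right_mult[OF ik SL_mat[OF bg(1)] bg(2) SL_mat[OF bg(3)]]
      by (simp add: E_def algebra_simps)
  next
    show "E (($$) w) = 0" using cw by (simp add: E_def c_def)
  qed
  then have *: "f \<bullet> (\<rho> g *\<^sub>v v) = c * corner i k (($$) g)" if "g \<in> G" for g
    using Fg[OF that] Ez[OF that] by (simp add: E_def)
  moreover have "c \<noteq> 0" using separation[OF f_vec v(1,2)] * by auto
  ultimately show ?thesis by blast
qed

text \<open>By the formula for the coefficient and by separation, \<open>g\<close> stabilizes the line of \<open>f\<close> exactly
  when left translation by \<open>g\<close> rescales the corner minor.\<close>

lemma parabolic_block: "parabolic n \<rho> f = block_parabolic m k"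
proof -
  obtain c where c: "c \<noteq> 0" "\<And>g. g \<in> G \<Longrightarrow> f \<bullet> (\<rho> g *\<^sub>v v) = c * corner i k (($$) g)"
    using coefficient_is_minor by blast
  have mem: "g \<in> parabolic n \<rho> f \<longleftrightarrow> g \<in> G \<and> (\<exists>a. a \<noteq> 0 \<and> transpose_mat (\<rho> (Inv g)) *\<^sub>v f = a \<cdot>\<^sub>v f)" for g
  proof -
    have "(\<lambda>w. transpose_mat (\<rho> (Inv g)) *\<^sub>v w) ` line f = line f \<longleftrightarrow>
        (\<exists>a. a \<noteq> 0 \<and> transpose_mat (\<rho> (Inv g)) *\<^sub>v f = a \<cdot>\<^sub>v f)" if "g \<in> G"
      using rho_mat[OF SL_inv_closed[OF that]] by (intro line_stable_iff[OF _ f_vec]) simp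
    then show ?thesis unfolding parabolic_def line_stabilizer_def dual_rep_def m_eq by blast
  qed
  show ?thesis
  proof (intro equalityI subsetI)
    fix g assume "g \<in> parabolic n \<rho> f"
    then obtain a where g: "g \<in> G" and a: "a \<noteq> 0" "transpose_mat (\<rho> (Inv g)) *\<^sub>v f = a \<cdot>\<^sub>v f"
      using mem by blast
    have "corner i k (($$) (g * h)) = (1 / a) * corner i k (($$) h)" if h: "h \<in> G" for h
    proof -
      have gh: "g * h \<in> G" by (rule SL_mult_closed[OF g h])
      have "f \<bullet> (\<rho> h *\<^sub>v v) = f \<bullet> (\<rho> (Inv g) *\<^sub>v (\<rho> (g * h) *\<^sub>v v))"
        using rho_act[OF g h v(1)] rho_inv_act(1)[OF g rho_vec[OF h v(1)]] by simp
      also have "\<dots> = a * (f \<bullet> (\<rho> (g * h) *\<^sub>v v))"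
        using transpose_rho[OF SL_inv_closed[OF g] f_vec(1) rho_vec[OF gh v(1)]] a(2) f_vec(1) rho_vec[OF gh v(1)] by simp
      finally show ?thesis using c(1) a(1) by (simp add: c(2)[OF h] c(2)[OF gh])
    qed
    then show "g \<in> block_parabolic m k"
      unfolding block_parabolic_iff[OF ik m_pos] using g a(1) by (intro conjI exI[of _ "1 / a"]) auto
  next
    fix g assume "g \<in> block_parabolic m k"
    then obtain D where g: "g \<in> G" and "D \<noteq> 0"
      and D: "\<And>h. h \<in> G \<Longrightarrow> corner i k (($$) (g * h)) = D * corner i k (($$) h)"
      unfolding block_parabolic_iff[OF ik m_pos] by blast
    define y where "y = transpose_mat (\<rho> (Inv g)) *\<^sub>v f - (1 / D) \<cdot>\<^sub>v f"
    have tm: "transpose_mat (\<rho> (Inv g)) \<in> carrier_mat N N"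
      using rho_mat[OF SL_inv_closed[OF g]] by simp
    have tf: "transpose_mat (\<rho> (Inv g)) *\<^sub>v f \<in> carrier_vec N"
      by (rule mult_mat_vec_carrier[OF tm f_vec(1)])
    then have ym: "y \<in> carrier_vec N" using f_vec by (simp add: y_def)
    have "y \<bullet> (\<rho> h *\<^sub>v v) = 0" if h: "h \<in> G" for h
    proof -
      have gi: "Inv g \<in> G" "Inv g * h \<in> G" using SL_inv_closed[OF g] h by (auto intro: SL_mult_closed)
      have "(transpose_mat (\<rho> (Inv g)) *\<^sub>v f) \<bullet> (\<rho> h *\<^sub>v v) = f \<bullet> (\<rho> (Inv g * h) *\<^sub>v v)"
        using transpose_rho[OF gi(1) f_vec(1) rho_vec[OF h v(1)]] rho_act[OF gi(1) h v(1)] by simp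
      also have "\<dots> = (1 / D) * (f \<bullet> (\<rho> h *\<^sub>v v))"
        using D[OF gi(2)] \<open>D \<noteq> 0\<close> by (simp add: c(2)[OF gi(2)] c(2)[OF h] SL_inv_cancel(2)[OF g h])
      finally show ?thesis
        unfolding y_def using tf f_vec(1) rho_vec[OF h v(1)] by (simp add: minus_scalar_prod_distrib[of _ N])
    qed
    then have y0: "y = 0\<^sub>v N" using separation[OF ym _ v(1,2)] by blast
    have "transpose_mat (\<rho> (Inv g)) *\<^sub>v f = (1 / D) \<cdot>\<^sub>v f"
    proof (rule eq_vecI)
      fix r assume "r < dim_vec ((1 / D) \<cdot>\<^sub>v f)"
      then have r: "r < N" using f_vec by simp
      have "y $ r = (transpose_mat (\<rho> (Inv g)) *\<^sub>v f) $ r - ((1 / D) \<cdot>\<^sub>v f) $ r"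
        unfolding y_def by (rule index_minus_vec) (use r f_vec in simp)
      then show "(transpose_mat (\<rho> (Inv g)) *\<^sub>v f) $ r = ((1 / D) \<cdot>\<^sub>v f) $ r"
        using y0 r by simp
    qed (use carrier_vecD[OF tf] carrier_vecD[OF f_vec(1)] in \<open>simp only: index_smult_vec\<close>)
    then show "g \<in> parabolic n \<rho> f" using mem g \<open>D \<noteq> 0\<close> by (metis divide_eq_0_iff one_neq_zero)
  qed
qed

lemma scalar_prod_sum: "y \<in> carrier_vec N \<Longrightarrow> u \<in> carrier_vec N \<Longrightarrow> y \<bullet> u = (\<Sum>r<N. y $ r * u $ r)"
  by (simp add: scalar_prod_def atLeast0LessThan)

text \<open>A basis is given by the translates of \<open>v\<close> under one permutation matrix for each set of \<open>i\<close> columns.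
  They are independent because the corresponding minors are, and they span because every \<open>\<rho>(h) v\<close> is a
  combination of them. Both bounds are drawn from the solvability of homogeneous linear systems with more
  unknowns than equations.\<close>

lemma dimension: "N = m choose i"
proof -
  obtain c where c: "c \<noteq> 0" "\<And>g. g \<in> G \<Longrightarrow> f \<bullet> (\<rho> g *\<^sub>v v) = c * corner i k (($$) g)"
    using coefficient_is_minor by blast
  obtain b where b: "b \<noteq> 0" "b \<cdot>\<^sub>m antidiag m \<in> G"
    by (rule scale_to_SL[OF antidiag_mat det_antidiag m_pos])
  define w where "w = b \<cdot>\<^sub>m antidiag m"
  have w: "w \<in> G" and cw: "corner i k (($$) w) \<noteq> 0"
    using b corner_antidiag[OF ik b(1)] by (auto simp: w_def)
  define S where "S = {J. J \<subseteq> {..<m} \<and> card J = i}"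
  have S: "finite S" "card S = m choose i" by (auto simp: S_def n_subsets)
  have "\<forall>J\<in>S. \<exists>ea. bij_betw (fst ea) {..<m} {..<m} \<and> fst ea ` {..<i} = J \<and> snd ea \<noteq> (0 :: complex) \<and>
      snd ea \<cdot>\<^sub>m perm_mat m (fst ea) \<in> G"
  proof
    fix J assume "J \<in> S"
    then obtain e where e: "bij_betw e {..<m} {..<m}" "e ` {..<i} = J"
      using adapted_enumeration[of J m i] by (auto simp: S_def)
    obtain a where "a \<noteq> 0" "a \<cdot>\<^sub>m perm_mat m e \<in> G"
      by (rule scale_to_SL[OF perm_mat_carrier det_perm_mat[OF e(1)] m_pos])
    then show "\<exists>ea. bij_betw (fst ea) {..<m} {..<m} \<and> fst ea ` {..<i} = J \<and> snd ea \<noteq> (0 :: complex) \<and>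
      snd ea \<cdot>\<^sub>m perm_mat m (fst ea) \<in> G" using e by (intro exI[of _ "(e, a)"]) simp
  qed
  from bchoice[OF this] obtain ea where
    ea: "\<forall>J\<in>S. bij_betw (fst (ea J)) {..<m} {..<m} \<and> fst (ea J) ` {..<i} = J \<and> snd (ea J) \<noteq> (0 :: complex) \<and>
      snd (ea J) \<cdot>\<^sub>m perm_mat m (fst (ea J)) \<in> G" by (elim exE)
  define e a where "e J = fst (ea J)" and "a J = snd (ea J)" for J
  have e: "bij_betw (e J) {..<m} {..<m}" "e J ` {..<i} = J" "a J \<noteq> 0" "a J \<cdot>\<^sub>m perm_mat m (e J) \<in> G"
    if "J \<in> S" for J using bspec[OF ea that] by (auto simp: e_def a_def)
  define w' where "w' J = a J \<cdot>\<^sub>m perm_mat m (e J)" for J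
  define v' where "v' J = \<rho> (w' J) *\<^sub>v v" for J
  have w': "w' J \<in> G" if "J \<in> S" for J using e(4)[OF that] by (simp add: w'_def)
  have v': "v' J \<in> carrier_vec N" if "J \<in> S" for J using rho_vec[OF w'[OF that] v(1)] by (simp add: v'_def)
  have fv': "f \<bullet> (\<rho> g *\<^sub>v v' J) = c * corner i k (($$) (g * w' J))" if "g \<in> G" "J \<in> S" for g J
    using that w' c(2)[OF SL_mult_closed[OF that(1) w'[OF that(2)]]] by (simp add: v'_def rho_act v(1))
  have "\<not> N < card S"
  proof
    assume "N < card S"
    then have "card {..<N} < card S" by simp
    from linear_dependence[OF finite_lessThan S(1) this, of "\<lambda>J r. v' J $ r"] obtain x where
      x: "\<exists>J\<in>S. x J \<noteq> 0" "\<forall>r\<in>{..<N}. (\<Sum>J\<in>S. x J * v' J $ r) = 0" by blast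
    then obtain J0 where J0: "J0 \<in> S" "x J0 \<noteq> 0" by blast
    define g where "g = w * Inv (w' J0)"
    have g: "g \<in> G" using w w'[OF J0(1)] by (auto simp: g_def intro: SL_mult_closed SL_inv_closed)
    have gw: "g * w' J0 = w"
      using SL_assoc[OF w SL_inv_closed[OF w'[OF J0(1)]] w'[OF J0(1)]] SL_l_inv[OF w'[OF J0(1)]] SL_mat[OF w]
      by (simp add: g_def)
    define y where "y = transpose_mat (\<rho> g) *\<^sub>v f"
    have y: "y \<in> carrier_vec N" using rho_mat[OF g] f_vec by (auto simp: y_def)
    have yv: "y \<bullet> v' J = c * corner i k (($$) (g * w' J))" if "J \<in> S" for J
      using transpose_rho[OF g f_vec(1) v'[OF that]] fv'[OF g that] by (simp add: y_def)
    have other: "y \<bullet> v' J = 0" if "J \<in> S" "J \<noteq> J0" for J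
    proof -
      have "corner i k (($$) (g * (a J \<cdot>\<^sub>m perm_mat m (e J)))) = 0"
        by (rule corner_perm_mat_other[OF ik SL_mat[OF w] w_def e(1)[OF J0(1)] e(1)[OF that(1)] _ SL_mat[OF g] _ e(3)[OF J0(1)]])
          (use that e(2) J0 gw in \<open>auto simp: w'_def\<close>)
      then show ?thesis using yv[OF that(1)] by (simp add: w'_def)
    qed
    have "0 = (\<Sum>r<N. y $ r * (\<Sum>J\<in>S. x J * v' J $ r))" using x(2) by simp
    also have "\<dots> = (\<Sum>J\<in>S. x J * (\<Sum>r<N. y $ r * v' J $ r))"
      unfolding sum_distrib_left by (subst sum.swap) (simp add: mult_ac)
    also have "\<dots> = (\<Sum>J\<in>S. x J * (y \<bullet> v' J))" using v' by (simp add: scalar_prod_sum[OF y])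
    also have "\<dots> = (\<Sum>J\<in>S. if J = J0 then x J0 * (y \<bullet> v' J0) else 0)"
      by (rule sum.cong) (use other in auto)
    also have "\<dots> = x J0 * (c * corner i k (($$) w))" using S J0 yv[OF J0(1)] gw by simp
    finally show False using J0 c cw by simp
  qed
  moreover have "\<not> card S < N"
  proof
    assume "card S < N"
    then have "card S < card {..<N}" by simp
    from linear_dependence[OF S(1) finite_lessThan this, of "\<lambda>r J. v' J $ r"] obtain x where
      x: "\<exists>r\<in>{..<N}. x r \<noteq> 0" "\<forall>J\<in>S. (\<Sum>r\<in>{..<N}. x r * v' J $ r) = 0" by blast
    define y where "y = vec N x"
    have y: "y \<in> carrier_vec N" by (simp add: y_def)
    have "y \<noteq> 0\<^sub>v N"
    proof
      assume y0: "y = 0\<^sub>v N"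
      have "x r = 0" if r: "r < N" for r
      proof -
        have "x r = y $ r" using r by (simp add: y_def)
        then show ?thesis using r by (simp add: y0)
      qed
      then show False using x(1) by auto
    qed
    moreover have yv: "y \<bullet> v' J = 0" if "J \<in> S" for J
      using bspec[OF x(2) that] v'[OF that] by (simp add: scalar_prod_sum[OF y]) (simp add: y_def)
    have "y \<bullet> (\<rho> h *\<^sub>v v) = 0" if h: "h \<in> G" for h
    proof -
      have "\<exists>(T :: (nat \<Rightarrow> nat) set) \<beta> K. (\<forall>\<tau>\<in>T. K \<tau> \<subseteq> {..<m} \<and> card (K \<tau>) = i) \<and>
         (\<forall>g\<in>carrier_mat m m. corner i k (($$) (g * h)) =
            (\<Sum>\<tau>\<in>T. \<beta> \<tau> * corner i k (($$) (g * (a (K \<tau>) \<cdot>\<^sub>m perm_mat m (e (K \<tau>)))))))"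
        by (rule corner_mult_combination[OF ik SL_mat[OF h]]) (use e in \<open>auto simp: S_def\<close>)
      then obtain T :: "(nat \<Rightarrow> nat) set" and \<beta> K where
        T: "(\<forall>\<tau>\<in>T. K \<tau> \<subseteq> {..<m} \<and> card (K \<tau>) = i) \<and>
         (\<forall>g\<in>carrier_mat m m. corner i k (($$) (g * h)) =
            (\<Sum>\<tau>\<in>T. \<beta> \<tau> * corner i k (($$) (g * (a (K \<tau>) \<cdot>\<^sub>m perm_mat m (e (K \<tau>)))))))"
        by (elim exE)
      have K: "K \<tau> \<in> S" if "\<tau> \<in> T" for \<tau> using T that by (simp add: S_def)
      \<comment> \<open>all coefficients of \<open>u\<close> against translates of \<open>f\<close> vanish, so \<open>u = 0\<close>\<close>
      define u where "u = vec N (\<lambda>r. (\<rho> h *\<^sub>v v) $ r - (\<Sum>\<tau>\<in>T. \<beta> \<tau> * v' (K \<tau>) $ r))"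
      have um: "u \<in> carrier_vec N" by (simp add: u_def)
      have pu: "z \<bullet> u = z \<bullet> (\<rho> h *\<^sub>v v) - (\<Sum>\<tau>\<in>T. \<beta> \<tau> * (z \<bullet> v' (K \<tau>)))" if z: "z \<in> carrier_vec N" for z
      proof -
        have "z \<bullet> u = (\<Sum>r<N. z $ r * ((\<rho> h *\<^sub>v v) $ r - (\<Sum>\<tau>\<in>T. \<beta> \<tau> * v' (K \<tau>) $ r)))"
          unfolding scalar_prod_sum[OF z um] by (simp add: u_def)
        also have "\<dots> = (\<Sum>r<N. z $ r * (\<rho> h *\<^sub>v v) $ r) - (\<Sum>r<N. \<Sum>\<tau>\<in>T. z $ r * (\<beta> \<tau> * v' (K \<tau>) $ r))"
          by (simp add: right_diff_distrib sum_subtractf sum_distrib_left)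
        also have "(\<Sum>r<N. \<Sum>\<tau>\<in>T. z $ r * (\<beta> \<tau> * v' (K \<tau>) $ r)) = (\<Sum>\<tau>\<in>T. \<beta> \<tau> * (\<Sum>r<N. z $ r * v' (K \<tau>) $ r))"
          unfolding sum_distrib_left by (subst sum.swap) (simp add: mult_ac)
        also have "\<dots> = (\<Sum>\<tau>\<in>T. \<beta> \<tau> * (z \<bullet> v' (K \<tau>)))"
          using K v' by (simp add: scalar_prod_sum[OF z])
        finally show ?thesis by (simp add: scalar_prod_sum[OF z rho_vec[OF h v(1)]])
      qed
      have "f \<bullet> (\<rho> g *\<^sub>v u) = 0" if g: "g \<in> G" for g
      proof -
        define z where "z = transpose_mat (\<rho> g) *\<^sub>v f"
        have z: "z \<in> carrier_vec N" using rho_mat[OF g] f_vec by (auto simp: z_def)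
        have zz: "z \<bullet> x = f \<bullet> (\<rho> g *\<^sub>v x)" if "x \<in> carrier_vec N" for x
          unfolding z_def by (rule transpose_rho[OF g f_vec(1) that])
        have "(\<Sum>\<tau>\<in>T. \<beta> \<tau> * (z \<bullet> v' (K \<tau>))) = (\<Sum>\<tau>\<in>T. \<beta> \<tau> * (c * corner i k (($$) (g * w' (K \<tau>)))))"
          by (rule sum.cong) (use K in \<open>auto simp: zz[OF v'[OF K]] fv'[OF g K]\<close>)
        also have "\<dots> = c * corner i k (($$) (g * h))"
          using T SL_mat[OF g] by (simp add: sum_distrib_left w'_def mult_ac)
        also have "\<dots> = z \<bullet> (\<rho> h *\<^sub>v v)"
          using c(2)[OF SL_mult_closed[OF g h]] by (simp add: zz[OF rho_vec[OF h v(1)]] rho_act[OF g h v(1)])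
        finally have "z \<bullet> u = 0" using pu[OF z] by simp
        then show ?thesis using zz[OF um] by simp
      qed
      then have "u = 0\<^sub>v N" using separation[OF f_vec um] by blast
      then have "y \<bullet> u = 0" using y by simp
      then show ?thesis using pu[OF y] yv K by simp
    qed
    ultimately show False using separation[OF y _ v(1,2)] by blast
  qed
  ultimately show ?thesis using S(2) by simp
qed

end

section \<open>The dimension of the Grassmannian\<close>

locale grassmannian =
  fixes n m i k :: nat
  assumes m_eq: "n + 1 = m" and ik: "i + k = m"
begin

abbreviation "G \<equiv> carrier (SL m)"
abbreviation "P \<equiv> block_parabolic m k"
abbreviation "V \<equiv> {..<i} \<times> {..<k}"
abbreviation "coset g \<equiv> g <#\<^bsub>SL m\<^esub> P"
abbreviation "X \<equiv> flag_space n P"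

lemma m_pos: "0 < m"
  using m_eq by simp

lemma openin_basic:
  assumes "polyfun (entries m) F"
  shows "openin (zariski_SL n) {g \<in> G. F (($$) g) \<noteq> 0}"
proof -
  obtain p where p: "p \<in> polys_in (entries m)" "\<forall>x. eval_poly p x = F x"
    using polyfun_imp_eval_poly[OF assms] by blast
  have "openin (zariski_SL n) {g \<in> G. eval_poly p (($$) g) \<noteq> 0}"
    unfolding zariski_SL_def m_eq using p(1) by (intro topology_generated_by_Basis) blast
  then show ?thesis using p(2) by simp
qed

text \<open>The given subbasis of the Zariski topology is a basis, because nonvanishing loci are closed under
  intersection.\<close>

definition basic_nbhd :: "complex mat set \<Rightarrow> complex mat \<Rightarrow> bool" where
  "basic_nbhd U g \<longleftrightarrow> (\<exists>F. polyfun (entries m) F \<and> F (($$) g) \<noteq> 0 \<and> {h \<in> G. F (($$) h) \<noteq> 0} \<subseteq> U)"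

lemma basic_nbhdE:
  assumes "basic_nbhd U g"
  obtains F where "polyfun (entries m) F" "F (($$) g) \<noteq> 0" "{h \<in> G. F (($$) h) \<noteq> 0} \<subseteq> U"
  using assms unfolding basic_nbhd_def by (elim exE conjE) (rule that)

lemma basic_nbhd_mono: "U \<subseteq> U' \<Longrightarrow> basic_nbhd U g \<Longrightarrow> basic_nbhd U' g"
  by (elim basic_nbhdE) (unfold basic_nbhd_def, intro exI conjI, assumption+, rule order_trans)

lemma basic_nbhd_Int:
  assumes "basic_nbhd U g" "basic_nbhd U' g" shows "basic_nbhd (U \<inter> U') g"
proof -
  obtain F1 where F1: "polyfun (entries m) F1" "F1 (($$) g) \<noteq> 0" "{h \<in> G. F1 (($$) h) \<noteq> 0} \<subseteq> U"
    using assms(1) by (rule basic_nbhdE)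
  obtain F2 where F2: "polyfun (entries m) F2" "F2 (($$) g) \<noteq> 0" "{h \<in> G. F2 (($$) h) \<noteq> 0} \<subseteq> U'"
    using assms(2) by (rule basic_nbhdE)
  show ?thesis unfolding basic_nbhd_def
    using F1 F2 by (intro exI[of _ "\<lambda>x. F1 x * F2 x"]) (auto intro: polyfun.mult)
qed

lemma openin_zariski_nbhd:
  assumes "openin (zariski_SL n) U"
  shows "U \<subseteq> G \<and> (\<forall>g\<in>U. basic_nbhd U g)"
proof -
  have "generate_topology_on {{g \<in> G. eval_poly p (($$) g) \<noteq> 0} | p. p \<in> polys_in (entries m)} U"
    using assms unfolding zariski_SL_def m_eq openin_topology_generated_by_iff .
  then show ?thesis
  proof (induction rule: generate_topology_on.induct)
    case (Int a b)
    then show ?case using basic_nbhd_Int by blast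
  next
    case (UN K)
    show ?case
    proof (intro conjI ballI)
      show "\<Union> K \<subseteq> G" using UN.IH by blast
      fix g assume "g \<in> \<Union> K"
      then obtain U where U: "U \<in> K" "g \<in> U" by blast
      then have "basic_nbhd U g" using UN.IH by blast
      then show "basic_nbhd (\<Union> K) g" by (rule basic_nbhd_mono[OF Union_upper[OF U(1)]])
    qed
  next
    case (Basis s)
    then obtain p where p: "p \<in> polys_in (entries m)" "s = {g \<in> G. eval_poly p (($$) g) \<noteq> 0}" by blast
    have "basic_nbhd s g" if "g \<in> s" for g
      unfolding basic_nbhd_def using polyfun_eval_poly[OF p(1)] p(2) that by (intro exI[of _ "eval_poly p"]) auto
    then show ?case using p(2) by blast
  qed simp
qed

lemma topspace_zariski: "topspace (zariski_SL n) = G"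
proof
  have "openin (zariski_SL n) (topspace (zariski_SL n))" by simp
  then show "topspace (zariski_SL n) \<subseteq> G" using openin_zariski_nbhd by blast
  have "openin (zariski_SL n) {g \<in> G. (1 :: complex) \<noteq> 0}" by (rule openin_basic[OF polyfun.const])
  then show "G \<subseteq> topspace (zariski_SL n)" using openin_subset by force
qed

lemma openin_X: "openin X U \<longleftrightarrow> U \<subseteq> coset ` G \<and> openin (zariski_SL n) {g \<in> G. coset g \<in> U}"
  unfolding flag_space_def openin_quotient_topology m_eq topspace_zariski ..

lemma topspace_X: "topspace X = coset ` G"
proof
  show "topspace X \<subseteq> coset ` G" using openin_X[of "topspace X"] by simp
  have "{g \<in> G. coset g \<in> coset ` G} = G" by blast
  then have "openin X (coset ` G)"
    unfolding openin_X using openin_topspace[of "zariski_SL n"] by (simp add: topspace_zariski)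
  then show "coset ` G \<subseteq> topspace X" by (rule openin_subset)
qed

lemma closed_separated:
  assumes "closedin X A" "g \<in> G" "coset g \<notin> A"
  obtains F where "polyfun (entries m) F" "F (($$) g) \<noteq> 0"
    "\<forall>h\<in>G. coset h \<in> A \<longrightarrow> F (($$) h) = 0"
proof -
  have "openin X (coset ` G - A)" using assms(1) by (simp add: closedin_def topspace_X)
  then have "openin (zariski_SL n) {h \<in> G. coset h \<in> coset ` G - A}" by (simp add: openin_X)
  with assms(2,3) have "basic_nbhd {h \<in> G. coset h \<in> coset ` G - A} g"
    using openin_zariski_nbhd by blast
  then obtain F where
    "polyfun (entries m) F" "F (($$) g) \<noteq> 0" "{h \<in> G. F (($$) h) \<noteq> 0} \<subseteq> {h \<in> G. coset h \<in> coset ` G - A}"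
    by (rule basic_nbhdE)
  then show ?thesis by (intro that[of F]) blast+
qed

lemma coset_eq_iff:
  assumes "g \<in> G" "h \<in> G"
  shows "coset g = coset h \<longleftrightarrow> (\<exists>p\<in>P. g = h * p)"
proof
  note sub = block_parabolic_subgroup[OF ik m_pos]
  have "1\<^sub>m m \<in> P" using subgroup.one_closed[OF sub] by (simp add: one_SL)
  then have "g \<in> coset g" using SL_mat[OF assms(1)] by (auto simp: l_coset_def mult_SL intro!: bexI[of _ "1\<^sub>m m"])
  moreover assume "coset g = coset h"
  ultimately show "\<exists>p\<in>P. g = h * p" by (auto simp: l_coset_def mult_SL)
next
  assume "\<exists>p\<in>P. g = h * p"
  then have "g \<in> coset h" by (auto simp: l_coset_def mult_SL)
  from group.l_repr_independence[OF group_SL this assms(2) block_parabolic_subgroup[OF ik m_pos]]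
  show "coset g = coset h" by simp
qed

text \<open>The block unipotent matrices with lower left block \<open>x\<close>; their cosets fill the open cell of the Grassmannian.\<close>

definition cell :: "(nat \<times> nat \<Rightarrow> complex) \<Rightarrow> complex mat" where
  "cell x = mat m m (\<lambda>(r, c). if r = c then 1 else if k \<le> r \<and> c < k then x (r - k, c) else 0)"

lemma cell_mat[simp]: "cell x \<in> carrier_mat m m"
  by (simp add: cell_def)

lemma cell_SL: "cell x \<in> G"
proof -
  have "upper_triangular (transpose_mat (cell x))" by (rule upper_triangularI) (auto simp: cell_def)
  then have "det (transpose_mat (cell x)) = 1"
    by (subst det_triangular[of _ m]) (auto simp: cell_def)
  then show ?thesis using det_transpose[OF cell_mat, of x] by (simp add: carrier_SL)
qed

lemma cell_mult_top:
  assumes "p \<in> carrier_mat m m" "r < k" "c < m"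
  shows "(cell x * p) $$ (r, c) = p $$ (r, c)"
proof -
  have "r < m" using assms(2) ik by simp
  then have "(cell x * p) $$ (r, c) = (\<Sum>j<m. cell x $$ (r, j) * p $$ (j, c))"
    by (rule mult_entry[OF cell_mat assms(1) _ assms(3)])
  also have "\<dots> = (\<Sum>j<m. if j = r then p $$ (j, c) else 0)"
    by (rule sum.cong) (use assms ik in \<open>auto simp: cell_def\<close>)
  finally show ?thesis using assms ik by simp
qed

lemma cell_mult_bottom:
  assumes "p \<in> carrier_mat m m" "r < i" "c < m"
  shows "(cell x * p) $$ (k + r, c) = (\<Sum>j<k. x (r, j) * p $$ (j, c)) + p $$ (k + r, c)"
proof -
  have "(cell x * p) $$ (k + r, c) = (\<Sum>j<m. cell x $$ (k + r, j) * p $$ (j, c))"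
    by (rule mult_entry[OF cell_mat assms(1)]) (use assms ik in auto)
  also have "\<dots> = (\<Sum>j<k. cell x $$ (k + r, j) * p $$ (j, c)) + (\<Sum>j<i. cell x $$ (k + r, k + j) * p $$ (k + j, c))"
    by (rule sum_split_block[OF ik])
  also have "(\<Sum>j<k. cell x $$ (k + r, j) * p $$ (j, c)) = (\<Sum>j<k. x (r, j) * p $$ (j, c))"
    by (rule sum.cong) (use assms ik in \<open>auto simp: cell_def\<close>)
  also have "(\<Sum>j<i. cell x $$ (k + r, k + j) * p $$ (k + j, c)) = (\<Sum>j<i. if j = r then p $$ (k + j, c) else 0)"
    by (rule sum.cong) (use assms ik in \<open>auto simp: cell_def\<close>)
  finally show ?thesis using assms by simp
qed

text \<open>Modulo \<open>P\<close>, a matrix with upper left block \<open>A\<close> and lower left block \<open>C\<close> lies in the cell when \<open>A\<close> is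
  invertible, and then its coordinate is \<open>C A\<^sup>-\<^sup>1\<close>, which is \<open>numer\<close> divided by \<open>denom = det A\<close>.\<close>

definition denom :: "(nat \<times> nat \<Rightarrow> complex) \<Rightarrow> complex" where
  "denom y = det (mat k k y)"

definition numer :: "(nat \<times> nat \<Rightarrow> complex) \<Rightarrow> nat \<times> nat \<Rightarrow> complex" where
  "numer y = (\<lambda>(r, c). \<Sum>j<k. y (k + r, j) * adj_mat (mat k k y) $$ (j, c))"

lemma polyfun_denom: "polyfun (entries m) denom"
  unfolding denom_def by (rule polyfun_det[where Y = "\<lambda>y. y"]) (use ik in \<open>auto intro: polyfun.var\<close>)

lemma polyfun_numer: "v \<in> V \<Longrightarrow> polyfun (entries m) (\<lambda>y. numer y v)"
proof -
  assume "v \<in> V"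
  then obtain r c where v: "v = (r, c)" "r < i" "c < k" by auto
  have adj: "polyfun (entries m) (\<lambda>y. adj_mat (mat k k y) $$ (j, c))" if jk: "j < k" for j
  proof -
    obtain F where F: "polyfun (entries k) F" "\<forall>g\<in>carrier_mat k k. adj_mat g $$ (j, c) = F (($$) g)"
      using polyfun_adj_mat_entry[OF jk v(3)] by (elim bexE exE conjE) (rule that)
    have "adj_mat (mat k k y) $$ (j, c) = F y" for y
    proof -
      have "F (($$) (mat k k y)) = F y" by (rule polyfun_cong[OF F(1)]) auto
      then show ?thesis using F(2) by simp
    qed
    moreover have "polyfun (entries m) F"
      by (rule polyfun_compose[OF F(1), of "entries m" "\<lambda>x. x"]) (use ik in \<open>auto intro: polyfun.var\<close>)
    ultimately show ?thesis by simp
  qed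
  have var: "polyfun (entries m) (\<lambda>y. y (k + r, j))" if "j < k" for j
    using that v ik by (intro polyfun.var) auto
  show ?thesis
    unfolding numer_def v using adj var by (auto intro!: polyfun_sum polyfun.mult)
qed

text \<open>The lower left block of \<open>p = (cell x)\<^sup>-\<^sup>1 h\<close> is \<open>B - Z A\<close>, in terms of the blocks \<open>A\<close>, \<open>B\<close> of the
  first \<open>k\<close> columns of \<open>h\<close> and the matrix \<open>Z\<close> of \<open>x\<close>. If it vanishes, then \<open>A\<close> is invertible, since a kernel
  vector of \<open>A\<close>, extended by zeros, would be a kernel vector of \<open>h\<close>.\<close>

lemma cell_coordinates:
  assumes h: "h \<in> G"
  shows "(\<exists>p\<in>P. h = cell x * p) \<longleftrightarrow>
    denom (($$) h) \<noteq> 0 \<and> (\<forall>v\<in>V. x v = numer (($$) h) v / denom (($$) h))"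
proof -
  define A where "A = mat k k (($$) h)"
  define B where "B = mat i k (\<lambda>(r, c). h $$ (k + r, c))"
  define Z where "Z = mat i k x"
  have A: "A \<in> carrier_mat k k" and B: "B \<in> carrier_mat i k" and Z: "Z \<in> carrier_mat i k"
    by (auto simp: A_def B_def Z_def)
  note adj = adj_mat[OF A]
  have dA: "denom (($$) h) = det A" by (simp add: denom_def A_def)
  have num: "numer (($$) h) (r, c) = (B * adj_mat A) $$ (r, c)" if "r < i" "c < k" for r c
    by (subst mult_entry[OF B adj(1) that]) (use that in \<open>simp add: numer_def B_def A_def[symmetric]\<close>)
  define p where "p = inv\<^bsub>SL m\<^esub> (cell x) * h"
  have pG: "p \<in> G" unfolding p_def by (intro SL_mult_closed SL_inv_closed cell_SL h)
  have hp: "h = cell x * p" unfolding p_def by (rule SL_inv_cancel(2)[OF cell_SL h, symmetric])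
  have pm: "p \<in> carrier_mat m m" by (rule SL_mat[OF pG])
  have "(\<exists>p\<in>P. h = cell x * p) \<longleftrightarrow> p \<in> P"
  proof
    assume "\<exists>p\<in>P. h = cell x * p"
    then obtain p' where p': "p' \<in> P" "h = cell x * p'" by blast
    then have "p' \<in> G" by (simp add: block_parabolic_def)
    then have "p = p'" unfolding p_def p'(2) by (rule SL_inv_cancel(1)[OF cell_SL])
    then show "p \<in> P" using p' by simp
  qed (use hp in blast)
  also have "\<dots> \<longleftrightarrow> Z * A = B"
  proof -
    have ent: "p $$ (k + r, c) = B $$ (r, c) - (Z * A) $$ (r, c)" if "r < i" "c < k" for r c
    proof -
      have "(Z * A) $$ (r, c) = (\<Sum>j<k. x (r, j) * p $$ (j, c))"
      proof (subst mult_entry[OF Z A that], rule sum.cong[OF refl])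
        fix j assume "j \<in> {..<k}"
        then have "h $$ (j, c) = p $$ (j, c)" unfolding hp using that ik by (intro cell_mult_top[OF pm]) auto
        then show "Z $$ (r, j) * A $$ (j, c) = x (r, j) * p $$ (j, c)"
          using \<open>j \<in> {..<k}\<close> that by (simp add: Z_def A_def)
      qed
      moreover have "B $$ (r, c) = (\<Sum>j<k. x (r, j) * p $$ (j, c)) + p $$ (k + r, c)"
        using cell_mult_bottom[OF pm, of r c x] that ik hp by (simp add: B_def)
      ultimately show ?thesis by simp
    qed
    show ?thesis
    proof
      assume "p \<in> P"
      show "Z * A = B"
      proof (rule eq_matI)
        fix r c assume "r < dim_row B" "c < dim_col B"
        then have rc: "r < i" "c < k" by (auto simp: B_def)
        have "p $$ (k + r, c) = 0" using \<open>p \<in> P\<close> rc ik by (simp add: block_parabolic_def)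
        then show "(Z * A) $$ (r, c) = B $$ (r, c)" using ent[OF rc] by simp
      qed (use A B Z in auto)
    next
      assume ZA: "Z * A = B"
      have "p $$ (r, c) = 0" if "k \<le> r" "r < m" "c < k" for r c
        using ent[of "r - k" c] that ik by (simp add: ZA)
      then show "p \<in> P" using pG by (simp add: block_parabolic_def)
    qed
  qed
  also have "\<dots> \<longleftrightarrow> det A \<noteq> 0 \<and> det A \<cdot>\<^sub>m Z = B * adj_mat A"
  proof
    assume ZA: "Z * A = B"
    have "B * adj_mat A = Z * (A * adj_mat A)"
      unfolding ZA[symmetric] by (rule assoc_mult_mat[OF Z A adj(1)])
    also have "\<dots> = det A \<cdot>\<^sub>m Z"
      unfolding adj(2) using mult_smult_distrib[OF Z one_carrier_mat, of "det A"] Z by simp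
    finally have "det A \<cdot>\<^sub>m Z = B * adj_mat A" ..
    moreover have "det A \<noteq> 0"
    proof
      assume "det A = 0"
      then obtain y where y: "y \<in> carrier_vec k" "y \<noteq> 0\<^sub>v k" "A *\<^sub>v y = 0\<^sub>v k"
        using det_0_iff_vec_prod_zero[OF A] by blast
      have By: "B *\<^sub>v y = 0\<^sub>v i"
      proof -
        have "B *\<^sub>v y = Z *\<^sub>v (A *\<^sub>v y)" unfolding ZA[symmetric] by (rule assoc_mult_mat_vec[OF Z A y(1)])
        then show ?thesis using y(3) Z by (auto intro!: eq_vecI)
      qed
      define y' where "y' = vec m (\<lambda>r. if r < k then y $ r else 0)"
      have y': "y' \<in> carrier_vec m" by (simp add: y'_def)
      have hy: "(h *\<^sub>v y') $ r = (\<Sum>j<k. h $$ (r, j) * y $ j)" if "r < m" for r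
      proof -
        have "(h *\<^sub>v y') $ r = (\<Sum>j<m. h $$ (r, j) * y' $ j)"
          using SL_mat[OF h] that by (simp add: scalar_prod_def y'_def atLeast0LessThan)
        also have "\<dots> = (\<Sum>j<k. h $$ (r, j) * y' $ j) + (\<Sum>j<i. h $$ (r, k + j) * y' $ (k + j))"
          by (rule sum_split_block[OF ik])
        also have "(\<Sum>j<i. h $$ (r, k + j) * y' $ (k + j)) = 0" using ik by (simp add: y'_def)
        finally show ?thesis using ik by (simp add: y'_def)
      qed
      have "h *\<^sub>v y' = 0\<^sub>v m"
      proof (rule eq_vecI)
        fix r assume "r < dim_vec (0\<^sub>v m :: complex vec)"
        then have r: "r < m" by simp
        have "(\<Sum>j<k. h $$ (r, j) * y $ j) = 0"
        proof (cases "r < k")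
          case True
          then have "(A *\<^sub>v y) $ r = (\<Sum>j<k. h $$ (r, j) * y $ j)"
            using y(1) by (simp add: A_def scalar_prod_def atLeast0LessThan)
          then show ?thesis using y(3) True by simp
        next
          case False
          then have rk: "r - k < i" "k + (r - k) = r" using r ik by auto
          then have "(B *\<^sub>v y) $ (r - k) = (\<Sum>j<k. h $$ (r, j) * y $ j)"
            using y(1) by (simp add: B_def scalar_prod_def atLeast0LessThan)
          then show ?thesis using By rk by simp
        qed
        then show "(h *\<^sub>v y') $ r = 0\<^sub>v m $ r" using hy[OF r] r by simp
      qed (use SL_mat[OF h] in simp)
      moreover have "y' \<noteq> 0\<^sub>v m"
      proof
        assume "y' = 0\<^sub>v m"
        then have "y' $ r = 0" if "r < k" for r using that ik by simp
        then have "y $ r = 0" if "r < k" for r using that ik by (simp add: y'_def)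
        then show False using y(1,2) by (auto intro!: eq_vecI)
      qed
      ultimately have "det h = 0" using det_0_iff_vec_prod_zero[OF SL_mat[OF h]] y' by blast
      then show False using h by (simp add: carrier_SL)
    qed
    ultimately show "det A \<noteq> 0 \<and> det A \<cdot>\<^sub>m Z = B * adj_mat A" by blast
  next
    assume *: "det A \<noteq> 0 \<and> det A \<cdot>\<^sub>m Z = B * adj_mat A"
    have "det A \<cdot>\<^sub>m (Z * A) = (det A \<cdot>\<^sub>m Z) * A" by (rule mult_smult_assoc_mat[OF Z A, symmetric])
    also have "\<dots> = B * (adj_mat A * A)" using * assoc_mult_mat[OF B adj(1) A] by simp
    also have "\<dots> = det A \<cdot>\<^sub>m B"
      unfolding adj(3) using mult_smult_distrib[OF B one_carrier_mat, of "det A"] B by simp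
    finally have eq: "det A \<cdot>\<^sub>m (Z * A) = det A \<cdot>\<^sub>m B" .
    have ZAm: "Z * A \<in> carrier_mat i k" by (rule mult_carrier_mat[OF Z A])
    show "Z * A = B"
    proof (rule eq_matI)
      fix r c assume "r < dim_row B" "c < dim_col B"
      then show "(Z * A) $$ (r, c) = B $$ (r, c)"
        using arg_cong[OF eq, of "\<lambda>M. M $$ (r, c)"] * carrier_matD[OF ZAm] carrier_matD[OF B]
        by (simp del: index_mult_mat)
    qed (use A B Z in auto)
  qed
  also have "\<dots> \<longleftrightarrow> det A \<noteq> 0 \<and> (\<forall>v\<in>V. x v = numer (($$) h) v / det A)"
  proof (intro conj_cong refl iffI ballI)
    fix v assume nz: "det A \<noteq> 0" and eq: "det A \<cdot>\<^sub>m Z = B * adj_mat A" and "v \<in> V"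
    then obtain r c where v: "v = (r, c)" "r < i" "c < k" by auto
    then show "x v = numer (($$) h) v / det A"
      using arg_cong[OF eq, of "\<lambda>M. M $$ (r, c)"] nz num[OF v(2,3)]
      by (simp add: Z_def field_simps del: index_mult_mat(1))
  next
    assume nz: "det A \<noteq> 0" and eq: "\<forall>v\<in>V. x v = numer (($$) h) v / det A"
    have Bm: "B * adj_mat A \<in> carrier_mat i k" by (rule mult_carrier_mat[OF B adj(1)])
    show "det A \<cdot>\<^sub>m Z = B * adj_mat A"
    proof (rule eq_matI)
      fix r c assume "r < dim_row (B * adj_mat A)" "c < dim_col (B * adj_mat A)"
      then have rc: "r < i" "c < k" using carrier_matD[OF Bm] by auto
      then have "x (r, c) = numer (($$) h) (r, c) / det A" using eq by blast
      then show "(det A \<cdot>\<^sub>m Z) $$ (r, c) = (B * adj_mat A) $$ (r, c)"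
        using rc nz num[OF rc] by (simp add: Z_def del: index_mult_mat(1))
    qed (use carrier_matD[OF Bm] in \<open>auto simp: Z_def\<close>)
  qed
  finally show ?thesis by (simp add: dA)
qed

lemma coset_cell_iff:
  assumes w: "w \<in> G" and g: "g \<in> G"
  shows "coset g = coset (w * cell x) \<longleftrightarrow> denom (($$) (inv\<^bsub>SL m\<^esub> w * g)) \<noteq> 0 \<and>
    (\<forall>v\<in>V. x v = numer (($$) (inv\<^bsub>SL m\<^esub> w * g)) v / denom (($$) (inv\<^bsub>SL m\<^esub> w * g)))"
proof -
  have wx: "w * cell x \<in> G" by (rule SL_mult_closed[OF w cell_SL])
  have "coset g = coset (w * cell x) \<longleftrightarrow> (\<exists>p\<in>P. g = w * cell x * p)" by (rule coset_eq_iff[OF g wx])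
  also have "\<dots> \<longleftrightarrow> (\<exists>p\<in>P. inv\<^bsub>SL m\<^esub> w * g = cell x * p)"
  proof (rule bex_cong[OF refl])
    fix p assume "p \<in> P"
    then have p: "p \<in> G" by (simp add: block_parabolic_def)
    have cp: "cell x * p \<in> G" by (rule SL_mult_closed[OF cell_SL p])
    show "g = w * cell x * p \<longleftrightarrow> inv\<^bsub>SL m\<^esub> w * g = cell x * p"
      using SL_assoc[OF w cell_SL p] SL_inv_cancel(1)[OF w cp] SL_inv_cancel(2)[OF w g] by metis
  qed
  also have "\<dots> \<longleftrightarrow> denom (($$) (inv\<^bsub>SL m\<^esub> w * g)) \<noteq> 0 \<and>
    (\<forall>v\<in>V. x v = numer (($$) (inv\<^bsub>SL m\<^esub> w * g)) v / denom (($$) (inv\<^bsub>SL m\<^esub> w * g)))"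
    by (rule cell_coordinates[OF SL_mult_closed[OF SL_inv_closed[OF w] g]])
  finally show ?thesis .
qed

lemma cell_injective:
  assumes "w \<in> G" "coset (w * cell x) = coset (w * cell y)" "v \<in> V"
  shows "x v = y v"
proof -
  let ?h = "($$) (inv\<^bsub>SL m\<^esub> w * (w * cell x))"
  note iff = coset_cell_iff[OF assms(1) SL_mult_closed[OF assms(1) cell_SL]]
  have "\<forall>v\<in>V. x v = numer ?h v / denom ?h" using iff[of x x] by blast
  moreover have "\<forall>v\<in>V. y v = numer ?h v / denom ?h" using iff[of x y] assms(2) by blast
  ultimately show ?thesis using assms(3) by (metis (no_types, lifting))
qed

lemma polyfun_left_mult:
  assumes "polyfun (entries m) F" "a \<in> carrier_mat m m"
  shows "\<exists>F'. polyfun (entries m) F' \<and> (\<forall>g\<in>carrier_mat m m. F (($$) (a * g)) = F' (($$) g))"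
proof (intro exI[of _ "\<lambda>y. F (\<lambda>(r, c). \<Sum>j<m. a $$ (r, j) * y (j, c))"] conjI ballI)
  show "polyfun (entries m) (\<lambda>y. F (\<lambda>(r, c). \<Sum>j<m. a $$ (r, j) * y (j, c)))"
    by (rule polyfun_compose[OF assms(1)]) (auto intro!: polyfun_intros)
  show "F (($$) (a * g)) = F (\<lambda>(r, c). \<Sum>j<m. a $$ (r, j) * g $$ (j, c))" if "g \<in> carrier_mat m m" for g
    by (rule polyfun_cong[OF assms(1)]) (use mult_entry[OF assms(2) that] in \<open>auto simp del: index_mult_mat(1)\<close>)
qed

lemma polyfun_cell:
  assumes "polyfun (entries m) F" "a \<in> carrier_mat m m"
  shows "polyfun V (\<lambda>x. F (($$) (a * cell x)))"
proof -
  have cell: "polyfun V (\<lambda>x. cell x $$ (j, c))" if "j < m" "c < m" for j c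
    using that ik by (cases "j = c"; cases "k \<le> j \<and> c < k") (auto simp: cell_def intro!: polyfun_intros)
  have "polyfun V (\<lambda>x. F (\<lambda>(r, c). \<Sum>j<m. a $$ (r, j) * cell x $$ (j, c)))"
    by (rule polyfun_compose[OF assms(1)]) (auto intro!: polyfun_intros cell)
  moreover have "F (($$) (a * cell x)) = F (\<lambda>(r, c). \<Sum>j<m. a $$ (r, j) * cell x $$ (j, c))" for x
    by (rule polyfun_cong[OF assms(1)])
      (use mult_entry[OF assms(2) cell_mat] in \<open>auto simp del: index_mult_mat(1)\<close>)
  ultimately show ?thesis by simp
qed

text \<open>With constant \<open>f\<close> this says that the translated cell is open, in general that the
  Zariski topology of the cell is not finer than the one induced from the quotient.\<close>

lemma cell_open:
  assumes w: "w \<in> G" and f: "polyfun V f"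
  shows "openin X {coset (w * cell x) | x. f x \<noteq> 0}"
  unfolding openin_X
proof
  show "{coset (w * cell x) | x. f x \<noteq> 0} \<subseteq> coset ` G"
    using SL_mult_closed[OF w cell_SL] by blast
  define h where "h g = inv\<^bsub>SL m\<^esub> w * g" for g
  have "\<exists>e H. polyfun (entries m) H \<and> (\<forall>y. denom y \<noteq> 0 \<longrightarrow> f (\<lambda>v. numer y v / denom y) * denom y ^ e = H y)"
    by (rule polyfun_quotient[where Y = numer, OF f _ polyfun_denom]) (rule polyfun_numer)
  then obtain e H where
    H0: "polyfun (entries m) H \<and> (\<forall>y. denom y \<noteq> 0 \<longrightarrow> f (\<lambda>v. numer y v / denom y) * denom y ^ e = H y)"
    by (elim exE)
  have "polyfun (entries m) (\<lambda>y. denom y * H y)" using H0 polyfun_denom by (blast intro: polyfun.mult)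
  from polyfun_left_mult[OF this SL_mat[OF SL_inv_closed[OF w]]] obtain F where
    F0: "polyfun (entries m) F \<and> (\<forall>g\<in>carrier_mat m m. denom (($$) (h g)) * H (($$) (h g)) = F (($$) g))"
    unfolding h_def by (elim exE)
  note F = conjunct1[OF F0] conjunct2[OF F0]
  have "coset g \<in> {coset (w * cell x) | x. f x \<noteq> 0} \<longleftrightarrow> F (($$) g) \<noteq> 0" if g: "g \<in> G" for g
  proof -
    let ?y = "\<lambda>v. numer (($$) (h g)) v / denom (($$) (h g))"
    have "coset g \<in> {coset (w * cell x) | x. f x \<noteq> 0} \<longleftrightarrow>
        (\<exists>x. f x \<noteq> 0 \<and> denom (($$) (h g)) \<noteq> 0 \<and> (\<forall>v\<in>V. x v = ?y v))"
      using coset_cell_iff[OF w g] unfolding h_def by blast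
    also have "\<dots> \<longleftrightarrow> denom (($$) (h g)) \<noteq> 0 \<and> f ?y \<noteq> 0"
    proof
      assume "\<exists>x. f x \<noteq> 0 \<and> denom (($$) (h g)) \<noteq> 0 \<and> (\<forall>v\<in>V. x v = ?y v)"
      then obtain x where x: "f x \<noteq> 0" "denom (($$) (h g)) \<noteq> 0" "\<forall>v\<in>V. x v = ?y v" by blast
      have "f x = f ?y" by (rule polyfun_cong[OF f]) (use x(3) in blast)
      then show "denom (($$) (h g)) \<noteq> 0 \<and> f ?y \<noteq> 0" using x by simp
    qed blast
    also have "\<dots> \<longleftrightarrow> denom (($$) (h g)) * H (($$) (h g)) \<noteq> 0"
      using conjunct2[OF H0, rule_format, of "($$) (h g)", symmetric] by auto
    also have "\<dots> \<longleftrightarrow> F (($$) g) \<noteq> 0" using F(2) SL_mat[OF g] by simp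
    finally show ?thesis .
  qed
  then have "{g \<in> G. coset g \<in> {coset (w * cell x) | x. f x \<noteq> 0}} = {g \<in> G. F (($$) g) \<noteq> 0}" by blast
  then show "openin (zariski_SL n) {g \<in> G. coset g \<in> {coset (w * cell x) | x. f x \<noteq> 0}}"
    using openin_basic[OF F(1)] by simp
qed

text \<open>Translate the cell to a point \<open>coset w\<close> of the smallest member, so that it meets every member;
  irreducibility then carries over to the traces \<open>Y l\<close> of the chain in the cell.\<close>

lemma chain_bound:
  fixes Z :: "nat \<Rightarrow> complex mat set set"
  assumes irr: "\<And>l. l \<le> L \<Longrightarrow> irreducible_closedin X (Z l)" and strict: "\<And>l. l < L \<Longrightarrow> Z l \<subset> Z (Suc l)"
  shows "L \<le> i * k"
proof -
  have closed: "closedin X (Z l)" if "l \<le> L" for l using irr[OF that] by (simp add: irreducible_closedin_def)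
  have union: "Z l \<subseteq> A \<or> Z l \<subseteq> B" if "l \<le> L" "closedin X A" "closedin X B" "Z l \<subseteq> A \<union> B" for l A B
    using irr[OF that(1)] that(2-4) unfolding irreducible_closedin_def by blast
  obtain z where z: "z \<in> Z 0" using irr[of 0] by (auto simp: irreducible_closedin_def)
  then obtain w where w: "w \<in> G" "z = coset w"
    using closedin_subset[OF closed[of 0]] by (auto simp: topspace_X)
  have cell0: "cell (\<lambda>_. 0) = 1\<^sub>m m" by (rule eq_matI) (auto simp: cell_def)
  have w0: "coset (w * cell (\<lambda>_. 0)) = z" using w SL_mat[OF w(1)] by (simp add: cell0)
  have mono0: "Z 0 \<subseteq> Z l" if "l \<le> L" for l
    using that by (induction l) (use strict in \<open>auto dest: Suc_le_lessD\<close>)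
  define U where "U f = {coset (w * cell x) | x. f x \<noteq> 0}" for f :: "(nat \<times> nat \<Rightarrow> complex) \<Rightarrow> complex"
  have Uc: "closedin X (topspace X - U f)" if "polyfun V f" for f
    unfolding U_def using cell_open[OF w(1) that] by blast
  define Y where "Y l = {x. coset (w * cell x) \<in> Z l}" for l
  have "\<exists>f. polyfun V f \<and> (\<forall>x\<in>Y l. f x = 0) \<and> (\<exists>x\<in>Y (Suc l). f x \<noteq> 0)" if l: "l < L" for l
  proof -
    have "\<not> Z (Suc l) \<subseteq> topspace X - U (\<lambda>_. 1)"
      using mono0[of "Suc l"] l z w0 by (auto simp: U_def)
    moreover have "\<not> Z (Suc l) \<subseteq> Z l" using strict[OF l] by blast
    ultimately have "\<not> Z (Suc l) \<subseteq> Z l \<union> (topspace X - U (\<lambda>_. 1))"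
      using union[of "Suc l"] closed[of l] Uc[OF polyfun.const] l by (meson Suc_leI less_imp_le)
    then obtain x where x: "coset (w * cell x) \<in> Z (Suc l)" "coset (w * cell x) \<notin> Z l"
      using closedin_subset[OF closed[of "Suc l"]] l by (auto simp: U_def)
    obtain F where
      F: "polyfun (entries m) F" "F (($$) (w * cell x)) \<noteq> 0" "\<forall>h\<in>G. coset h \<in> Z l \<longrightarrow> F (($$) h) = 0"
      by (rule closed_separated[OF closed[OF less_imp_le[OF l]] SL_mult_closed[OF w(1) cell_SL] x(2)])
    show ?thesis
    proof (intro exI[of _ "\<lambda>x. F (($$) (w * cell x))"] conjI ballI)
      show "polyfun V (\<lambda>x. F (($$) (w * cell x)))" by (rule polyfun_cell[OF F(1) SL_mat[OF w(1)]])
      show "F (($$) (w * cell x)) = 0" if "x \<in> Y l" for x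
        using bspec[OF F(3) SL_mult_closed[OF w(1) cell_SL]] that by (simp add: Y_def)
      show "\<exists>x\<in>Y (Suc l). F (($$) (w * cell x)) \<noteq> 0" using F(2) x(1) by (auto simp: Y_def)
    qed
  qed
  then have "\<forall>l\<in>{..<L}. \<exists>f. polyfun V f \<and> (\<forall>x\<in>Y l. f x = 0) \<and> (\<exists>x\<in>Y (Suc l). f x \<noteq> 0)" by simp
  from bchoice[OF this] obtain f where
    f: "\<forall>l\<in>{..<L}. polyfun V (f l) \<and> (\<forall>x\<in>Y l. f l x = 0) \<and> (\<exists>x\<in>Y (Suc l). f l x \<noteq> 0)" by (elim exE)
  have "L \<le> card V"
  proof (rule no_long_chain[where f = f and Z = Y])
    fix l F F' assume l: "l \<le> L" and F: "polyfun V F" "polyfun V F'" and zero: "\<forall>x\<in>Y l. F x * F' x = 0"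
    have "Z l \<subseteq> (topspace X - U F) \<union> (topspace X - U F')"
    proof
      fix y assume y: "y \<in> Z l"
      have "\<not> (y \<in> U F \<and> y \<in> U F')"
      proof
        assume "y \<in> U F \<and> y \<in> U F'"
        then obtain x x' where x: "y = coset (w * cell x)" "F x \<noteq> 0" and x': "y = coset (w * cell x')" "F' x' \<noteq> 0"
          by (auto simp: U_def)
        have "F' x = F' x'" by (rule polyfun_cong[OF F(2)], rule cell_injective[OF w(1)]) (use x x' in auto)
        then show False using zero x x' y by (auto simp: Y_def)
      qed
      then show "y \<in> (topspace X - U F) \<union> (topspace X - U F')"
        using y closedin_subset[OF closed[OF l]] by blast
    qed
    then have "Z l \<subseteq> topspace X - U F \<or> Z l \<subseteq> topspace X - U F'"
      by (rule union[OF l Uc[OF F(1)] Uc[OF F(2)]])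
    then show "(\<forall>x\<in>Y l. F x = 0) \<or> (\<forall>x\<in>Y l. F' x = 0)" by (auto simp: Y_def U_def)
  next
    show "Y 0 \<noteq> {}" using w0 z by (auto simp: Y_def)
    show "Y l \<subseteq> Y (Suc l)" if "l < L" for l using strict[OF that] by (auto simp: Y_def)
  qed (use f in auto)
  then show ?thesis by simp
qed

text \<open>The closures of the coordinate subspaces \<open>T l\<close>, spanned by the first \<open>l\<close> of the coordinates in some
  enumeration \<open>b\<close>. They are irreducible since \<open>T l\<close> contains the line through any two of its points, and
  distinct since the locus in the cell where the \<open>l\<close>-th coordinate is nonzero is open.\<close>

lemma chain_exists:
  "\<exists>Z :: nat \<Rightarrow> complex mat set set. (\<forall>l\<le>i * k. irreducible_closedin X (Z l)) \<and> (\<forall>l<i * k. Z l \<subset> Z (Suc l))"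
proof -
  obtain b where b: "bij_betw b {..<i * k} V"
    using finite_same_card_bij[of "{..<i * k}" V] by auto
  define T where "T l = {x :: nat \<times> nat \<Rightarrow> complex. \<forall>v. x v \<noteq> 0 \<longrightarrow> v \<in> b ` {..<l}}" for l
  define S where "S l = (\<lambda>x. coset (cell x)) ` T l" for l
  define Z where "Z l = X closure_of S l" for l
  have one: "1\<^sub>m m * cell x = cell x" for x by (rule left_mult_one_mat[OF cell_mat])
  have Ssub: "S l \<subseteq> topspace X" for l unfolding S_def topspace_X using cell_SL by blast
  have SZ: "S l \<subseteq> Z l" for l unfolding Z_def by (rule closure_of_subset[OF Ssub])
  have irr: "irreducible_closedin X (Z l)" for l
    unfolding irreducible_closedin_def
  proof (intro conjI allI impI)
    show "closedin X (Z l)" by (simp add: Z_def)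
    have "(\<lambda>_. 0) \<in> T l" by (simp add: T_def)
    then show "Z l \<noteq> {}" using SZ[of l] by (auto simp: S_def)
    fix A B assume AB: "closedin X A \<and> closedin X B \<and> Z l \<subseteq> A \<union> B"
    have "S l \<subseteq> A \<or> S l \<subseteq> B"
    proof (rule ccontr)
      assume "\<not> ?thesis"
      then obtain x y where x: "x \<in> T l" "coset (cell x) \<notin> A" and y: "y \<in> T l" "coset (cell y) \<notin> B"
        by (auto simp: S_def)
      obtain F where F: "polyfun (entries m) F" "F (($$) (cell x)) \<noteq> 0"
          "\<forall>h\<in>G. coset h \<in> A \<longrightarrow> F (($$) h) = 0"
        by (rule closed_separated[OF conjunct1[OF AB] cell_SL x(2)])
      obtain F' where F': "polyfun (entries m) F'" "F' (($$) (cell y)) \<noteq> 0"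
          "\<forall>h\<in>G. coset h \<in> B \<longrightarrow> F' (($$) h) = 0"
        by (rule closed_separated[OF conjunct1[OF conjunct2[OF AB]] cell_SL y(2)])
      define z where "z s = (\<lambda>v. x v + s * (y v - x v))" for s
      have zT: "z s \<in> T l" for s
        unfolding T_def mem_Collect_eq
      proof (intro allI impI, rule ccontr)
        fix v assume "z s v \<noteq> 0" "v \<notin> b ` {..<l}"
        moreover have "x v = 0" "y v = 0" using x(1) y(1) \<open>v \<notin> b ` {..<l}\<close> unfolding T_def by blast+
        ultimately show False by (simp add: z_def)
      qed
      have pf: "polyfun V (\<lambda>x. F (($$) (cell x)))" "polyfun V (\<lambda>x. F' (($$) (cell x)))"
        using polyfun_cell[OF F(1) one_carrier_mat] polyfun_cell[OF F'(1) one_carrier_mat] by (simp_all add: one)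
      obtain p where p: "\<forall>s. F (($$) (cell (z s))) = poly p s"
        using polyfun_line[OF pf(1), of x y] unfolding z_def by (elim exE)
      obtain q where q: "\<forall>s. F' (($$) (cell (z s))) = poly q s"
        using polyfun_line[OF pf(2), of x y] unfolding z_def by (elim exE)
      have "z 0 = x" "z 1 = y" by (auto simp: z_def)
      then have "poly p 0 \<noteq> 0" "poly q 1 \<noteq> 0" using p[rule_format, of 0, symmetric] q[rule_format, of 1, symmetric] F(2) F'(2) by simp_all
      then obtain s where "poly p s \<noteq> 0" "poly q s \<noteq> 0" by (rule poly_common_nonroot)
      then have "coset (cell (z s)) \<notin> A" "coset (cell (z s)) \<notin> B"
        using bspec[OF F(3) cell_SL, of "z s"] bspec[OF F'(3) cell_SL, of "z s"] p q by auto
      moreover have "coset (cell (z s)) \<in> A \<union> B" using zT AB SZ[of l] by (auto simp: S_def)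
      ultimately show False by blast
    qed
    then show "Z l \<subseteq> A \<or> Z l \<subseteq> B" unfolding Z_def using AB by (meson closure_of_minimal)
  qed
  have "Z l \<subset> Z (Suc l)" if l: "l < i * k" for l
  proof
    have "T l \<subseteq> T (Suc l)" by (auto simp: T_def lessThan_Suc)
    then show "Z l \<subseteq> Z (Suc l)" unfolding Z_def S_def by (intro closure_of_mono image_mono)
    define e where "e = (\<lambda>v. if v = b l then 1 else (0 :: complex))"
    have binj: "inj_on b {..<i * k}" and bim: "b ` {..<i * k} = V" using b by (simp_all add: bij_betw_def)
    have bl: "b l \<in> V" unfolding bim[symmetric] using l by simp
    have bl_new: "b l \<notin> b ` {..<l}"
    proof
      assume "b l \<in> b ` {..<l}"
      then obtain j where "j < l" "b l = b j" by blast
      then show False using inj_onD[OF binj, of l j] l by simp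
    qed
    have "e \<in> T (Suc l)" by (auto simp: T_def e_def lessThan_Suc)
    then have "coset (cell e) \<in> Z (Suc l)" using SZ[of "Suc l"] by (auto simp: S_def)
    moreover have "coset (cell e) \<notin> Z l"
    proof -
      define U where "U = {coset (1\<^sub>m m * cell x) | x. x (b l) \<noteq> 0}"
      have "openin X U"
        unfolding U_def by (rule cell_open[OF SL_one_closed polyfun.var[OF bl]])
      then have "closedin X (topspace X - U)" by blast
      moreover have "S l \<subseteq> topspace X - U"
      proof
        fix y assume y: "y \<in> S l"
        then obtain x where x: "x \<in> T l" "y = coset (1\<^sub>m m * cell x)" by (auto simp: S_def one)
        have "y \<notin> U"
        proof
          assume "y \<in> U"
          then obtain x' where x': "y = coset (1\<^sub>m m * cell x')" "x' (b l) \<noteq> 0" by (auto simp: U_def)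
          have "x (b l) = x' (b l)" using x x' by (intro cell_injective[OF SL_one_closed _ bl]) simp
          then have "x (b l) \<noteq> 0" using x'(2) by simp
          then show False using x(1) bl_new unfolding T_def by blast
        qed
        then show "y \<in> topspace X - U" using y Ssub by blast
      qed
      ultimately have "Z l \<subseteq> topspace X - U" unfolding Z_def by (intro closure_of_minimal)
      moreover have "coset (cell e) \<in> U" by (auto simp: U_def one e_def intro!: exI[of _ e])
      ultimately show ?thesis by blast
    qed
    ultimately show "Z l \<noteq> Z (Suc l)" by blast
  qed
  then show ?thesis using irr by blast
qed

lemma krull_dim_flag_space: "krull_dim X = enat (i * k)"
  unfolding krull_dim_def
proof (rule antisym)
  show "Sup {enat L | L. \<exists>Z. (\<forall>j\<le>L. irreducible_closedin X (Z j)) \<and> (\<forall>j<L. Z j \<subset> Z (Suc j))} \<le> enat (i * k)"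
  proof (rule Sup_least)
    fix a assume "a \<in> {enat L | L. \<exists>Z. (\<forall>j\<le>L. irreducible_closedin X (Z j)) \<and> (\<forall>j<L. Z j \<subset> Z (Suc j))}"
    then obtain L Z where a: "a = enat L" "\<forall>j\<le>L. irreducible_closedin X (Z j)" "\<forall>j<L. Z j \<subset> Z (Suc j)" by blast
    have "L \<le> i * k" by (rule chain_bound[of L Z]) (use a in auto)
    then show "a \<le> enat (i * k)" by (simp add: a(1))
  qed
  show "enat (i * k) \<le> Sup {enat L | L. \<exists>Z. (\<forall>j\<le>L. irreducible_closedin X (Z j)) \<and> (\<forall>j<L. Z j \<subset> Z (Suc j))}"
    by (rule Sup_upper) (use chain_exists in blast)
qed

end

section \<open>The Hilbert function in degrees zero and one\<close>

abbreviation cpoly_scale :: "complex \<Rightarrow> 'v cpoly \<Rightarrow> 'v cpoly" where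
  "cpoly_scale c \<equiv> Poly_Mapping.map ((*) c)"

lemma lookup_cpoly_scale: "Poly_Mapping.lookup (cpoly_scale c p) a = c * Poly_Mapping.lookup p a"
  by (simp add: Poly_Mapping.map.rep_eq when_def)

lemma single_key_inject: "Poly_Mapping.single a c = Poly_Mapping.single b c \<Longrightarrow> c \<noteq> 0 \<Longrightarrow> a = b"
  by (drule arg_cong[of _ _ Poly_Mapping.keys]) simp

text \<open>For spaces of polynomials that are spanned by monomials, the dimension is their number.\<close>

lemma poly_dim_monomials:
  fixes b :: "'i \<Rightarrow> 'v \<Rightarrow>\<^sub>0 nat"
  assumes "finite I" "inj_on b I"
    and "\<And>i. i \<in> I \<Longrightarrow> Poly_Mapping.single (b i) 1 \<in> S"
    and keys: "\<And>p. p \<in> S \<Longrightarrow> Poly_Mapping.keys p \<subseteq> b ` I"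
  shows "poly_dim S = card I"
proof -
  interpret vs: vector_space "cpoly_scale :: complex \<Rightarrow> 'v cpoly \<Rightarrow> 'v cpoly" by (rule vector_space_cpoly)
  let ?e = "\<lambda>i. Poly_Mapping.single (b i) (1 :: complex)"
  have inj: "inj_on ?e I"
    using assms(2) by (auto simp: inj_on_def dest!: single_key_inject)
  have comb: "Poly_Mapping.lookup (\<Sum>x\<in>?e ` I. cpoly_scale (c x) x) (b j) = c (?e j)" if "j \<in> I" for c j
  proof -
    have "Poly_Mapping.lookup (\<Sum>x\<in>?e ` I. cpoly_scale (c x) x) (b j) =
        (\<Sum>i\<in>I. c (?e i) * Poly_Mapping.lookup (?e i) (b j))"
      by (simp only: sum.reindex[OF inj] lookup_sum lookup_cpoly_scale o_def)
    also have "\<dots> = (\<Sum>i\<in>I. if i = j then c (?e j) else 0)"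
      by (rule sum.cong) (use that assms(2) in \<open>auto simp: lookup_single when_def inj_on_def\<close>)
    finally show ?thesis using that assms(1) by simp
  qed
  have "vs.independent (?e ` I)"
  proof (rule vs.independent_if_scalars_zero)
    fix c x assume "(\<Sum>x\<in>?e ` I. cpoly_scale (c x) x) = 0" "x \<in> ?e ` I"
    then show "c x = 0" using comb[of _ c] by auto
  qed (use assms(1) in simp)
  moreover have "S \<subseteq> vs.span (?e ` I)"
  proof
    fix p assume "p \<in> S"
    have "p = (\<Sum>i\<in>I. cpoly_scale (Poly_Mapping.lookup p (b i)) (?e i))"
    proof (rule poly_mapping_eqI)
      fix a
      have "Poly_Mapping.lookup p a = (\<Sum>i\<in>I. Poly_Mapping.lookup p (b i) * Poly_Mapping.lookup (?e i) a)"
      proof (cases "a \<in> b ` I")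
        case True
        then obtain j where j: "j \<in> I" "a = b j" by blast
        have "(\<Sum>i\<in>I. Poly_Mapping.lookup p (b i) * Poly_Mapping.lookup (?e i) a) =
            (\<Sum>i\<in>I. if i = j then Poly_Mapping.lookup p (b j) else 0)"
          by (rule sum.cong) (use j assms(2) in \<open>auto simp: lookup_single when_def inj_on_def\<close>)
        then show ?thesis using j assms(1) by simp
      next
        case False
        then have "Poly_Mapping.lookup p a = 0" using keys[OF \<open>p \<in> S\<close>] by (auto simp: in_keys_iff)
        moreover have "(\<Sum>i\<in>I. Poly_Mapping.lookup p (b i) * Poly_Mapping.lookup (?e i) a) = 0"
          by (rule sum.neutral) (use False in \<open>auto simp: lookup_single when_def\<close>)
        ultimately show ?thesis by simp
      qed
      then show "Poly_Mapping.lookup p a =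
          Poly_Mapping.lookup (\<Sum>i\<in>I. cpoly_scale (Poly_Mapping.lookup p (b i)) (?e i)) a"
        by (simp only: lookup_sum lookup_cpoly_scale)
    qed
    also have "\<dots> \<in> vs.span (?e ` I)"
      by (intro vs.span_sum vs.span_scale vs.span_base) auto
    finally show "p \<in> vs.span (?e ` I)" .
  qed
  moreover have "?e ` I \<subseteq> S" using assms(3) by blast
  moreover have "card (?e ` I) = card I" by (rule card_image[OF inj])
  ultimately show ?thesis unfolding poly_dim_def by (intro vs.dim_unique)
qed

lemma poly_dim_zero: "poly_dim ({0} :: 'v cpoly set) = 0"
proof -
  interpret vs: vector_space "cpoly_scale :: complex \<Rightarrow> 'v cpoly \<Rightarrow> 'v cpoly" by (rule vector_space_cpoly)
  show ?thesis unfolding poly_dim_def by (rule vs.dim_unique[of "{}"]) (auto simp: vs.independent_empty)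
qed

lemma homogeneous_0_keys:
  assumes "p \<in> homogeneous_polys V 0" shows "Poly_Mapping.keys p \<subseteq> {0}"
proof
  fix a assume "a \<in> Poly_Mapping.keys p"
  then have "(\<Sum>v\<in>Poly_Mapping.keys a. Poly_Mapping.lookup a v) = 0"
    using assms by (simp add: homogeneous_polys_def)
  then have "Poly_Mapping.lookup a v = 0" for v
    by (cases "v \<in> Poly_Mapping.keys a") (auto simp: in_keys_iff)
  then have "a = 0" by (intro poly_mapping_eqI) simp
  then show "a \<in> {0}" by simp
qed

lemma homogeneous_1_keys:
  assumes "p \<in> homogeneous_polys V 1"
  shows "Poly_Mapping.keys p \<subseteq> (\<lambda>r. Poly_Mapping.single r 1) ` V"
proof
  fix a assume a: "a \<in> Poly_Mapping.keys p"
  then have sum1: "(\<Sum>v\<in>Poly_Mapping.keys a. Poly_Mapping.lookup a v) = 1" and sub: "Poly_Mapping.keys a \<subseteq> V"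
    using assms by (auto simp: homogeneous_polys_def polys_in_def)
  then obtain r where r: "r \<in> Poly_Mapping.keys a" by fastforce
  have split: "Poly_Mapping.lookup a r + (\<Sum>v\<in>Poly_Mapping.keys a - {r}. Poly_Mapping.lookup a v) = 1"
    using sum1 r by (simp add: sum.remove)
  have "Poly_Mapping.lookup a r \<noteq> 0" using r by (simp add: in_keys_iff)
  then have ar: "Poly_Mapping.lookup a r = 1" and "(\<Sum>v\<in>Poly_Mapping.keys a - {r}. Poly_Mapping.lookup a v) = 0"
    using split by linarith+
  then have "\<forall>v\<in>Poly_Mapping.keys a - {r}. Poly_Mapping.lookup a v = 0"
    by (subst (asm) sum_eq_0_iff) auto
  then have "Poly_Mapping.lookup a v = 0" if "v \<noteq> r" for v
    using that by (metis DiffI singletonD in_keys_iff)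
  then have "a = Poly_Mapping.single r 1"
    by (intro poly_mapping_eqI) (auto simp: ar lookup_single when_def)
  then show "a \<in> (\<lambda>r. Poly_Mapping.single r 1) ` V" using r sub by blast
qed

lemma poly_dim_homogeneous_0: "poly_dim (homogeneous_polys V 0) = 1"
  using poly_dim_monomials[of "{()}" "\<lambda>_. 0" "homogeneous_polys V 0"] homogeneous_0_keys[of _ V]
  by (auto simp: homogeneous_polys_def polys_in_def)

lemma inj_variable: "inj_on (\<lambda>r. Poly_Mapping.single r (1 :: nat)) V"
  by (auto simp: inj_on_def dest!: single_key_inject)

lemma poly_dim_homogeneous_1: "finite V \<Longrightarrow> poly_dim (homogeneous_polys V 1) = card V"
proof (rule poly_dim_monomials[OF _ inj_variable])
  show "Poly_Mapping.single (Poly_Mapping.single r 1) 1 \<in> homogeneous_polys V 1" if "r \<in> V" for r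
    using that by (simp add: homogeneous_polys_def polys_in_def)
qed (use homogeneous_1_keys in blast)+

context fundamental_rep
begin

text \<open>The functional that defines the hyperplane \<open>g H\<close>, where \<open>H\<close> is the kernel of \<open>f\<close>.\<close>

definition moved_functional :: "complex mat \<Rightarrow> complex vec" where
  "moved_functional g = transpose_mat (\<rho> (Inv g)) *\<^sub>v f"

lemma moved_functional_prod:
  assumes "g \<in> G" "u \<in> carrier_vec N"
  shows "moved_functional g \<bullet> u = f \<bullet> (\<rho> (Inv g) *\<^sub>v u)"
  unfolding moved_functional_def by (rule transpose_rho[OF SL_inv_closed[OF assms(1)] f_vec(1) assms(2)])

lemma moved_functional_point:
  assumes g: "g \<in> G"
  shows "moved_functional g \<in> carrier_vec N" "moved_functional g \<noteq> 0\<^sub>v N"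
    "hyperplane N (moved_functional g) \<in> flag_image n N \<rho> f"
proof -
  have "transpose_mat (\<rho> (Inv g)) \<in> carrier_mat N N" using rho_mat[OF SL_inv_closed[OF g]] by simp
  then show vec: "moved_functional g \<in> carrier_vec N"
    unfolding moved_functional_def by (rule mult_mat_vec_carrier[OF _ f_vec(1)])
  show "moved_functional g \<noteq> 0\<^sub>v N"
  proof
    assume zero: "moved_functional g = 0\<^sub>v N"
    have "f $ r = 0" if r: "r < N" for r
    proof -
      have "moved_functional g \<bullet> (\<rho> g *\<^sub>v unit_vec N r) = f $ r"
        using moved_functional_prod[OF g rho_vec[OF g unit_vec_carrier]] rho_inv_act(1)[OF g unit_vec_carrier] r by simp
      then show ?thesis using rho_vec[OF g unit_vec_carrier, of r] by (simp add: zero)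
    qed
    then have "f = 0\<^sub>v N" using f_vec(1) by (intro eq_vecI) auto
    then show False using f_vec(2) by simp
  qed
  have "hyperplane N (moved_functional g) = (\<lambda>v. \<rho> g *\<^sub>v v) ` hyperplane N f"
  proof (intro equalityI subsetI)
    fix u assume "u \<in> hyperplane N (moved_functional g)"
    then have u: "u \<in> carrier_vec N" "f \<bullet> (\<rho> (Inv g) *\<^sub>v u) = 0"
      using moved_functional_prod[OF g] by (auto simp: hyperplane_def)
    then have "\<rho> (Inv g) *\<^sub>v u \<in> hyperplane N f"
      using rho_vec[OF SL_inv_closed[OF g]] by (simp add: hyperplane_def)
    moreover have "u = \<rho> g *\<^sub>v (\<rho> (Inv g) *\<^sub>v u)" using rho_inv_act(2)[OF g u(1)] by simp
    ultimately show "u \<in> (\<lambda>v. \<rho> g *\<^sub>v v) ` hyperplane N f" by blast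
  next
    fix u assume "u \<in> (\<lambda>v. \<rho> g *\<^sub>v v) ` hyperplane N f"
    then obtain x where x: "x \<in> carrier_vec N" "f \<bullet> x = 0" "u = \<rho> g *\<^sub>v x" by (auto simp: hyperplane_def)
    then show "u \<in> hyperplane N (moved_functional g)"
      using moved_functional_prod[OF g rho_vec[OF g x(1)]] rho_inv_act(1)[OF g x(1)] rho_vec[OF g x(1)]
      by (simp add: hyperplane_def)
  qed
  then show "hyperplane N (moved_functional g) \<in> flag_image n N \<rho> f"
    unfolding flag_image_def m_eq using g by blast
qed

lemma vanishing_at:
  assumes "p \<in> vanishing_polys N (flag_image n N \<rho> f) d" "g \<in> G"
  shows "eval_poly p (($) (moved_functional g)) = 0"
  using assms moved_functional_point[OF assms(2)] by (simp add: vanishing_polys_def)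

lemma zero_vanishes: "0 \<in> vanishing_polys N (flag_image n N \<rho> f) d"
  by (auto simp: vanishing_polys_def homogeneous_polys_def polys_in_def eval_poly_def)

lemma vanishing_polys_0: "vanishing_polys N (flag_image n N \<rho> f) 0 = {0}"
proof (intro equalityI subsetI)
  fix p assume p: "p \<in> vanishing_polys N (flag_image n N \<rho> f) 0"
  then have "Poly_Mapping.keys p \<subseteq> {0}"
    using homogeneous_0_keys[of p "{..<N}"] by (simp add: vanishing_polys_def)
  then have "eval_poly p (($) (moved_functional (1\<^sub>m m))) = Poly_Mapping.lookup p 0"
    by (subst eval_poly_eq[of "{0}"]) auto
  then have "Poly_Mapping.lookup p 0 = 0" using vanishing_at[OF p SL_one_closed] by simp
  then show "p \<in> {0}" using \<open>Poly_Mapping.keys p \<subseteq> {0}\<close> by (auto intro!: poly_mapping_eqI simp: in_keys_iff)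
qed (use zero_vanishes in auto)

text \<open>A linear form with coefficient vector \<open>c\<close> takes the value \<open>f(\<rho>(g)\<^sup>-\<^sup>1 c)\<close> at the point \<open>g H\<close>.\<close>

lemma vanishing_polys_1: "vanishing_polys N (flag_image n N \<rho> f) 1 = {0}"
proof (intro equalityI subsetI)
  fix p assume p: "p \<in> vanishing_polys N (flag_image n N \<rho> f) 1"
  let ?x = "\<lambda>r :: nat. Poly_Mapping.single r (1 :: nat)"
  have keys: "Poly_Mapping.keys p \<subseteq> ?x ` {..<N}"
    using homogeneous_1_keys[of p "{..<N}"] p by (simp add: vanishing_polys_def)
  define c where "c = vec N (\<lambda>r. Poly_Mapping.lookup p (?x r))"
  have c: "c \<in> carrier_vec N" by (simp add: c_def)
  have eval: "eval_poly p (($) y) = y \<bullet> c" if y: "y \<in> carrier_vec N" for y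
  proof -
    have "eval_poly p (($) y) = (\<Sum>r<N. Poly_Mapping.lookup p (?x r) * y $ r)"
      by (subst eval_poly_eq[OF _ keys], simp, subst sum.reindex[OF inj_variable]) simp
    also have "\<dots> = y \<bullet> c" by (simp add: scalar_prod_sum[OF y c]) (simp add: c_def mult.commute)
    finally show ?thesis .
  qed
  have "f \<bullet> (\<rho> h *\<^sub>v c) = 0" if h: "h \<in> G" for h
  proof -
    have h': "Inv h \<in> G" by (rule SL_inv_closed[OF h])
    have "Inv (Inv h) = h" by (rule group.inv_inv[OF group_SL h])
    then have "f \<bullet> (\<rho> h *\<^sub>v c) = moved_functional (Inv h) \<bullet> c" using moved_functional_prod[OF h' c] by simp
    also have "\<dots> = 0" using eval[OF moved_functional_point(1)[OF h']] vanishing_at[OF p h'] by simp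
    finally show ?thesis .
  qed
  then have c0: "c = 0\<^sub>v N" using separation[OF f_vec c] by blast
  have zero: "Poly_Mapping.lookup p (?x r) = 0" if r: "r < N" for r
  proof -
    have "Poly_Mapping.lookup p (?x r) = c $ r" using r by (simp add: c_def)
    then show ?thesis using r by (simp add: c0)
  qed
  have "Poly_Mapping.keys p = {}"
  proof (rule equals0I)
    fix a assume a: "a \<in> Poly_Mapping.keys p"
    then obtain r where "r < N" "a = ?x r" using keys by auto
    then show False using a zero by (simp add: in_keys_iff)
  qed
  then show "p \<in> {0}" by simp
qed (use zero_vanishes in auto)

lemma hilbert_function_0: "hilbert_function N (flag_image n N \<rho> f) 0 = 1"
  by (simp add: hilbert_function_def vanishing_polys_0 poly_dim_homogeneous_0 poly_dim_zero)

lemma hilbert_function_1: "hilbert_function N (flag_image n N \<rho> f) 1 = N"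
  using poly_dim_homogeneous_1[of "{..<N}"] by (simp add: hilbert_function_def vanishing_polys_1[simplified] poly_dim_zero)

end


section \<open>The second coefficient of the numerator\<close>

lemma numerator_coeff_1:
  fixes H :: "rat fps"
  assumes "H = fps_of_poly g / (1 - fps_X) ^ (d + 1)"
  shows "coeff g 1 = fps_nth H 1 - of_nat (d + 1) * fps_nth H 0"
proof -
  let ?U = "\<lambda>j. (1 - fps_X :: rat fps) ^ j"
  have U0: "fps_nth (?U j) 0 = 1" for j by (induction j) simp_all
  have U1: "fps_nth (?U j) 1 = - of_nat j" for j
  proof (induction j)
    case (Suc j)
    have "fps_nth (?U (Suc j)) 1 = fps_nth (1 - fps_X) 0 * fps_nth (?U j) 1 + fps_nth (1 - fps_X) 1 * fps_nth (?U j) 0"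
      by (simp only: power_Suc fps_mult_nth_1)
    then show ?case by (simp only: Suc.IH U0) simp
  qed simp
  have "H * ?U (d + 1) = fps_of_poly g"
    unfolding assms fps_divide_unit[of "?U (d + 1)", unfolded U0, OF one_neq_zero]
    using inverse_mult_eq_1[of "?U (d + 1)"] U0[of "d + 1"] by (simp add: mult.assoc)
  then have "coeff g 1 = fps_nth (H * ?U (d + 1)) 1" by simp
  also have "\<dots> = fps_nth H 0 * fps_nth (?U (d + 1)) 1 + fps_nth H 1 * fps_nth (?U (d + 1)) 0"
    by (rule fps_mult_nth_1)
  finally show ?thesis by (simp only: U0 U1) (simp add: algebra_simps)
qed

theorem mainTheorem2:
  fixes n i N d :: nat
    and \<rho> :: "complex mat \<Rightarrow> complex mat"
    and f :: "complex vec"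
    and g :: "rat poly"
  assumes "1 \<le> n" and "1 \<le> i" and "i \<le> n"
    and "is_L n (fundamental_weight i) N \<rho>"
    and "generates_B_stable_dual_line n N \<rho> f"
    and "enat d = krull_dim (flag_space n (parabolic n \<rho> f))"
    and "hilbert_series N (flag_image n N \<rho> f) = fps_of_poly g / (1 - fps_X) ^ (d + 1)"
  shows "coeff g 1 = of_nat ((n + 1) choose i) - (of_nat (i * (n - i + 1)) + 1)"
proof -
  obtain v where v: "v \<in> carrier_vec N" "v \<noteq> 0\<^sub>v N" "borel n \<subseteq> line_stabilizer n \<rho> v"
    "\<And>t. t \<in> torus n \<Longrightarrow> \<rho> t *\<^sub>v v = fundamental_weight i t \<cdot>\<^sub>v v"
    using assms(4) unfolding is_L_def has_highest_weight_def by blast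
  define k where "k = n - i + 1"
  interpret rep: fundamental_rep n "n + 1" i k N \<rho> v f
    by unfold_locales (use assms v in \<open>auto simp: k_def is_L_def\<close>)
  interpret gr: grassmannian n "n + 1" i k
    by unfold_locales (use assms in \<open>auto simp: k_def\<close>)
  have d: "d = i * k"
    using assms(6) gr.krull_dim_flag_space by (simp only: rep.parabolic_block) simp
  have "fps_nth (hilbert_series N (flag_image n N \<rho> f)) 0 = 1"
    "fps_nth (hilbert_series N (flag_image n N \<rho> f)) 1 = of_nat N"
    using rep.hilbert_function_0 rep.hilbert_function_1 by (simp_all add: hilbert_series_def)
  then have "coeff g 1 = of_nat N - of_nat (d + 1)"
    using numerator_coeff_1[OF assms(7)] by simp
  then show ?thesis using rep.dimension d by (simp add: k_def)
qed


end
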